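(* Let $N\in\mathbb N$, $s\in(0,1)$, $N>2s$, $2^*_s=2N/(N-2s)$, $\alpha,\beta>1$, $2<\alpha+\beta<2^*_s$, $0<p\le q<1$, $\theta>0$. Let $a\in L^{\frac{2}{1+p}}(\mathbb R^N)$, $b\in L^{\frac{2}{1+q}}(\mathbb R^N)$ with $a(x),b(x)>0$ for all $x\in\mathbb R^N$. Let $V_1,V_2:\mathbb R^N\to\mathbb R$ be continuous with $V_i(x)\ge V_0>0$ for all $x$ (for some constant $V_0$) and $|\{x\in\mathbb R^N: V_i(x)\le M\}|<+\infty$ for all $M>0$, $i=1,2$. Let $\lambda\in(0,\lambda^* )$. Then the system $(S_\lambda)$ admits at least one weak solution $(z,w)\in\mathcal A$ satisfying: (i) $E_\lambda''(z,w)(z,w)^2<0$, that is, $(z,w)\in\mathcal N_\lambda^-\cap\mathcal A=\mathcal N_\lambda^-$; (ii) if $\lambda\in(0,\lambda_* )$ then $E_\lambda(z,w)>0$; (iii) if $\lambda=\lambda_*$ then $E_\lambda(z,w)=0$; (iv) if $\lambda\in(\lambda_*,\lambda^* )$ then $E_\lambda(z,w)<0$.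
   Context: All integrals are over $\mathbb R^N$; $|\cdot|$ of a set is Lebesgue measure. $X=X_1\times X_2$, $X_j=\{u\in H^s(\mathbb R^N):\int V_ju^2dx<\infty\}$, with inner product $\langle(u,v),(\varphi,\psi)\rangle=\iint\frac{[u(x)-u(y)][\varphi(x)-\varphi(y)]+[v(x)-v(y)][\psi(x)-\psi(y)]}{|x-y|^{N+2s}}dxdy+\int V_1u\varphi+V_2v\psi\,dx$ and norm $\|(u,v)\|^2=\langle(u,v),(u,v)\rangle$. The system $(S_\lambda)$ is $(-\Delta)^su+V_1(x)u=\lambda\frac{a(x)}{u^p}+\frac{\alpha}{\alpha+\beta}\theta|u|^{\alpha-2}u|v|^\beta$, $\ (-\Delta)^sv+V_2(x)v=\lambda\frac{b(x)}{v^q}+\frac{\beta}{\alpha+\beta}\theta|u|^\alpha|v|^{\beta-2}v$ in $\mathbb R^N$. A pair $(u,v)\in X$ is a weak solution of $(S_\lambda)$ if for every $(\varphi_1,\varphi_2)\in X$ (all integrals being well defined and finite, with $|0|^{-p}=|0|^{-q}=+\infty$) $\langle(u,v),(\varphi_1,\varphi_2)\rangle-\frac{\theta}{\alpha+\beta}\int(\alpha|u|^{\alpha-2}u\varphi_1|v|^\beta+\beta|u|^\alpha|v|^{\beta-2}v\varphi_2)dx-\lambda\int(a|u|^{-p}\varphi_1+b|v|^{-q}\varphi_2)dx=0.$ Energy: $E_\lambda(u,v)=\frac12\|(u,v)\|^2-\frac{\lambda}{1-p}\int a|u|^{1-p}dx-\frac{\lambda}{1-q}\int b|v|^{1-q}dx-\frac{\theta}{\alpha+\beta}\int|u|^\alpha|v|^\beta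 dx$. Notation (defined by these formulas): $E_\lambda'(u,v)(u,v)=\|(u,v)\|^2-\lambda\int a|u|^{1-p}-\lambda\int b|v|^{1-q}-\theta\int|u|^\alpha|v|^\beta$, $E_\lambda''(u,v)(u,v)^2=2\|(u,v)\|^2-\lambda(1-p)\int a|u|^{1-p}-\lambda(1-q)\int b|v|^{1-q}-\theta(\alpha+\beta)\int|u|^\alpha|v|^\beta$. $\mathcal N_\lambda=\{(u,v)\in X\setminus\{(0,0)\}:E_\lambda'(u,v)(u,v)=0\}$, $\mathcal N_\lambda^-=\{(u,v)\in\mathcal N_\lambda:E_\lambda''(u,v)(u,v)^2<0\}$. $\mathcal A=\{(u,v)\in X:\int|u|^\alpha|v|^\beta dx>0\}$. For $(u,v)\in\mathcal A$, $R_n(u,v)=\dfrac{\|(u,v)\|^2-\theta\int|u|^\alpha|v|^\beta dx}{\int a|u|^{1-p}dx+\int b|v|^{1-q}dx}$, $\quad R_e(u,v)=\dfrac{\frac12\|(u,v)\|^2-\frac{\theta}{\alpha+\beta}\int|u|^\alpha|v|^\beta dx}{\frac1{1-p}\int a|u|^{1-p}dx+\frac1{1-q}\int b|v|^{1-q}dx}$, $\lambda^*=\inf_{(u,v)\in\mathcal A}\max_{t>0}R_n(tu,tv)$, $\lambda_*=\inf_{(u,v)\in\mathcal A}\max_{t>0}R_e(tu,tv)$. *)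

theory Defs
  imports "HOL-Analysis.Analysis"
begin

text \<open>
  Functions are Lebesgue measurable functions on \<open>\<real>\<^sup>N\<close> (the type \<open>real ^ 'n\<close> with \<open>N = CARD('n)\<close>),
  not equivalence classes, so the zero element of a function space is any function that vanishes
  almost everywhere. The convention \<open>0 powr r = 0\<close> is harmless for \<open>|u|\<^sup>\<alpha>\<^sup>-\<^sup>2 u\<close>, where \<open>\<alpha> > 1\<close>, and
  for \<open>|u|\<^sup>1\<^sup>-\<^sup>p\<close>, where \<open>p < 1\<close>; it is not used for the singular power, see \<open>sing_powr\<close>.
\<close>

type_synonym 'n fn = "real ^ 'n \<Rightarrow> real"

definition in_Lp :: "real \<Rightarrow> ('n::finite) fn \<Rightarrow> bool" where
  "in_Lp r f \<longleftrightarrow> f \<in> borel_measurable lebesgue \<and> integrable lebesgue (\<lambda>x. \<bar>f x\<bar> powr r)"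

text \<open>
  In double integrals \<open>lebesgue\<close> is Lebesgue measure on \<open>\<real>\<^sup>N \<times> \<real>\<^sup>N\<close>. On the diagonal, a null set,
  the quotient evaluates to 0.
\<close>

definition frac_sobolev :: "real \<Rightarrow> (('n::finite) fn) set" where
  "frac_sobolev s = {u. in_Lp 2 u \<and>
     integrable lebesgue (\<lambda>(x, y). (u x - u y)\<^sup>2 / norm (x - y) powr (real CARD('n) + 2 * s))}"

definition potential_space :: "real \<Rightarrow> ('n::finite) fn \<Rightarrow> ('n fn) set" where
  "potential_space s V = {u \<in> frac_sobolev s. integrable lebesgue (\<lambda>x. V x * (u x)\<^sup>2)}"

definition X_space :: "real \<Rightarrow> ('n::finite) fn \<Rightarrow> 'n fn \<Rightarrow> ('n fn \<times> 'n fn) set" where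
  "X_space s V1 V2 = potential_space s V1 \<times> potential_space s V2"

definition X_gagliardo_integrand ::
  "real \<Rightarrow> ('n::finite) fn \<times> 'n fn \<Rightarrow> 'n fn \<times> 'n fn \<Rightarrow> (real ^ 'n) \<times> (real ^ 'n) \<Rightarrow> real" where
  "X_gagliardo_integrand s = (\<lambda>(u, v) (\<phi>, \<psi>) (x, y).
     ((u x - u y) * (\<phi> x - \<phi> y) + (v x - v y) * (\<psi> x - \<psi> y))
       / norm (x - y) powr (real CARD('n) + 2 * s))"

definition X_potential_integrand ::
  "('n::finite) fn \<Rightarrow> 'n fn \<Rightarrow> 'n fn \<times> 'n fn \<Rightarrow> 'n fn \<times> 'n fn \<Rightarrow> real ^ 'n \<Rightarrow> real" where
  "X_potential_integrand V1 V2 = (\<lambda>(u, v) (\<phi>, \<psi>) x. V1 x * u x * \<phi> x + V2 x * v x * \<psi> x)"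

definition X_inner ::
  "real \<Rightarrow> ('n::finite) fn \<Rightarrow> 'n fn \<Rightarrow> 'n fn \<times> 'n fn \<Rightarrow> 'n fn \<times> 'n fn \<Rightarrow> real" where
  "X_inner s V1 V2 U \<Phi> =
     integral\<^sup>L lebesgue (X_gagliardo_integrand s U \<Phi>) +
     integral\<^sup>L lebesgue (X_potential_integrand V1 V2 U \<Phi>)"

definition X_norm :: "real \<Rightarrow> ('n::finite) fn \<Rightarrow> 'n fn \<Rightarrow> 'n fn \<times> 'n fn \<Rightarrow> real" where
  "X_norm s V1 V2 U = sqrt (X_inner s V1 V2 U U)"

definition sing_int :: "('n::finite) fn \<Rightarrow> real \<Rightarrow> 'n fn \<Rightarrow> real" where
  "sing_int a p u = integral\<^sup>L lebesgue (\<lambda>x. a x * \<bar>u x\<bar> powr (1 - p))"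

definition coupling_int :: "real \<Rightarrow> real \<Rightarrow> ('n::finite) fn \<times> 'n fn \<Rightarrow> real" where
  "coupling_int \<alpha> \<beta> = (\<lambda>(u, v). integral\<^sup>L lebesgue (\<lambda>x. \<bar>u x\<bar> powr \<alpha> * \<bar>v x\<bar> powr \<beta>))"

subsection \<open>Weak solutions\<close>

definition sing_powr :: "real \<Rightarrow> real \<Rightarrow> ereal" where
  "sing_powr t p = (if t = 0 then \<infinity> else ereal (\<bar>t\<bar> powr (- p)))"

text \<open>
  The Bochner integral does not apply to functions with values in \<open>ereal\<close>, so the Lebesgue integral
  of such a function is written as positive part minus negative part. Note that \<open>e2ennreal\<close>
  sends negative values to 0, and that \<open>\<infinity> * 0 = 0\<close> in \<open>ereal\<close>.
\<close>

definition ext_integrable :: "'b measure \<Rightarrow> ('b \<Rightarrow> ereal) \<Rightarrow> bool" where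
  "ext_integrable M f \<longleftrightarrow> f \<in> borel_measurable M \<and> (\<integral>\<^sup>+x. e2ennreal \<bar>f x\<bar> \<partial>M) < \<infinity>"

definition ext_integral :: "'b measure \<Rightarrow> ('b \<Rightarrow> ereal) \<Rightarrow> real" where
  "ext_integral M f =
     enn2real (\<integral>\<^sup>+x. e2ennreal (f x) \<partial>M) - enn2real (\<integral>\<^sup>+x. e2ennreal (- f x) \<partial>M)"

definition sing_test_integrand :: "('n::finite) fn \<Rightarrow> real \<Rightarrow> 'n fn \<Rightarrow> 'n fn \<Rightarrow> real ^ 'n \<Rightarrow> ereal" where
  "sing_test_integrand a p u \<phi> x = ereal (a x) * sing_powr (u x) p * ereal (\<phi> x)"

definition coupling_test_integrand ::
  "real \<Rightarrow> real \<Rightarrow> ('n::finite) fn \<times> 'n fn \<Rightarrow> 'n fn \<times> 'n fn \<Rightarrow> real ^ 'n \<Rightarrow> real" where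
  "coupling_test_integrand \<alpha> \<beta> = (\<lambda>(u, v) (\<phi>\<^sub>1, \<phi>\<^sub>2) x.
     \<alpha> * \<bar>u x\<bar> powr (\<alpha> - 2) * u x * \<phi>\<^sub>1 x * \<bar>v x\<bar> powr \<beta> +
     \<beta> * \<bar>u x\<bar> powr \<alpha> * \<bar>v x\<bar> powr (\<beta> - 2) * v x * \<phi>\<^sub>2 x)"

text \<open>
  The two singular terms are required to be integrable separately, which avoids \<open>\<infinity> - \<infinity>\<close>; this
  is no restriction, since test pairs with one component equal to zero are allowed.
\<close>

definition weak_solution ::
  "real \<Rightarrow> ('n::finite) fn \<Rightarrow> 'n fn \<Rightarrow> 'n fn \<Rightarrow> 'n fn \<Rightarrow> real \<Rightarrow> real \<Rightarrow> real \<Rightarrow> real \<Rightarrow> real \<Rightarrow> real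
    \<Rightarrow> 'n fn \<times> 'n fn \<Rightarrow> bool" where
  "weak_solution s V1 V2 a b p q \<alpha> \<beta> \<theta> lam = (\<lambda>(u, v).
     (u, v) \<in> X_space s V1 V2 \<and>
     (\<forall>(\<phi>\<^sub>1, \<phi>\<^sub>2) \<in> X_space s V1 V2.
        integrable lebesgue (X_gagliardo_integrand s (u, v) (\<phi>\<^sub>1, \<phi>\<^sub>2)) \<and>
        integrable lebesgue (X_potential_integrand V1 V2 (u, v) (\<phi>\<^sub>1, \<phi>\<^sub>2)) \<and>
        integrable lebesgue (coupling_test_integrand \<alpha> \<beta> (u, v) (\<phi>\<^sub>1, \<phi>\<^sub>2)) \<and>
        ext_integrable lebesgue (sing_test_integrand a p u \<phi>\<^sub>1) \<and>
        ext_integrable lebesgue (sing_test_integrand b q v \<phi>\<^sub>2) \<and>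
        X_inner s V1 V2 (u, v) (\<phi>\<^sub>1, \<phi>\<^sub>2)
          - \<theta> / (\<alpha> + \<beta>) * integral\<^sup>L lebesgue (coupling_test_integrand \<alpha> \<beta> (u, v) (\<phi>\<^sub>1, \<phi>\<^sub>2))
          - lam * (ext_integral lebesgue (sing_test_integrand a p u \<phi>\<^sub>1) +
                   ext_integral lebesgue (sing_test_integrand b q v \<phi>\<^sub>2)) = 0))"

subsection \<open>Energy, Nehari sets and extremal parameters\<close>

definition energy ::
  "real \<Rightarrow> ('n::finite) fn \<Rightarrow> 'n fn \<Rightarrow> 'n fn \<Rightarrow> 'n fn \<Rightarrow> real \<Rightarrow> real \<Rightarrow> real \<Rightarrow> real \<Rightarrow> real \<Rightarrow> real
    \<Rightarrow> 'n fn \<times> 'n fn \<Rightarrow> real" where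
  "energy s V1 V2 a b p q \<alpha> \<beta> \<theta> lam = (\<lambda>(u, v).
     1 / 2 * (X_norm s V1 V2 (u, v))\<^sup>2
       - lam / (1 - p) * sing_int a p u - lam / (1 - q) * sing_int b q v
       - \<theta> / (\<alpha> + \<beta>) * coupling_int \<alpha> \<beta> (u, v))"

text \<open>The values \<open>E'(u,v)(u,v)\<close> and \<open>E''(u,v)(u,v)\<^sup>2\<close>; these formulas are their definitions.\<close>

definition energy' ::
  "real \<Rightarrow> ('n::finite) fn \<Rightarrow> 'n fn \<Rightarrow> 'n fn \<Rightarrow> 'n fn \<Rightarrow> real \<Rightarrow> real \<Rightarrow> real \<Rightarrow> real \<Rightarrow> real \<Rightarrow> real
    \<Rightarrow> 'n fn \<times> 'n fn \<Rightarrow> real" where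
  "energy' s V1 V2 a b p q \<alpha> \<beta> \<theta> lam = (\<lambda>(u, v).
     (X_norm s V1 V2 (u, v))\<^sup>2
       - lam * sing_int a p u - lam * sing_int b q v
       - \<theta> * coupling_int \<alpha> \<beta> (u, v))"

definition energy'' ::
  "real \<Rightarrow> ('n::finite) fn \<Rightarrow> 'n fn \<Rightarrow> 'n fn \<Rightarrow> 'n fn \<Rightarrow> real \<Rightarrow> real \<Rightarrow> real \<Rightarrow> real \<Rightarrow> real \<Rightarrow> real
    \<Rightarrow> 'n fn \<times> 'n fn \<Rightarrow> real" where
  "energy'' s V1 V2 a b p q \<alpha> \<beta> \<theta> lam = (\<lambda>(u, v).
     2 * (X_norm s V1 V2 (u, v))\<^sup>2
       - lam * (1 - p) * sing_int a p u - lam * (1 - q) * sing_int b q v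
       - \<theta> * (\<alpha> + \<beta>) * coupling_int \<alpha> \<beta> (u, v))"

definition nehari ::
  "real \<Rightarrow> ('n::finite) fn \<Rightarrow> 'n fn \<Rightarrow> 'n fn \<Rightarrow> 'n fn \<Rightarrow> real \<Rightarrow> real \<Rightarrow> real \<Rightarrow> real \<Rightarrow> real \<Rightarrow> real
    \<Rightarrow> ('n fn \<times> 'n fn) set" where
  "nehari s V1 V2 a b p q \<alpha> \<beta> \<theta> lam = {(u, v) \<in> X_space s V1 V2.
     \<not> (AE x in lebesgue. u x = 0 \<and> v x = 0) \<and>
     energy' s V1 V2 a b p q \<alpha> \<beta> \<theta> lam (u, v) = 0}"

definition nehari_minus ::
  "real \<Rightarrow> ('n::finite) fn \<Rightarrow> 'n fn \<Rightarrow> 'n fn \<Rightarrow> 'n fn \<Rightarrow> real \<Rightarrow> real \<Rightarrow> real \<Rightarrow> real \<Rightarrow> real \<Rightarrow> real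
    \<Rightarrow> ('n fn \<times> 'n fn) set" where
  "nehari_minus s V1 V2 a b p q \<alpha> \<beta> \<theta> lam =
     {U \<in> nehari s V1 V2 a b p q \<alpha> \<beta> \<theta> lam. energy'' s V1 V2 a b p q \<alpha> \<beta> \<theta> lam U < 0}"

definition A_set ::
  "real \<Rightarrow> ('n::finite) fn \<Rightarrow> 'n fn \<Rightarrow> real \<Rightarrow> real \<Rightarrow> ('n fn \<times> 'n fn) set" where
  "A_set s V1 V2 \<alpha> \<beta> = {U \<in> X_space s V1 V2. coupling_int \<alpha> \<beta> U > 0}"

definition R_n ::
  "real \<Rightarrow> ('n::finite) fn \<Rightarrow> 'n fn \<Rightarrow> 'n fn \<Rightarrow> 'n fn \<Rightarrow> real \<Rightarrow> real \<Rightarrow> real \<Rightarrow> real \<Rightarrow> real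
    \<Rightarrow> 'n fn \<times> 'n fn \<Rightarrow> real" where
  "R_n s V1 V2 a b p q \<alpha> \<beta> \<theta> = (\<lambda>(u, v).
     ((X_norm s V1 V2 (u, v))\<^sup>2 - \<theta> * coupling_int \<alpha> \<beta> (u, v))
       / (sing_int a p u + sing_int b q v))"

definition R_e ::
  "real \<Rightarrow> ('n::finite) fn \<Rightarrow> 'n fn \<Rightarrow> 'n fn \<Rightarrow> 'n fn \<Rightarrow> real \<Rightarrow> real \<Rightarrow> real \<Rightarrow> real \<Rightarrow> real
    \<Rightarrow> 'n fn \<times> 'n fn \<Rightarrow> real" where
  "R_e s V1 V2 a b p q \<alpha> \<beta> \<theta> = (\<lambda>(u, v).
     (1 / 2 * (X_norm s V1 V2 (u, v))\<^sup>2 - \<theta> / (\<alpha> + \<beta>) * coupling_int \<alpha> \<beta> (u, v))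
       / (1 / (1 - p) * sing_int a p u + 1 / (1 - q) * sing_int b q v))"

text \<open>
  The maxima over \<open>t > 0\<close> are written as suprema, and suprema and infima are taken in \<open>ereal\<close>, so
  that no value depends on the unspecified supremum of an unbounded set of reals.
\<close>

definition lambda_upper ::
  "real \<Rightarrow> ('n::finite) fn \<Rightarrow> 'n fn \<Rightarrow> 'n fn \<Rightarrow> 'n fn \<Rightarrow> real \<Rightarrow> real \<Rightarrow> real \<Rightarrow> real \<Rightarrow> real \<Rightarrow> ereal" where
  "lambda_upper s V1 V2 a b p q \<alpha> \<beta> \<theta> =
     (INF (u, v) \<in> A_set s V1 V2 \<alpha> \<beta>. SUP t \<in> {0<..}.
        ereal (R_n s V1 V2 a b p q \<alpha> \<beta> \<theta> (\<lambda>x. t * u x, \<lambda>x. t * v x)))"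

definition lambda_lower ::
  "real \<Rightarrow> ('n::finite) fn \<Rightarrow> 'n fn \<Rightarrow> 'n fn \<Rightarrow> 'n fn \<Rightarrow> real \<Rightarrow> real \<Rightarrow> real \<Rightarrow> real \<Rightarrow> real \<Rightarrow> ereal" where
  "lambda_lower s V1 V2 a b p q \<alpha> \<beta> \<theta> =
     (INF (u, v) \<in> A_set s V1 V2 \<alpha> \<beta>. SUP t \<in> {0<..}.
        ereal (R_e s V1 V2 a b p q \<alpha> \<beta> \<theta> (\<lambda>x. t * u x, \<lambda>x. t * v x)))"

end

theory Submission
  imports Defs "HOL-Complex_Analysis.Great_Picard"
begin

text \<open>
  A minimizer of the energy on \<open>\<N>\<^sup>-\<close> is a weak solution; it is found by the direct method. Divided by \<open>t\<close>,
  the derivative of \<open>t \<mapsto> E (t u, t v)\<close> is concave in \<open>ln t\<close>, so for \<open>lam\<close> below the extremal value every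
  fibre through \<open>\<A>\<close> meets \<open>\<N>\<^sup>-\<close> exactly where the energy has its local maximum. On \<open>\<N>\<^sup>-\<close> the coupling
  integral is bounded below, hence it survives in the limit of a minimizing sequence, and the
  fibre of the limit is compared with those of the sequence just below its own maximum, where the
  slopes are positive; this needs only Fatou's lemma for the norm.

  Compactness in \<open>L\<^sup>2\<close> comes from averaging over dyadic cubes: the error is controlled by the Gagliardo
  seminorm, the averages converge along a diagonal subsequence, and the set where the potential is
  small has finite measure. The subcritical Sobolev inequality upgrades this to \<open>L\<^sup>r\<close>; it follows from
  the pointwise bound \<open>\<bar>u x\<bar> powr (2 + 2 s q / N) \<le> K * \<integral> (u x - u y)\<^sup>2 / norm (x - y) powr (N + 2 s)\<close>
  for functions with bounded \<open>L\<^sup>q\<close> norm, by iteration in \<open>q\<close>.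

  In nonnegative directions concavity of \<open>t powr (1 - p)\<close> turns minimality into a one-sided variational
  inequality, which forces positivity of both components. Testing it with the positive part of
  \<open>z + e * \<phi>\<close> gives the equation, since the negative part contributes \<open>o(e)\<close>.
\<close>

section \<open>Gagliardo forms on Borel functions\<close>

text \<open>On a fibre through a pair in \<open>A_set\<close>, \<open>lam < R_n\<close> at the
  parameter \<open>t\<close> says that the slope of the energy is positive there, and the energy at
  \<open>t\<close> is \<open>R_e - lam\<close> times the positive denominator of \<open>R_e\<close>.
  So \<open>lambda_upper\<close> guarantees a rising piece on every fibre, while
  \<open>lambda_lower\<close> decides whether all fibres reach positive energy or some fibre stays
  negative throughout. Two obstacles shape the argument. First, \<open>nehari_minus\<close> is not
  closed: a limit can have smaller norm and leave the set. This is repaired by projecting the limit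
  along its own fibre, which \<open>lam < lambda_upper\<close> permits. Second, the powers
  \<open>1 - p\<close> and \<open>1 - q\<close> make the energy nondifferentiable, so neither
  Lagrange multipliers nor the implicit function theorem are at hand. A perturbed pair is therefore
  projected by some factor \<open>t\<close>, and its energy is compared with that of the minimizer
  at the same \<open>t\<close>; only bounds on \<open>t\<close> enter, never a derivative of the
  projection.\<close>

text \<open>Borel measurable representatives are used throughout, because Fubini's theorem is available for
  \<open>lborel\<close> but not for its completion.\<close>

definition gagliardo :: "real \<Rightarrow> ('n::finite) fn \<Rightarrow> 'n fn \<Rightarrow> (real ^ 'n) \<times> (real ^ 'n) \<Rightarrow> real" where
  "gagliardo s u \<phi> = (\<lambda>(x, y). (u x - u y) * (\<phi> x - \<phi> y) / norm (x - y) powr (real CARD('n) + 2 * s))"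

definition borel_potential :: "real \<Rightarrow> ('n::finite) fn \<Rightarrow> 'n fn set" where
  "borel_potential s V = {u \<in> borel_measurable borel. integrable lborel (\<lambda>x. (u x)\<^sup>2) \<and>
     integrable lborel (gagliardo s u u) \<and> integrable lborel (\<lambda>x. V x * (u x)\<^sup>2)}"

text \<open>One component of \<open>X_inner\<close>. The inner product of the product space is a sum
  of two such forms, so compactness and semicontinuity are proved once, for a single function and a
  single potential.\<close>

definition sobolev_form :: "real \<Rightarrow> ('n::finite) fn \<Rightarrow> 'n fn \<Rightarrow> 'n fn \<Rightarrow> real" where
  "sobolev_form s V u \<phi> = integral\<^sup>L lborel (gagliardo s u \<phi>) + integral\<^sup>L lborel (\<lambda>x. V x * u x * \<phi> x)"

lemma gagliardo_apply: "gagliardo s u \<phi> (x, y) = (u x - u y) * (\<phi> x - \<phi> y) / norm (x - y) powr (real CARD('n) + 2 * s)"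
  for u \<phi> :: "('n::finite) fn"
  by (simp add: gagliardo_def)

lemma gagliardo_commute: "gagliardo s u \<phi> = gagliardo s \<phi> u"
  by (auto simp: gagliardo_def mult.commute)

lemma gagliardo_self_nonneg [simp]: "0 \<le> gagliardo s u u z"
  by (cases z) (simp add: gagliardo_apply)

lemma gagliardo_measurable [measurable]:
  fixes u \<phi> :: "('n::finite) fn"
  assumes [measurable]: "u \<in> borel_measurable borel" "\<phi> \<in> borel_measurable borel"
  shows "gagliardo s u \<phi> \<in> borel_measurable borel"
proof -
  have [measurable]: "(\<lambda>z::(real^'n)\<times>(real^'n). u (fst z)) \<in> borel_measurable borel"
    "(\<lambda>z::(real^'n)\<times>(real^'n). u (snd z)) \<in> borel_measurable borel"
    "(\<lambda>z::(real^'n)\<times>(real^'n). \<phi> (fst z)) \<in> borel_measurable borel"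
    "(\<lambda>z::(real^'n)\<times>(real^'n). \<phi> (snd z)) \<in> borel_measurable borel"
    unfolding borel_prod[symmetric] by measurable
  have [measurable]: "(\<lambda>z::(real^'n)\<times>(real^'n). norm (fst z - snd z)) \<in> borel_measurable borel"
    by (intro borel_measurable_continuous_onI continuous_intros)
  show ?thesis
    unfolding gagliardo_def case_prod_unfold by measurable
qed

lemma abs_mult_le_squares: "\<bar>x * y\<bar> \<le> x\<^sup>2 + (y::real)\<^sup>2"
proof -
  have "2 * (\<bar>x\<bar> * \<bar>y\<bar>) \<le> x\<^sup>2 + y\<^sup>2" "0 \<le> \<bar>x\<bar> * \<bar>y\<bar>"
    using sum_squares_bound[of "\<bar>x\<bar>" "\<bar>y\<bar>"] by (simp_all add: mult.assoc)
  then show ?thesis unfolding abs_mult by linarith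
qed

text \<open>Young's inequality, applied pointwise, takes the place of Cauchy-Schwarz: only
  integrability of the mixed integrand is wanted, and the two diagonal integrands majorize
  it.\<close>

lemma abs_gagliardo_le: "\<bar>gagliardo s u \<phi> z\<bar> \<le> gagliardo s u u z + gagliardo s \<phi> \<phi> z"
proof (cases z)
  case (Pair x y)
  show ?thesis
    using divide_right_mono[OF abs_mult_le_squares[of "u x - u y" "\<phi> x - \<phi> y"],
        of "norm (x - y) powr (real CARD('a) + 2 * s)"]
    by (simp add: Pair gagliardo_apply abs_mult power2_eq_square add_divide_distrib)
qed

section \<open>The form domain of one potential\<close>

locale positive_potential =
  fixes s V0 :: real and V :: "('n::finite) fn"
  assumes V_borel [measurable]: "V \<in> borel_measurable borel"
    and V0_pos: "V0 > 0" and V_ge: "\<And>x. V x \<ge> V0"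
begin

lemma V_nonneg [simp]: "0 \<le> V x"
  using V0_pos V_ge[of x] by linarith

lemma borel_potentialD:
  assumes "u \<in> borel_potential s V"
  shows "u \<in> borel_measurable borel" "integrable lborel (\<lambda>x. (u x)\<^sup>2)"
    "integrable lborel (gagliardo s u u)" "integrable lborel (\<lambda>x. V x * (u x)\<^sup>2)"
  using assms by (auto simp: borel_potential_def)

lemma gagliardo_integrable:
  assumes "u \<in> borel_potential s V" "\<phi> \<in> borel_potential s V"
  shows "integrable lborel (gagliardo s u \<phi>)"
proof (rule Bochner_Integration.integrable_bound)
  show "integrable lborel (\<lambda>z. gagliardo s u u z + gagliardo s \<phi> \<phi> z)"
    using assms by (auto simp: borel_potential_def)
  show "gagliardo s u \<phi> \<in> borel_measurable lborel"
    using gagliardo_measurable[OF borel_potentialD(1)[OF assms(1)] borel_potentialD(1)[OF assms(2)]] by simp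
  show "AE z in lborel. norm (gagliardo s u \<phi> z) \<le> norm (gagliardo s u u z + gagliardo s \<phi> \<phi> z)"
    using abs_gagliardo_le[of s u \<phi>] by (auto intro: order_trans[OF _ abs_ge_self])
qed

lemma potential_integrable:
  assumes "u \<in> borel_potential s V" "\<phi> \<in> borel_potential s V"
  shows "integrable lborel (\<lambda>x. V x * u x * \<phi> x)"
proof (rule Bochner_Integration.integrable_bound)
  note [measurable] = borel_potentialD(1)[OF assms(1)] borel_potentialD(1)[OF assms(2)]
  show "integrable lborel (\<lambda>x. V x * (u x)\<^sup>2 + V x * (\<phi> x)\<^sup>2)"
    using assms by (auto simp: borel_potential_def)
  show "(\<lambda>x. V x * u x * \<phi> x) \<in> borel_measurable lborel"
    by measurable
  show "AE x in lborel. norm (V x * u x * \<phi> x) \<le> norm (V x * (u x)\<^sup>2 + V x * (\<phi> x)\<^sup>2)"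
  proof (rule AE_I2)
    fix x
    have "V x * \<bar>u x * \<phi> x\<bar> \<le> V x * ((u x)\<^sup>2 + (\<phi> x)\<^sup>2)"
      by (intro mult_left_mono abs_mult_le_squares) simp
    then show "norm (V x * u x * \<phi> x) \<le> norm (V x * (u x)\<^sup>2 + V x * (\<phi> x)\<^sup>2)"
      by (simp add: abs_mult algebra_simps)
  qed
qed

lemma gagliardo_scale_add:
  "gagliardo s (\<lambda>x. c * u x + d * v x) \<phi> z = c * gagliardo s u \<phi> z + d * gagliardo s v \<phi> z"
  by (cases z) (simp add: gagliardo_apply algebra_simps add_divide_distrib[symmetric])

lemma square_add_le: "(c * x + d * y)\<^sup>2 \<le> 2 * c\<^sup>2 * x\<^sup>2 + 2 * d\<^sup>2 * (y::real)\<^sup>2"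
proof -
  have "0 \<le> (c * x - d * y)\<^sup>2" by simp
  then show ?thesis by (simp add: power2_eq_square algebra_simps)
qed

lemma borel_potential_lincomb:
  assumes u: "u \<in> borel_potential s V" and v: "v \<in> borel_potential s V"
  shows "(\<lambda>x. c * u x + d * v x) \<in> borel_potential s V"
  unfolding borel_potential_def
proof (intro CollectI conjI)
  note [measurable] = borel_potentialD(1)[OF u] borel_potentialD(1)[OF v]
  let ?w = "\<lambda>x. c * u x + d * v x"
  show "?w \<in> borel_measurable borel" by measurable
  show "integrable lborel (\<lambda>x. (?w x)\<^sup>2)"
  proof (rule Bochner_Integration.integrable_bound)
    show "integrable lborel (\<lambda>x. 2 * c\<^sup>2 * (u x)\<^sup>2 + 2 * d\<^sup>2 * (v x)\<^sup>2)"
      using u v by (auto simp: borel_potential_def)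
    show "AE x in lborel. norm ((?w x)\<^sup>2) \<le> norm (2 * c\<^sup>2 * (u x)\<^sup>2 + 2 * d\<^sup>2 * (v x)\<^sup>2)"
      using square_add_le by (auto intro: order_trans[OF _ abs_ge_self])
  qed measurable
  show "integrable lborel (\<lambda>x. V x * (?w x)\<^sup>2)"
  proof (rule Bochner_Integration.integrable_bound)
    show "integrable lborel (\<lambda>x. 2 * c\<^sup>2 * (V x * (u x)\<^sup>2) + 2 * d\<^sup>2 * (V x * (v x)\<^sup>2))"
      using u v by (auto simp: borel_potential_def)
    show "AE x in lborel. norm (V x * (?w x)\<^sup>2) \<le> norm (2 * c\<^sup>2 * (V x * (u x)\<^sup>2) + 2 * d\<^sup>2 * (V x * (v x)\<^sup>2))"
    proof (rule AE_I2)
      fix x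
      have "V x * (?w x)\<^sup>2 \<le> V x * (2 * c\<^sup>2 * (u x)\<^sup>2 + 2 * d\<^sup>2 * (v x)\<^sup>2)"
        by (intro mult_left_mono square_add_le) simp
      then show "norm (V x * (?w x)\<^sup>2) \<le> norm (2 * c\<^sup>2 * (V x * (u x)\<^sup>2) + 2 * d\<^sup>2 * (V x * (v x)\<^sup>2))"
        by (simp add: algebra_simps)
    qed
  qed measurable
  show "integrable lborel (gagliardo s ?w ?w)"
  proof -
    have "gagliardo s ?w ?w z = c\<^sup>2 * gagliardo s u u z + 2 * c * d * gagliardo s u v z + d\<^sup>2 * gagliardo s v v z" for z
      by (cases z) (simp add: gagliardo_apply power2_eq_square algebra_simps add_divide_distrib diff_divide_distrib)
    then have "gagliardo s ?w ?w = (\<lambda>z. c\<^sup>2 * gagliardo s u u z + 2 * c * d * gagliardo s u v z + d\<^sup>2 * gagliardo s v v z)"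
      by (intro ext)
    then show ?thesis
      using gagliardo_integrable[OF u u] gagliardo_integrable[OF u v] gagliardo_integrable[OF v v] by simp
  qed
qed

lemma borel_potential_scale: "u \<in> borel_potential s V \<Longrightarrow> (\<lambda>x. c * u x) \<in> borel_potential s V"
  using borel_potential_lincomb[of u u c 0] by simp

lemma borel_potential_add: "u \<in> borel_potential s V \<Longrightarrow> v \<in> borel_potential s V \<Longrightarrow> (\<lambda>x. u x + v x) \<in> borel_potential s V"
  using borel_potential_lincomb[of u v 1 1] by simp

lemma borel_potential_diff: "u \<in> borel_potential s V \<Longrightarrow> v \<in> borel_potential s V \<Longrightarrow> (\<lambda>x. u x - v x) \<in> borel_potential s V"
  using borel_potential_lincomb[of u v 1 "-1"] by simp

lemma sobolev_form_commute: "sobolev_form s V u \<phi> = sobolev_form s V \<phi> u"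
  unfolding sobolev_form_def by (simp add: gagliardo_commute[of s u] mult.assoc mult.commute[of "u _"])

lemma sobolev_form_lincomb_left:
  assumes "u \<in> borel_potential s V" "v \<in> borel_potential s V" "\<phi> \<in> borel_potential s V"
  shows "sobolev_form s V (\<lambda>x. c * u x + d * v x) \<phi> = c * sobolev_form s V u \<phi> + d * sobolev_form s V v \<phi>"
proof -
  have "(\<lambda>x. V x * (c * u x + d * v x) * \<phi> x) = (\<lambda>x. c * (V x * u x * \<phi> x) + d * (V x * v x * \<phi> x))"
    by (auto simp: algebra_simps)
  moreover have "gagliardo s (\<lambda>x. c * u x + d * v x) \<phi> = (\<lambda>z. c * gagliardo s u \<phi> z + d * gagliardo s v \<phi> z)"
    by (intro ext gagliardo_scale_add)
  ultimately show ?thesis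
    unfolding sobolev_form_def
    using gagliardo_integrable[OF assms(1,3)] gagliardo_integrable[OF assms(2,3)]
      potential_integrable[OF assms(1,3)] potential_integrable[OF assms(2,3)]
    by (simp add: algebra_simps)
qed

lemma sobolev_form_lincomb_right:
  assumes "u \<in> borel_potential s V" "v \<in> borel_potential s V" "\<phi> \<in> borel_potential s V"
  shows "sobolev_form s V \<phi> (\<lambda>x. c * u x + d * v x) = c * sobolev_form s V \<phi> u + d * sobolev_form s V \<phi> v"
  using sobolev_form_lincomb_left[OF assms] by (simp add: sobolev_form_commute)

lemma sobolev_form_scale_scale:
  assumes "u \<in> borel_potential s V"
  shows "sobolev_form s V (\<lambda>x. c * u x) (\<lambda>x. c * u x) = c\<^sup>2 * sobolev_form s V u u"
  using sobolev_form_lincomb_left[OF assms assms borel_potential_scale[OF assms, of c], of c 0]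
    sobolev_form_lincomb_right[OF assms assms assms, of c 0]
  by (simp add: power2_eq_square)

lemma sobolev_form_add_scale:
  assumes "u \<in> borel_potential s V" "\<phi> \<in> borel_potential s V"
  shows "sobolev_form s V (\<lambda>x. u x + c * \<phi> x) (\<lambda>x. u x + c * \<phi> x) =
    sobolev_form s V u u + 2 * c * sobolev_form s V u \<phi> + c\<^sup>2 * sobolev_form s V \<phi> \<phi>"
proof -
  have w: "(\<lambda>x. u x + c * \<phi> x) \<in> borel_potential s V"
    using borel_potential_lincomb[OF assms, of 1 c] by simp
  have "sobolev_form s V (\<lambda>x. u x + c * \<phi> x) (\<lambda>x. u x + c * \<phi> x) =
     sobolev_form s V u (\<lambda>x. u x + c * \<phi> x) + c * sobolev_form s V \<phi> (\<lambda>x. u x + c * \<phi> x)"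
    using sobolev_form_lincomb_left[OF assms w, of 1 c] by simp
  also have "\<dots> = sobolev_form s V u u + c * sobolev_form s V u \<phi> + c * (sobolev_form s V \<phi> u + c * sobolev_form s V \<phi> \<phi>)"
    using sobolev_form_lincomb_right[OF assms assms(1), of 1 c] sobolev_form_lincomb_right[OF assms assms(2), of 1 c]
    by simp
  finally show ?thesis by (simp add: sobolev_form_commute[of \<phi> u] power2_eq_square algebra_simps)
qed

lemma sobolev_form_self_ge:
  assumes "u \<in> borel_potential s V"
  shows "V0 * (LBINT x. (u x)\<^sup>2) \<le> sobolev_form s V u u"
    "(LBINT z. gagliardo s u u z) \<le> sobolev_form s V u u"
    "(LBINT x. V x * (u x)\<^sup>2) \<le> sobolev_form s V u u"
    "0 \<le> sobolev_form s V u u"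
proof -
  have "(LBINT x. V0 * (u x)\<^sup>2) \<le> (LBINT x. V x * (u x)\<^sup>2)"
    using borel_potentialD[OF assms] V_ge by (intro integral_mono) (auto intro: mult_right_mono)
  then have 1: "V0 * (LBINT x. (u x)\<^sup>2) \<le> (LBINT x. V x * (u x)\<^sup>2)"
    by simp
  have 2: "0 \<le> (LBINT z. gagliardo s u u z)" "0 \<le> (LBINT x. V x * (u x)\<^sup>2)"
    by (auto intro!: integral_nonneg)
  have 3: "sobolev_form s V u u = (LBINT z. gagliardo s u u z) + (LBINT x. V x * (u x)\<^sup>2)"
    by (simp add: sobolev_form_def power2_eq_square mult.assoc)
  show "V0 * (LBINT x. (u x)\<^sup>2) \<le> sobolev_form s V u u"
    "(LBINT z. gagliardo s u u z) \<le> sobolev_form s V u u"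
    "(LBINT x. V x * (u x)\<^sup>2) \<le> sobolev_form s V u u"
    "0 \<le> sobolev_form s V u u"
    using 1 2 3 by linarith+
qed

text \<open>Fatou's lemma bounds nonnegative integrals of the limit, one for the seminorm and one
  for the potential part; this identity carries the two bounds back to the form.\<close>

lemma ennreal_sobolev_form_self:
  assumes "u \<in> borel_potential s V"
  shows "ennreal (sobolev_form s V u u) =
    (\<integral>\<^sup>+z. ennreal (gagliardo s u u z) \<partial>lborel) + (\<integral>\<^sup>+x. ennreal (V x * (u x)\<^sup>2) \<partial>lborel)"
proof -
  have 3: "sobolev_form s V u u = (LBINT z. gagliardo s u u z) + (LBINT x. V x * (u x)\<^sup>2)"
    by (simp add: sobolev_form_def power2_eq_square mult.assoc)
  show ?thesis
    unfolding 3 using borel_potentialD[OF assms]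
    by (subst (1 2) nn_integral_eq_integral) (auto intro!: ennreal_plus integral_nonneg)
qed

text \<open>Normal contractions operate on the form: a 1-Lipschitz map fixing 0 decreases both
  \<open>\<bar>u x - u y\<bar>\<close> and \<open>\<bar>u x\<bar>\<close>, hence every integrand
  pointwise. This keeps absolute values, positive parts and negative parts in the space.\<close>

lemma borel_potential_lipschitz:
  assumes u: "u \<in> borel_potential s V" and g: "\<And>a b. \<bar>g a - g b\<bar> \<le> \<bar>a - b\<bar>" "g 0 = 0"
  shows "(\<lambda>x. g (u x)) \<in> borel_potential s V"
    "sobolev_form s V (\<lambda>x. g (u x)) (\<lambda>x. g (u x)) \<le> sobolev_form s V u u"
proof -
  note [measurable] = borel_potentialD(1)[OF u]
  have "continuous_on UNIV g"
    using g(1) by (intro lipschitz_on_continuous_on[of 1] lipschitz_onI) (auto simp: dist_real_def)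
  then have [measurable]: "g \<in> borel_measurable borel"
    by (rule borel_measurable_continuous_onI)
  have sq: "(g a - g b)\<^sup>2 \<le> (a - b)\<^sup>2" for a b
    using g(1)[of a b] by (simp add: abs_le_square_iff)
  have sq0: "(g a)\<^sup>2 \<le> a\<^sup>2" for a
    using sq[of a 0] g(2) by simp
  have G: "gagliardo s (\<lambda>x. g (u x)) (\<lambda>x. g (u x)) z \<le> gagliardo s u u z" for z
    using sq by (cases z) (auto simp: gagliardo_apply power2_eq_square[symmetric] intro!: divide_right_mono)
  have Vg: "V x * (g (u x))\<^sup>2 \<le> V x * (u x)\<^sup>2" for x
    using sq0 by (intro mult_left_mono) auto
  have [measurable]: "gagliardo s (\<lambda>x. g (u x)) (\<lambda>x. g (u x)) \<in> borel_measurable borel"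
    by measurable
  show mem: "(\<lambda>x. g (u x)) \<in> borel_potential s V"
    unfolding borel_potential_def
  proof (intro CollectI conjI)
    show "integrable lborel (\<lambda>x. (g (u x))\<^sup>2)"
      by (rule Bochner_Integration.integrable_bound[OF borel_potentialD(2)[OF u]]) (use sq0 in auto)
    show "integrable lborel (\<lambda>x. V x * (g (u x))\<^sup>2)"
      by (rule Bochner_Integration.integrable_bound[OF borel_potentialD(4)[OF u]]) (use Vg in auto)
    show "integrable lborel (gagliardo s (\<lambda>x. g (u x)) (\<lambda>x. g (u x)))"
      by (rule Bochner_Integration.integrable_bound[OF borel_potentialD(3)[OF u]]) (use G in auto)
  qed measurable
  show "sobolev_form s V (\<lambda>x. g (u x)) (\<lambda>x. g (u x)) \<le> sobolev_form s V u u"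
    unfolding sobolev_form_def
    using integral_mono[OF borel_potentialD(3)[OF mem] borel_potentialD(3)[OF u] G] integral_mono[OF borel_potentialD(4)[OF mem] borel_potentialD(4)[OF u] Vg]
    by (simp add: power2_eq_square mult.assoc)
qed

lemma borel_potential_abs: "u \<in> borel_potential s V \<Longrightarrow> (\<lambda>x. \<bar>u x\<bar>) \<in> borel_potential s V"
  by (rule borel_potential_lipschitz(1)[where g = abs]) auto

lemma borel_potential_pos: "u \<in> borel_potential s V \<Longrightarrow> (\<lambda>x. max 0 (u x)) \<in> borel_potential s V"
  by (rule borel_potential_lipschitz(1)[where g = "max 0"]) auto

lemma borel_potential_neg: "u \<in> borel_potential s V \<Longrightarrow> (\<lambda>x. max 0 (- u x)) \<in> borel_potential s V"
  by (rule borel_potential_lipschitz(1)[where g = "\<lambda>a. max 0 (- a)"]) auto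

end

section \<open>The subcritical fractional Sobolev inequality\<close>

lemma emeasure_lborel_ball:
  fixes x :: "real ^ 'n::finite"
  assumes "\<rho> > 0"
  shows "emeasure lborel (ball x \<rho>) = ennreal (\<rho> powr real CARD('n) * measure lborel (ball (0::real^'n) 1))"
proof -
  have "measure lborel (ball x \<rho>) = \<rho> powr real CARD('n) * measure lborel (ball (0::real^'n) 1)"
    using content_ball_conv_unit_ball[of \<rho> x] assms by (simp add: powr_realpow)
  then show ?thesis
    using emeasure_lborel_ball_finite[of x \<rho>] by (simp add: emeasure_eq_ennreal_measure)
qed

text \<open>The ball around \<open>x\<close> is chosen so large that, by Chebyshev's inequality, \<open>\<bar>u\<bar> \<le> \<bar>u x\<bar> / 2\<close> on
  at least half of it; there the numerator of the Gagliardo integrand is at least \<open>(u x / 2)\<^sup>2\<close>.\<close>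

lemma sobolev_pointwise:
  fixes u :: "('n::finite) fn"
  assumes [measurable]: "u \<in> borel_measurable borel" and s: "0 < s" and q: "0 < q" and K: "K > 0"
    and uK: "(\<integral>\<^sup>+x. ennreal (\<bar>u x\<bar> powr q) \<partial>lborel) \<le> ennreal K"
  defines "\<omega> \<equiv> measure lborel (ball (0::real^'n) 1)"
  shows "ennreal (\<bar>u x\<bar> powr (2 + 2 * s * q / real CARD('n))) \<le>
    ennreal (8 / \<omega> * (2 powr (q + 1) * K / \<omega>) powr (2 * s / real CARD('n))) *
      (\<integral>\<^sup>+y. ennreal (gagliardo s u u (x, y)) \<partial>lborel)"
proof (cases "u x = 0")
  case True
  then show ?thesis using s q by simp
next
  case False
  define m where "m = \<bar>u x\<bar>"
  have m: "m > 0" using False by (simp add: m_def)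
  have \<omega>: "\<omega> > 0" unfolding \<omega>_def by (rule content_ball_pos) simp
  define N where "N = real CARD('n)"
  have N: "N > 0" by (simp add: N_def)
  \<comment> \<open>The constant is chosen so that the Chebyshev bound
    \<open>(2 / m) powr q * K\<close> for the set where \<open>\<bar>u\<bar>\<close> exceeds
    \<open>m / 2\<close> is exactly half the volume of the ball of radius \<open>\<rho>\<close>,
    where \<open>\<rho> powr N = c * m powr (- q)\<close>.\<close>
  define c where "c = 2 powr (q + 1) * K / \<omega>"
  have c: "c > 0" using K \<omega> by (simp add: c_def)
  define \<rho> where "\<rho> = (c * m powr (- q)) powr (1 / N)"
  have \<rho>: "\<rho> > 0" using c m by (simp add: \<rho>_def)
  have \<rho>N: "\<rho> powr N = c * m powr (- q)"
    using c m N by (simp add: \<rho>_def powr_powr)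
  define d where "d = N + 2 * s"
  have d: "d > 0" using N s by (simp add: d_def)
  have eB: "emeasure lborel (ball x \<rho>) = ennreal (\<rho> powr N * \<omega>)"
    using emeasure_lborel_ball[OF \<rho>] by (simp add: N_def \<omega>_def)
  then have mB: "measure lborel (ball x \<rho>) = \<rho> powr N * \<omega>"
    using \<omega> by (simp add: measure_def)
  define S where "S = {y \<in> ball x \<rho>. \<bar>u y\<bar> \<le> m / 2}"
  have [measurable]: "S \<in> sets borel" unfolding S_def by measurable
  have comp: "emeasure lborel (ball x \<rho> - S) \<le> ennreal (\<rho> powr N * \<omega> / 2)"
  proof -
    have "emeasure lborel (ball x \<rho> - S) = (\<integral>\<^sup>+y. indicator (ball x \<rho> - S) y \<partial>lborel)"
      by simp
    also have "\<dots> \<le> (\<integral>\<^sup>+y. ennreal ((2 / m) powr q) * ennreal (\<bar>u y\<bar> powr q) \<partial>lborel)"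
    proof (rule nn_integral_mono)
      fix y
      show "indicator (ball x \<rho> - S) y \<le> ennreal ((2 / m) powr q) * ennreal (\<bar>u y\<bar> powr q)"
      proof (cases "y \<in> ball x \<rho> - S")
        case True
        then have "1 \<le> 2 / m * \<bar>u y\<bar>" using m by (auto simp: S_def field_simps)
        then have "1 \<le> (2 / m * \<bar>u y\<bar>) powr q" using q by (simp add: ge_one_powr_ge_zero)
        then have "1 \<le> (2 / m) powr q * \<bar>u y\<bar> powr q" using m by (subst (asm) powr_mult) auto
        then show ?thesis using True by (simp add: ennreal_mult[symmetric] del: ennreal_1 flip: ennreal_1)
      qed simp
    qed
    also have "\<dots> = ennreal ((2 / m) powr q) * (\<integral>\<^sup>+y. ennreal (\<bar>u y\<bar> powr q) \<partial>lborel)"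
      by (rule nn_integral_cmult) measurable
    also have "\<dots> \<le> ennreal ((2 / m) powr q) * ennreal K"
      using uK by (rule mult_left_mono) simp
    also have "\<dots> = ennreal (\<rho> powr N * \<omega> / 2)"
    proof -
      have "(2 / m) powr q * K = \<rho> powr N * \<omega> / 2"
        unfolding \<rho>N c_def using \<omega> m by (simp add: powr_divide powr_minus powr_add field_simps)
      moreover have "ennreal ((2 / m) powr q) * ennreal K = ennreal ((2 / m) powr q * K)"
        using K by (simp add: ennreal_mult)
      ultimately show ?thesis by (simp only:)
    qed
    finally show ?thesis .
  qed
  have SB: "S \<subseteq> ball x \<rho>" by (auto simp: S_def)
  have finS: "emeasure lborel S < \<infinity>"
    using emeasure_mono[OF SB, of lborel] eB by (auto intro: le_less_trans)
  have mS: "\<rho> powr N * \<omega> / 2 \<le> measure lborel S"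
  proof -
    have "measure lborel (ball x \<rho> - S) = measure lborel (ball x \<rho>) - measure lborel S"
      using finS eB SB by (intro measure_Diff) auto
    moreover have "measure lborel (ball x \<rho> - S) \<le> \<rho> powr N * \<omega> / 2"
      using comp \<omega> unfolding measure_def by (intro enn2real_leI) auto
    ultimately show ?thesis using mB by linarith
  qed
  have "ennreal (m\<^sup>2 / 4 * \<rho> powr (- d) * (\<rho> powr N * \<omega> / 2)) \<le> ennreal (m\<^sup>2 / 4 * \<rho> powr (- d)) * emeasure lborel S"
  proof -
    have "emeasure lborel S = ennreal (measure lborel S)"
      using finS by (intro emeasure_eq_ennreal_measure) auto
    moreover have "m\<^sup>2 / 4 * \<rho> powr (- d) * (\<rho> powr N * \<omega> / 2) \<le> m\<^sup>2 / 4 * \<rho> powr (- d) * measure lborel S"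
      using mS by (rule mult_left_mono) simp
    ultimately show ?thesis
      by (simp only: ennreal_leI mult_nonneg_nonneg divide_nonneg_nonneg zero_le_power2 powr_ge_zero
          zero_le_numeral flip: ennreal_mult')
  qed
  also have "\<dots> = (\<integral>\<^sup>+y. ennreal (m\<^sup>2 / 4 * \<rho> powr (- d)) * indicator S y \<partial>lborel)"
    by (simp add: nn_integral_cmult_indicator)
  also have "\<dots> \<le> (\<integral>\<^sup>+y. ennreal (gagliardo s u u (x, y)) \<partial>lborel)"
  proof (rule nn_integral_mono)
    fix y
    show "ennreal (m\<^sup>2 / 4 * \<rho> powr (- d)) * indicator S y \<le> ennreal (gagliardo s u u (x, y))"
    proof (cases "y \<in> S")
      case True
      then have y: "\<bar>u y\<bar> \<le> m / 2" "norm (x - y) < \<rho>" by (auto simp: S_def dist_norm)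
      have "x \<noteq> y" using y m by (auto simp: m_def)
      then have n: "0 < norm (x - y)" by simp
      have "m / 2 \<le> \<bar>u x - u y\<bar>" using y unfolding m_def by linarith
      then have "(m / 2)\<^sup>2 \<le> (u x - u y)\<^sup>2" using m by (subst abs_le_square_iff[symmetric]) auto
      moreover have "\<rho> powr (- d) \<le> norm (x - y) powr (- d)"
        using n y d by (intro powr_mono2') auto
      ultimately have "(m / 2)\<^sup>2 * \<rho> powr (- d) \<le> (u x - u y)\<^sup>2 * norm (x - y) powr (- d)"
        by (intro mult_mono) auto
      moreover have "gagliardo s u u (x, y) = (u x - u y)\<^sup>2 * norm (x - y) powr (- d)"
        unfolding gagliardo_apply powr_minus d_def N_def by (simp add: power2_eq_square divide_inverse)
      moreover have "(m / 2)\<^sup>2 = m\<^sup>2 / 4" by (simp add: power_divide)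
      ultimately show ?thesis using True by (simp add: ennreal_leI)
    qed simp
  qed
  finally have G: "ennreal (m\<^sup>2 / 4 * \<rho> powr (- d) * (\<rho> powr N * \<omega> / 2)) \<le> (\<integral>\<^sup>+y. ennreal (gagliardo s u u (x, y)) \<partial>lborel)" .
  define C where "C = 8 / \<omega> * c powr (2 * s / N)"
  have C: "C > 0" using \<omega> c by (simp add: C_def)
  \<comment> \<open>The kernel and the volume of the ball leave
    \<open>\<rho> powr (- (2 * s))\<close>. Since \<open>\<rho>\<close> is a negative power of
    \<open>m\<close>, this is the additional power of \<open>m\<close> beyond 2, the gain in
    integrability.\<close>
  have "\<rho> powr (- d) * \<rho> powr N = \<rho> powr (- (2 * s))"
    by (simp add: d_def powr_add[symmetric])
  also have "\<dots> = c powr (- (2 * s / N)) * m powr (2 * s * q / N)"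
    unfolding \<rho>_def using c m by (simp add: powr_powr powr_mult mult_ac)
  finally have e1: "\<rho> powr (- d) * \<rho> powr N = c powr (- (2 * s / N)) * m powr (2 * s * q / N)" .
  have e2: "c powr (2 * s / N) * c powr (- (2 * s / N)) = 1"
    using c by (simp add: powr_add[symmetric])
  have "C * (m\<^sup>2 / 4 * \<rho> powr (- d) * (\<rho> powr N * \<omega> / 2)) = C * (m\<^sup>2 * \<omega> / 8) * (\<rho> powr (- d) * \<rho> powr N)"
    by simp
  also have "\<dots> = (c powr (2 * s / N) * c powr (- (2 * s / N))) * (m\<^sup>2 * m powr (2 * s * q / N))"
    unfolding e1 C_def using \<omega> by simp
  also have "\<dots> = m powr (2 + 2 * s * q / N)"
    using m by (simp add: e2 powr_add powr_numeral)
  finally have "ennreal (m powr (2 + 2 * s * q / N)) = ennreal C * ennreal (m\<^sup>2 / 4 * \<rho> powr (- d) * (\<rho> powr N * \<omega> / 2))"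
    using C \<omega> m by (simp add: ennreal_mult[symmetric])
  also have "\<dots> \<le> ennreal C * (\<integral>\<^sup>+y. ennreal (gagliardo s u u (x, y)) \<partial>lborel)"
    using G by (rule mult_left_mono) simp
  finally show ?thesis
    by (simp add: m_def C_def c_def N_def)
qed

lemma nn_integral_gagliardo_iterated:
  fixes u :: "('n::finite) fn"
  assumes [measurable]: "u \<in> borel_measurable borel"
  shows "(\<integral>\<^sup>+x. \<integral>\<^sup>+y. ennreal (gagliardo s u u (x, y)) \<partial>lborel \<partial>lborel) = (\<integral>\<^sup>+z. ennreal (gagliardo s u u z) \<partial>lborel)"
proof -
  have [measurable]: "gagliardo s u u \<in> borel_measurable (lborel \<Otimes>\<^sub>M lborel)"
    using gagliardo_measurable[OF assms assms] by (simp add: lborel_prod)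
  show ?thesis
    by (subst lborel.nn_integral_fst) (auto simp: lborel_prod)
qed

text \<open>Integrating the pointwise bound in \<open>x\<close> turns its right side into the full
  seminorm. This is one bootstrap step from the exponent \<open>q\<close> to
  \<open>2 + 2 * s * q / N\<close>; as the integrals are extended nonnegative, finiteness of the
  left side is part of the conclusion.\<close>

lemma sobolev_step:
  fixes u :: "('n::finite) fn"
  assumes [measurable]: "u \<in> borel_measurable borel" and s: "0 < s" and q: "0 < q" and K: "K > 0"
    and uK: "(\<integral>\<^sup>+x. ennreal (\<bar>u x\<bar> powr q) \<partial>lborel) \<le> ennreal K"
  defines "\<omega> \<equiv> measure lborel (ball (0::real^'n) 1)"
  shows "(\<integral>\<^sup>+x. ennreal (\<bar>u x\<bar> powr (2 + 2 * s * q / real CARD('n))) \<partial>lborel) \<le>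
    ennreal (8 / \<omega> * (2 powr (q + 1) * K / \<omega>) powr (2 * s / real CARD('n))) *
      (\<integral>\<^sup>+z. ennreal (gagliardo s u u z) \<partial>lborel)"
proof -
  have [measurable]: "gagliardo s u u \<in> borel_measurable (lborel \<Otimes>\<^sub>M lborel)"
    using gagliardo_measurable[OF assms(1) assms(1)] by (simp add: lborel_prod)
  have "(\<integral>\<^sup>+x. ennreal (\<bar>u x\<bar> powr (2 + 2 * s * q / real CARD('n))) \<partial>lborel) \<le>
     (\<integral>\<^sup>+x. ennreal (8 / \<omega> * (2 powr (q + 1) * K / \<omega>) powr (2 * s / real CARD('n))) *
      (\<integral>\<^sup>+y. ennreal (gagliardo s u u (x, y)) \<partial>lborel) \<partial>lborel)"
    unfolding \<omega>_def by (intro nn_integral_mono sobolev_pointwise assms)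
  also have "\<dots> = ennreal (8 / \<omega> * (2 powr (q + 1) * K / \<omega>) powr (2 * s / real CARD('n))) *
      (\<integral>\<^sup>+x. \<integral>\<^sup>+y. ennreal (gagliardo s u u (x, y)) \<partial>lborel \<partial>lborel)"
    by (rule nn_integral_cmult) measurable
  finally show ?thesis by (simp add: nn_integral_gagliardo_iterated)
qed

lemma powr_le_add_powr:
  assumes "0 < a" "a \<le> b" "b \<le> c" "0 \<le> (x::real)"
  shows "x powr b \<le> x powr a + x powr c"
proof (cases "x \<le> 1")
  case True
  then have "x powr b \<le> x powr a" using assms by (cases "x = 0") (auto intro: powr_mono')
  then show ?thesis by (smt (verit) powr_ge_zero)
next
  case False
  then have "x powr b \<le> x powr c" using assms by (intro powr_mono) auto
  then show ?thesis by (smt (verit) powr_ge_zero)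
qed

text \<open>The estimate is stated for bounded sets, with \<open>K\<close> depending on
  \<open>M\<close>; the homogeneous inequality is recovered by normalization in
  \<open>C_le_powr_norm_square\<close>. The iteration reaches the critical exponent only in the
  limit, hence the strict bound on \<open>r\<close>.\<close>

theorem sobolev_subcritical:
  fixes s r M :: real
  assumes s: "0 < s" and N: "2 * s < real CARD('n)"
    and r: "2 \<le> r" "r < 2 * real CARD('n) / (real CARD('n) - 2 * s)" and M: "M > 0"
  obtains K where "K > 0"
    "\<And>u :: ('n::finite) fn. u \<in> borel_measurable borel \<Longrightarrow> (\<integral>\<^sup>+x. ennreal ((u x)\<^sup>2) \<partial>lborel) \<le> ennreal M \<Longrightarrow>
       (\<integral>\<^sup>+z. ennreal (gagliardo s u u z) \<partial>lborel) \<le> ennreal M \<Longrightarrow>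
       (\<integral>\<^sup>+x. ennreal (\<bar>u x\<bar> powr r) \<partial>lborel) \<le> ennreal K"
proof -
  define \<kappa> where "\<kappa> = 2 * s / real CARD('n)"
  have \<kappa>: "0 < \<kappa>" "\<kappa> < 1" using s N by (auto simp: \<kappa>_def field_simps)
  \<comment> \<open>The explicit solution of \<open>Q (Suc j) = 2 + \<kappa> * Q j\<close> with
    \<open>Q 0 = 2\<close>. Its limit \<open>2 / (1 - \<kappa>)\<close> is the critical exponent
    \<open>2 * N / (N - 2 * s)\<close>.\<close>
  define Q where "Q j = 2 * (1 - \<kappa> ^ Suc j) / (1 - \<kappa>)" for j :: nat
  have Q0: "Q 0 = 2" using \<kappa> by (simp add: Q_def field_simps)
  have QSuc: "Q (Suc j) = 2 + 2 * s * Q j / real CARD('n)" for j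
  proof -
    have "Q (Suc j) = 2 + \<kappa> * Q j" using \<kappa> by (simp add: Q_def field_simps)
    then show ?thesis by (simp add: \<kappa>_def)
  qed
  have Q2: "2 \<le> Q j" for j
    by (induction j) (use s in \<open>auto simp: Q0 QSuc\<close>)
  have "Q \<longlonglongrightarrow> 2 * (1 - 0) / (1 - \<kappa>)"
    unfolding Q_def using \<kappa> by (intro tendsto_intros LIMSEQ_Suc LIMSEQ_power_zero) auto
  moreover have "r < 2 * (1 - 0) / (1 - \<kappa>)"
    using r(2) N s by (simp add: \<kappa>_def field_simps)
  ultimately have "\<forall>\<^sub>F j in sequentially. r < Q j" by (rule order_tendstoD)
  then obtain j where j: "r < Q j" by (auto simp: eventually_sequentially)
  have P: "\<exists>K>0. \<forall>u :: 'n fn. u \<in> borel_measurable borel \<longrightarrow> (\<integral>\<^sup>+x. ennreal ((u x)\<^sup>2) \<partial>lborel) \<le> ennreal M \<longrightarrow>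
       (\<integral>\<^sup>+z. ennreal (gagliardo s u u z) \<partial>lborel) \<le> ennreal M \<longrightarrow>
       (\<integral>\<^sup>+x. ennreal (\<bar>u x\<bar> powr Q j) \<partial>lborel) \<le> ennreal K" for j
  proof (induction j)
    case 0
    have "\<bar>t\<bar> powr 2 = t\<^sup>2" for t :: real by (cases "t = 0") (auto simp: powr_numeral)
    then show ?case using M by (auto simp: Q0 intro!: exI[of _ M])
  next
    case (Suc j)
    then obtain K where K: "K > 0" "\<And>u :: 'n fn. u \<in> borel_measurable borel \<Longrightarrow> (\<integral>\<^sup>+x. ennreal ((u x)\<^sup>2) \<partial>lborel) \<le> ennreal M \<Longrightarrow>
       (\<integral>\<^sup>+z. ennreal (gagliardo s u u z) \<partial>lborel) \<le> ennreal M \<Longrightarrow>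
       (\<integral>\<^sup>+x. ennreal (\<bar>u x\<bar> powr Q j) \<partial>lborel) \<le> ennreal K" by auto
    define \<omega> where "\<omega> = measure lborel (ball (0::real^'n) 1)"
    have \<omega>: "\<omega> > 0" unfolding \<omega>_def by (rule content_ball_pos) simp
    define C where "C = 8 / \<omega> * (2 powr (Q j + 1) * K / \<omega>) powr (2 * s / real CARD('n))"
    have C: "C > 0" using \<omega> K(1) by (simp add: C_def)
    show ?case
    proof (intro exI[of _ "C * M"] conjI allI impI)
      fix u :: "'n fn"
      assume u: "u \<in> borel_measurable borel" "(\<integral>\<^sup>+x. ennreal ((u x)\<^sup>2) \<partial>lborel) \<le> ennreal M"
        "(\<integral>\<^sup>+z. ennreal (gagliardo s u u z) \<partial>lborel) \<le> ennreal M"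
      have "(\<integral>\<^sup>+x. ennreal (\<bar>u x\<bar> powr Q (Suc j)) \<partial>lborel) \<le> ennreal C * (\<integral>\<^sup>+z. ennreal (gagliardo s u u z) \<partial>lborel)"
        using sobolev_step[OF u(1) s _ K(1) K(2)[OF u]] Q2[of j] by (simp add: QSuc C_def \<omega>_def)
      also have "\<dots> \<le> ennreal C * ennreal M" using u(3) by (rule mult_left_mono) simp
      finally show "(\<integral>\<^sup>+x. ennreal (\<bar>u x\<bar> powr Q (Suc j)) \<partial>lborel) \<le> ennreal (C * M)"
        using C M by (simp add: ennreal_mult)
    qed (use C M in simp)
  qed
  obtain K where K: "K > 0" "\<And>u :: 'n fn. u \<in> borel_measurable borel \<Longrightarrow> (\<integral>\<^sup>+x. ennreal ((u x)\<^sup>2) \<partial>lborel) \<le> ennreal M \<Longrightarrow>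
       (\<integral>\<^sup>+z. ennreal (gagliardo s u u z) \<partial>lborel) \<le> ennreal M \<Longrightarrow>
       (\<integral>\<^sup>+x. ennreal (\<bar>u x\<bar> powr Q j) \<partial>lborel) \<le> ennreal K"
    using P[of j] by auto
  show ?thesis
  proof (rule that[of "M + K"])
    fix u :: "'n fn"
    assume u: "u \<in> borel_measurable borel" "(\<integral>\<^sup>+x. ennreal ((u x)\<^sup>2) \<partial>lborel) \<le> ennreal M"
      "(\<integral>\<^sup>+z. ennreal (gagliardo s u u z) \<partial>lborel) \<le> ennreal M"
    note [measurable] = u(1)
    have "\<bar>t\<bar> powr 2 = t\<^sup>2" for t :: real by (cases "t = 0") (auto simp: powr_numeral)
    then have "\<bar>u x\<bar> powr r \<le> (u x)\<^sup>2 + \<bar>u x\<bar> powr Q j" for x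
      using powr_le_add_powr[of 2 r "Q j" "\<bar>u x\<bar>"] r j by simp
    then have "(\<integral>\<^sup>+x. ennreal (\<bar>u x\<bar> powr r) \<partial>lborel) \<le> (\<integral>\<^sup>+x. ennreal ((u x)\<^sup>2) + ennreal (\<bar>u x\<bar> powr Q j) \<partial>lborel)"
      by (intro nn_integral_mono) (simp flip: ennreal_plus)
    also have "\<dots> = (\<integral>\<^sup>+x. ennreal ((u x)\<^sup>2) \<partial>lborel) + (\<integral>\<^sup>+x. ennreal (\<bar>u x\<bar> powr Q j) \<partial>lborel)"
      by (rule nn_integral_add) measurable
    also have "\<dots> \<le> ennreal M + ennreal K"
      using u K(2)[OF u] by (intro add_mono)
    finally show "(\<integral>\<^sup>+x. ennreal (\<bar>u x\<bar> powr r) \<partial>lborel) \<le> ennreal (M + K)"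
      using M K by simp
  qed (use M K in simp)
qed

section \<open>Averages over dyadic cubes\<close>

text \<open>Floors make the cubes half-open, so that each generation partitions the space. The
  indices over all generations form a countable set, which the diagonal extraction needs.\<close>

definition cell :: "nat \<Rightarrow> int ^ 'n \<Rightarrow> (real ^ 'n::finite) set" where
  "cell n k = {y. \<forall>i. \<lfloor>2 ^ n * y $ i\<rfloor> = k $ i}"

definition cell_of :: "nat \<Rightarrow> real ^ 'n \<Rightarrow> int ^ 'n::finite" where
  "cell_of n x = (\<chi> i. \<lfloor>2 ^ n * x $ i\<rfloor>)"

definition cell_avg :: "nat \<Rightarrow> ('n::finite) fn \<Rightarrow> 'n fn" where
  "cell_avg n u x = (2 ^ n) ^ CARD('n) * (LBINT y. indicator (cell n (cell_of n x)) y * u y)"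

lemma cell_borel [measurable]: "cell n k \<in> sets borel"
proof -
  have [measurable]: "(\<lambda>y::real^'a. y $ i) \<in> borel_measurable borel" for i
    by (intro borel_measurable_continuous_onI continuous_intros)
  have "cell n k = (\<Inter>i\<in>UNIV. {y. \<lfloor>2 ^ n * y $ i\<rfloor> = k $ i})"
    by (auto simp: cell_def)
  also have "\<dots> \<in> sets borel"
    by (intro sets.finite_INT) (auto, measurable)
  finally show ?thesis .
qed

lemma
  fixes k :: "int ^ 'n::finite"
  shows emeasure_cell_finite: "emeasure lborel (cell n k) < \<infinity>"
    and measure_cell: "measure lborel (cell n k) = 1 / (2 ^ n) ^ CARD('n)"
proof -
  define a :: "real^'n" where "a = (\<chi> i. of_int (k $ i) / 2 ^ n)"
  define b :: "real^'n" where "b = (\<chi> i. (of_int (k $ i) + 1) / 2 ^ n)"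
  have ab: "(b - a) \<bullet> e = 1 / 2 ^ n" if e: "e \<in> Basis" for e
  proof -
    obtain i where "e = axis i 1" using e by (auto simp: Basis_vec_def)
    then show ?thesis by (simp add: inner_axis a_def b_def add_divide_distrib)
  qed
  have ab2: "a \<bullet> e \<le> b \<bullet> e" if e: "e \<in> Basis" for e
    using ab[OF e] by (simp add: inner_diff_left) (smt (verit) divide_nonneg_nonneg zero_le_power)
  have prod: "(\<Prod>e\<in>Basis. (b - a) \<bullet> e) = 1 / (2 ^ n) ^ CARD('n)"
    by (simp add: ab power_one_over)
  have 1: "box a b \<subseteq> cell n k"
  proof
    fix y assume y: "y \<in> box a b"
    have "a $ i < y $ i" "y $ i < b $ i" for i
      using y by (auto simp: mem_box_cart)
    then have "of_int (k $ i) < 2 ^ n * y $ i" "2 ^ n * y $ i < of_int (k $ i) + 1" for i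
      by (auto simp: a_def b_def field_simps)
    then have "\<lfloor>2 ^ n * y $ i\<rfloor> = k $ i" for i
      by (simp add: floor_eq_iff less_imp_le)
    then show "y \<in> cell n k" by (simp add: cell_def)
  qed
  have 2: "cell n k \<subseteq> cbox a b"
  proof
    fix y assume y: "y \<in> cell n k"
    have "of_int (k $ i) \<le> 2 ^ n * y $ i" "2 ^ n * y $ i < of_int (k $ i) + 1" for i
      using y by (auto simp: cell_def floor_eq_iff)
    then have "a $ i \<le> y $ i" "y $ i \<le> b $ i" for i
      by (auto simp: a_def b_def field_simps less_imp_le)
    then show "y \<in> cbox a b" by (simp add: mem_box_cart)
  qed
  have e1: "emeasure lborel (box a b) = ennreal (1 / (2 ^ n) ^ CARD('n))"
    using ab2 prod by (subst emeasure_lborel_box) auto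
  have e2: "emeasure lborel (cbox a b) = ennreal (1 / (2 ^ n) ^ CARD('n))"
    using ab2 prod by (subst emeasure_lborel_cbox) auto
  have e: "emeasure lborel (cell n k) = ennreal (1 / (2 ^ n) ^ CARD('n))"
    using emeasure_mono[OF 1, of lborel] emeasure_mono[OF 2, of lborel] e1 e2 by (intro antisym) auto
  show "emeasure lborel (cell n k) < \<infinity>" by (simp add: e)
  show "measure lborel (cell n k) = 1 / (2 ^ n) ^ CARD('n)" by (simp add: measure_def e)
qed

text \<open>Variance decomposition: as polynomials in \<open>c\<close> the two sides differ by the
  integral over \<open>Q\<close> of the squared deviation of \<open>u\<close> from its mean, which
  is nonnegative.\<close>

lemma mean_square_deviation:
  fixes u :: "('n::finite) fn"
  assumes [measurable]: "u \<in> borel_measurable borel" "Q \<in> sets borel"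
    and u: "integrable lborel (\<lambda>x. (u x)\<^sup>2)"
    and Q: "emeasure lborel Q < \<infinity>" and m: "m > 0" "measure lborel Q = m"
  shows "integrable lborel (\<lambda>y. indicator Q y * u y)"
    "integrable lborel (\<lambda>y. indicator Q y * (c - u y)\<^sup>2)"
    "m * (c - (LBINT y. indicator Q y * u y) / m)\<^sup>2 \<le> (LBINT y. indicator Q y * (c - u y)\<^sup>2)"
proof -
  have i0: "integrable lborel (indicator Q :: _ \<Rightarrow> real)"
    using Q by (intro integrable_real_indicator) auto
  show i1: "integrable lborel (\<lambda>y. indicator Q y * u y)"
  proof (rule Bochner_Integration.integrable_bound)
    show "integrable lborel (\<lambda>y. indicator Q y + (u y)\<^sup>2)" using i0 u by simp
    show "AE y in lborel. norm (indicator Q y * u y) \<le> norm (indicator Q y + (u y)\<^sup>2)"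
    proof (rule AE_I2)
      fix y
      have "\<bar>1 * u y\<bar> \<le> 1\<^sup>2 + (u y)\<^sup>2" by (rule abs_mult_le_squares)
      then show "norm (indicator Q y * u y) \<le> norm (indicator Q y + (u y)\<^sup>2)"
        by (auto simp: indicator_def)
    qed
  qed measurable
  have i2: "integrable lborel (\<lambda>y. indicator Q y * (u y)\<^sup>2)"
    by (rule Bochner_Integration.integrable_bound[OF u]) (auto simp: indicator_def)
  define W where "W = (LBINT y. indicator Q y * u y)"
  define W2 where "W2 = (LBINT y. indicator Q y * (u y)\<^sup>2)"
  have ex: "(\<lambda>y. indicator Q y * (c - u y)\<^sup>2) =
      (\<lambda>y. c\<^sup>2 * indicator Q y - 2 * c * (indicator Q y * u y) + indicator Q y * (u y)\<^sup>2)" for c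
    by (auto simp: power2_eq_square algebra_simps)
  show "integrable lborel (\<lambda>y. indicator Q y * (c - u y)\<^sup>2)"
    unfolding ex using i0 i1 i2 by auto
  have I: "(LBINT y. indicator Q y * (c - u y)\<^sup>2) = c\<^sup>2 * m - 2 * c * W + W2" for c
    unfolding ex using i0 i1 i2 m by (simp add: W_def W2_def)
  have "0 \<le> (LBINT y. indicator Q y * (W / m - u y)\<^sup>2)"
    by (intro Bochner_Integration.integral_nonneg) auto
  then have "W\<^sup>2 / m \<le> W2"
    unfolding I using m by (simp add: power2_eq_square field_simps)
  moreover have "m * (c - W / m)\<^sup>2 = c\<^sup>2 * m - 2 * c * W + W\<^sup>2 / m"
    using m by (simp add: power2_eq_square field_simps)
  ultimately show "m * (c - (LBINT y. indicator Q y * u y) / m)\<^sup>2 \<le> (LBINT y. indicator Q y * (c - u y)\<^sup>2)"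
    unfolding I W_def[symmetric] by simp
qed

lemma cell_avg_measurable [measurable]:
  fixes u :: "('n::finite) fn"
  assumes [measurable]: "u \<in> borel_measurable borel"
  shows "cell_avg n u \<in> borel_measurable borel"
proof -
  have [measurable]: "(\<lambda>y::real^'n. y $ i) \<in> borel_measurable borel" for i
    by (intro borel_measurable_continuous_onI continuous_intros)
  \<comment> \<open>Written as a product of coordinatewise comparisons, the indicator is visibly
    measurable in both variables jointly, as measurability of the parameter integral
    requires.\<close>
  have *: "cell_avg n u = (\<lambda>x. (2 ^ n) ^ CARD('n) *
      (LBINT y. (\<Prod>i\<in>UNIV. if \<lfloor>2 ^ n * y $ i\<rfloor> = \<lfloor>2 ^ n * x $ i\<rfloor> then 1 else 0) * u y))"
    unfolding cell_avg_def cell_def cell_of_def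
    by (intro ext arg_cong2[where f = "(*)"] refl Bochner_Integration.integral_cong)
      (auto simp: indicator_def prod.neutral)
  show ?thesis
    unfolding * by measurable
qed

lemma norm_diff_same_cell:
  fixes x y :: "real ^ 'n::finite"
  assumes "y \<in> cell n (cell_of n x)"
  shows "norm (x - y) \<le> real CARD('n) / 2 ^ n"
proof -
  have "\<bar>(x - y) $ i\<bar> \<le> 1 / 2 ^ n" for i
  proof -
    have "\<lfloor>2 ^ n * y $ i\<rfloor> = \<lfloor>2 ^ n * x $ i\<rfloor>"
      using assms by (auto simp: cell_def cell_of_def)
    then have "\<bar>2 ^ n * x $ i - 2 ^ n * y $ i\<bar> \<le> 1" by linarith
    then have "2 ^ n * \<bar>x $ i - y $ i\<bar> \<le> 1"
      by (simp add: right_diff_distrib[symmetric] abs_mult del: right_diff_distrib)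
    then show ?thesis by (simp add: field_simps)
  qed
  then have "(\<Sum>i\<in>UNIV. \<bar>(x - y) $ i\<bar>) \<le> (\<Sum>i\<in>(UNIV::'n set). 1 / 2 ^ n)"
    by (intro sum_mono)
  then show ?thesis using norm_le_l1_cart[of "x - y"] by simp
qed

text \<open>The squared error is at most the mean of \<open>(u x - u y)\<^sup>2\<close> over the
  cell of \<open>x\<close>. Points of a cell are within \<open>N / 2 ^ n\<close> of each other, so
  the weight \<open>(2 ^ n) ^ N\<close> of the mean is at most
  \<open>K / norm (x - y) powr (N + 2 * s)\<close>; matching powers of \<open>2 ^ n\<close> leaves
  the decaying factor \<open>2 powr (- (2 * s * n))\<close> in \<open>K\<close>.\<close>

lemma cell_avg_error_pointwise:
  fixes u :: "('n::finite) fn"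
  assumes [measurable]: "u \<in> borel_measurable borel" and s: "0 < s"
    and u: "integrable lborel (\<lambda>x. (u x)\<^sup>2)"
  shows "ennreal ((u x - cell_avg n u x)\<^sup>2) \<le>
    ennreal (real CARD('n) powr (real CARD('n) + 2 * s) * 2 powr (- (2 * s * n))) *
      (\<integral>\<^sup>+y. ennreal (gagliardo s u u (x, y)) \<partial>lborel)"
proof -
  define Q where "Q = cell n (cell_of n x)"
  define m :: real where "m = 1 / (2 ^ n) ^ CARD('n)"
  define N where "N = real CARD('n)"
  have N: "N > 0" by (simp add: N_def)
  have m: "m > 0" by (simp add: m_def)
  have [measurable]: "Q \<in> sets borel" by (simp add: Q_def)
  have Qf: "emeasure lborel Q < \<infinity>" "measure lborel Q = m"
    unfolding Q_def m_def by (rule emeasure_cell_finite measure_cell)+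
  note ms = mean_square_deviation(2,3)[OF assms(1) \<open>Q \<in> sets borel\<close> u Qf(1) m Qf(2), where c = "u x"]
  have avg: "cell_avg n u x = (LBINT y. indicator Q y * u y) / m"
    by (simp add: cell_avg_def Q_def m_def)
  have "(u x - cell_avg n u x)\<^sup>2 \<le> (1 / m) * (LBINT y. indicator Q y * (u x - u y)\<^sup>2)"
    using ms(2) m by (simp add: avg Q_def field_simps)
  also have "\<dots> = (LBINT y. (1 / m) * (indicator Q y * (u x - u y)\<^sup>2))"
    by simp
  finally have "ennreal ((u x - cell_avg n u x)\<^sup>2) \<le> ennreal (LBINT y. (1 / m) * (indicator Q y * (u x - u y)\<^sup>2))"
    by (rule ennreal_leI)
  also have "\<dots> = (\<integral>\<^sup>+y. ennreal ((1 / m) * (indicator Q y * (u x - u y)\<^sup>2)) \<partial>lborel)"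
    using ms(1) m by (intro nn_integral_eq_integral[symmetric]) (auto simp: Q_def)
  also have "\<dots> \<le> (\<integral>\<^sup>+y. ennreal (N powr (N + 2 * s) * 2 powr (- (2 * s * n))) * ennreal (gagliardo s u u (x, y)) \<partial>lborel)"
  proof (rule nn_integral_mono)
    fix y
    define K where "K = N powr (N + 2 * s) * 2 powr (- (2 * s * n))"
    have "(1 / m) * (indicator Q y * (u x - u y)\<^sup>2) \<le> K * gagliardo s u u (x, y)"
    proof (cases "y \<in> Q \<and> x \<noteq> y")
      case True
      then have n: "0 < norm (x - y)" "norm (x - y) \<le> N / 2 ^ n"
        using norm_diff_same_cell[of y n x] by (auto simp: Q_def N_def)
      have "norm (x - y) powr (N + 2 * s) \<le> (N / 2 ^ n) powr (N + 2 * s)"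
        using n N s by (intro powr_mono2) auto
      also have "\<dots> = K * m"
        using N by (simp add: K_def m_def N_def powr_divide powr_minus powr_add field_simps powr_realpow[symmetric] powr_powr)
      finally have "norm (x - y) powr (N + 2 * s) \<le> K * m" .
      then have "1 / m \<le> K / norm (x - y) powr (N + 2 * s)"
        using m n by (simp add: field_simps)
      then have "(1 / m) * (u x - u y)\<^sup>2 \<le> K / norm (x - y) powr (N + 2 * s) * (u x - u y)\<^sup>2"
        by (intro mult_right_mono) auto
      then show ?thesis using True by (simp add: gagliardo_apply N_def power2_eq_square)
    next
      case False
      then show ?thesis by (auto simp: K_def)
    qed
    then have "ennreal ((1 / m) * (indicator Q y * (u x - u y)\<^sup>2)) \<le> ennreal (K * gagliardo s u u (x, y))"
      by (rule ennreal_leI)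
    also have "\<dots> = ennreal K * ennreal (gagliardo s u u (x, y))"
      by (simp add: ennreal_mult' K_def)
    finally show "ennreal ((1 / m) * (indicator Q y * (u x - u y)\<^sup>2)) \<le> ennreal (N powr (N + 2 * s) * 2 powr (- (2 * s * n))) * ennreal (gagliardo s u u (x, y))"
      by (simp add: K_def)
  qed
  also have "\<dots> = ennreal (N powr (N + 2 * s) * 2 powr (- (2 * s * n))) * (\<integral>\<^sup>+y. ennreal (gagliardo s u u (x, y)) \<partial>lborel)"
  proof (rule nn_integral_cmult)
    have [measurable]: "gagliardo s u u \<in> borel_measurable (lborel \<Otimes>\<^sub>M lborel)"
      using gagliardo_measurable[OF assms(1) assms(1)] by (simp add: lborel_prod)
    show "(\<lambda>y. ennreal (gagliardo s u u (x, y))) \<in> borel_measurable lborel" by measurable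
  qed
  finally show ?thesis by (simp add: N_def)
qed

lemma cell_avg_error:
  fixes u :: "('n::finite) fn"
  assumes [measurable]: "u \<in> borel_measurable borel" and s: "0 < s"
    and u: "integrable lborel (\<lambda>x. (u x)\<^sup>2)" and g: "integrable lborel (gagliardo s u u)"
  shows "integrable lborel (\<lambda>x. (u x - cell_avg n u x)\<^sup>2)"
    "(LBINT x. (u x - cell_avg n u x)\<^sup>2) \<le>
    real CARD('n) powr (real CARD('n) + 2 * s) * 2 powr (- (2 * s * n)) * (LBINT z. gagliardo s u u z)"
proof -
  let ?K = "real CARD('n) powr (real CARD('n) + 2 * s) * 2 powr (- (2 * s * n))"
  have [measurable]: "gagliardo s u u \<in> borel_measurable (lborel \<Otimes>\<^sub>M lborel)"
    using gagliardo_measurable[OF assms(1) assms(1)] by (simp add: lborel_prod)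
  have G: "0 \<le> (LBINT z. gagliardo s u u z)" by (intro Bochner_Integration.integral_nonneg) auto
  have "(\<integral>\<^sup>+x. ennreal ((u x - cell_avg n u x)\<^sup>2) \<partial>lborel) \<le>
     (\<integral>\<^sup>+x. ennreal ?K * (\<integral>\<^sup>+y. ennreal (gagliardo s u u (x, y)) \<partial>lborel) \<partial>lborel)"
    by (intro nn_integral_mono cell_avg_error_pointwise assms)
  also have "\<dots> = ennreal ?K * (\<integral>\<^sup>+x. \<integral>\<^sup>+y. ennreal (gagliardo s u u (x, y)) \<partial>lborel \<partial>lborel)"
    by (rule nn_integral_cmult) measurable
  also have "\<dots> = ennreal ?K * ennreal (LBINT z. gagliardo s u u z)"
    using g by (simp add: nn_integral_gagliardo_iterated nn_integral_eq_integral)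
  also have "\<dots> = ennreal (?K * (LBINT z. gagliardo s u u z))"
    by (rule ennreal_mult'[symmetric]) simp
  finally have *: "(\<integral>\<^sup>+x. ennreal ((u x - cell_avg n u x)\<^sup>2) \<partial>lborel) \<le> ennreal (?K * (LBINT z. gagliardo s u u z))" .
  show i: "integrable lborel (\<lambda>x. (u x - cell_avg n u x)\<^sup>2)"
  proof (rule integrableI_nonneg)
    show "(\<integral>\<^sup>+x. ennreal ((u x - cell_avg n u x)\<^sup>2) \<partial>lborel) < \<infinity>"
      using * by (rule le_less_trans) simp
  qed auto
  show "(LBINT x. (u x - cell_avg n u x)\<^sup>2) \<le> ?K * (LBINT z. gagliardo s u u z)"
    using * G i by (subst (asm) nn_integral_eq_integral) auto
qed

text \<open>The case \<open>c = 0\<close> of the variance inequality. The factor grows with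
  \<open>n\<close>, but it is applied at a fixed generation or, for bare cell integrals, cancelled
  by the cell volume.\<close>

lemma abs_cell_integral_le:
  fixes u :: "('n::finite) fn"
  assumes "u \<in> borel_measurable borel" "integrable lborel (\<lambda>x. (u x)\<^sup>2)"
  shows "((2 ^ n) ^ CARD('n) * (LBINT y. indicator (cell n k) y * u y))\<^sup>2 \<le> (2 ^ n) ^ CARD('n) * (LBINT x. (u x)\<^sup>2)"
proof -
  define m :: real where "m = 1 / (2 ^ n) ^ CARD('n)"
  have m: "m > 0" by (simp add: m_def)
  have mc: "measure lborel (cell n k) = m"
    unfolding m_def by (rule measure_cell)
  note ms = mean_square_deviation(2,3)[OF assms(1) cell_borel assms(2) emeasure_cell_finite m mc, where c = 0]
  have "m * ((LBINT y. indicator (cell n k) y * u y) / m)\<^sup>2 \<le> (LBINT y. indicator (cell n k) y * (u y)\<^sup>2)"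
    using ms(2) by simp
  also have "\<dots> \<le> (LBINT y. (u y)\<^sup>2)"
    using ms(1) assms by (intro integral_mono) (auto simp: indicator_def)
  finally have "((LBINT y. indicator (cell n k) y * u y) / m)\<^sup>2 \<le> (1 / m) * (LBINT y. (u y)\<^sup>2)"
    using m by (simp add: field_simps)
  then show ?thesis by (simp add: m_def mult.commute)
qed

section \<open>Compactness of bounded sequences\<close>

lemma square_diff_le: "(x - y)\<^sup>2 \<le> 2 * x\<^sup>2 + 2 * (y::real)\<^sup>2"
  using sum_squares_ge_zero[of "x + y" 0] by (simp add: power2_eq_square algebra_simps)

context positive_potential
begin

lemma sobolev_form_diff_le:
  assumes "u \<in> borel_potential s V" "v \<in> borel_potential s V"
  shows "sobolev_form s V (\<lambda>x. u x - v x) (\<lambda>x. u x - v x) \<le> 2 * sobolev_form s V u u + 2 * sobolev_form s V v v"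
proof -
  have "0 \<le> sobolev_form s V (\<lambda>x. u x + 1 * v x) (\<lambda>x. u x + 1 * v x)"
    using borel_potential_add[OF assms] by (intro sobolev_form_self_ge) auto
  then show ?thesis
    using sobolev_form_add_scale[OF assms, of "-1"] sobolev_form_add_scale[OF assms, of 1] by simp
qed

end

section \<open>Compactness in the mean square\<close>

locale coercive_potential = positive_potential s V0 V for s V0 :: real and V :: "('n::finite) fn" +
  assumes s_pos: "0 < s"
    and sublevel_finite: "\<And>M. M > 0 \<Longrightarrow> emeasure lborel {x. V x \<le> M} < \<infinity>"
begin

text \<open>Where \<open>V > L\<close> one has \<open>w\<^sup>2 \<le> V * w\<^sup>2 / L\<close>; on
  the sublevel set \<open>w\<close> is split into its average and the error. The three terms are
  made small in order: the first by \<open>L\<close>, the second by \<open>n\<close>, and the third,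
  at fixed \<open>L\<close> and \<open>n\<close>, by convergence of averages on a set of finite
  measure.\<close>

lemma L2_small_by_averages:
  assumes w: "w \<in> borel_potential s V" and L: "L > 0"
  shows "integrable lborel (\<lambda>x. indicator {x. V x \<le> L} x * (cell_avg n w x)\<^sup>2)"
    "(LBINT x. (w x)\<^sup>2) \<le> sobolev_form s V w w / L +
      2 * (real CARD('n) powr (real CARD('n) + 2 * s) * 2 powr (- (2 * s * n)) * sobolev_form s V w w) +
      2 * (LBINT x. indicator {x. V x \<le> L} x * (cell_avg n w x)\<^sup>2)"
proof -
  note [measurable] = borel_potentialD(1)[OF w]
  let ?E = "{x. V x \<le> L}"
  let ?K = "real CARD('n) powr (real CARD('n) + 2 * s) * 2 powr (- (2 * s * n))"
  note ce = cell_avg_error[OF borel_potentialD(1)[OF w] s_pos borel_potentialD(2,3)[OF w], of n]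
  have [measurable]: "?E \<in> sets borel" by measurable
  show i: "integrable lborel (\<lambda>x. indicator ?E x * (cell_avg n w x)\<^sup>2)"
  proof (rule Bochner_Integration.integrable_bound)
    show "integrable lborel (\<lambda>x. 2 * (w x)\<^sup>2 + 2 * (w x - cell_avg n w x)\<^sup>2)"
      using ce borel_potentialD(2)[OF w] by simp
    show "AE x in lborel. norm (indicator ?E x * (cell_avg n w x)\<^sup>2) \<le> norm (2 * (w x)\<^sup>2 + 2 * (w x - cell_avg n w x)\<^sup>2)"
    proof (rule AE_I2)
      fix x
      show "norm (indicator ?E x * (cell_avg n w x)\<^sup>2) \<le> norm (2 * (w x)\<^sup>2 + 2 * (w x - cell_avg n w x)\<^sup>2)"
        using square_diff_le[of "w x" "w x - cell_avg n w x"] by (auto simp: indicator_def)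
    qed
  qed measurable
  have "(LBINT x. (w x)\<^sup>2) \<le> (LBINT x. (1 / L) * (V x * (w x)\<^sup>2) + 2 * (w x - cell_avg n w x)\<^sup>2
      + 2 * (indicator ?E x * (cell_avg n w x)\<^sup>2))"
  proof (rule integral_mono)
    fix x
    show "(w x)\<^sup>2 \<le> (1 / L) * (V x * (w x)\<^sup>2) + 2 * (w x - cell_avg n w x)\<^sup>2
      + 2 * (indicator ?E x * (cell_avg n w x)\<^sup>2)"
    proof (cases "x \<in> ?E")
      case True
      have "0 \<le> (1 / L) * (V x * (w x)\<^sup>2)" using L by simp
      then show ?thesis
        using True square_diff_le[of "w x - cell_avg n w x" "- cell_avg n w x"] by simp
    next
      case False
      have "1 * (w x)\<^sup>2 \<le> (V x / L) * (w x)\<^sup>2"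
        using False L by (intro mult_right_mono) auto
      then show ?thesis using False by simp (smt (verit) zero_le_power2)
    qed
  qed (use borel_potentialD[OF w] ce i in auto)
  also have "\<dots> = (1 / L) * (LBINT x. V x * (w x)\<^sup>2) + 2 * (LBINT x. (w x - cell_avg n w x)\<^sup>2)
      + 2 * (LBINT x. indicator ?E x * (cell_avg n w x)\<^sup>2)"
    using borel_potentialD[OF w] ce i by simp
  also have "\<dots> \<le> (1 / L) * sobolev_form s V w w + 2 * (?K * sobolev_form s V w w)
      + 2 * (LBINT x. indicator ?E x * (cell_avg n w x)\<^sup>2)"
  proof -
    have "?K * (LBINT z. gagliardo s w w z) \<le> ?K * sobolev_form s V w w"
      using sobolev_form_self_ge[OF w] by (intro mult_left_mono) auto
    with ce(2) have "(LBINT x. (w x - cell_avg n w x)\<^sup>2) \<le> ?K * sobolev_form s V w w"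
      by (rule order_trans)
    then show ?thesis
      using sobolev_form_self_ge(3)[OF w] L
      by (intro add_mono mult_left_mono) auto
  qed
  finally show "(LBINT x. (w x)\<^sup>2) \<le> sobolev_form s V w w / L + 2 * (?K * sobolev_form s V w w)
      + 2 * (LBINT x. indicator ?E x * (cell_avg n w x)\<^sup>2)" by simp
qed

lemma cell_avg_diff:
  assumes u: "u \<in> borel_potential s V" and v: "v \<in> borel_potential s V"
  shows "cell_avg n (\<lambda>x. u x - v x) x = cell_avg n u x - cell_avg n v x"
proof -
  have i: "integrable lborel (\<lambda>y. indicator (cell n (cell_of n x)) y * w y)" if "w \<in> borel_potential s V" for w
    using borel_potentialD(1,2)[OF that] emeasure_cell_finite
    by (intro mean_square_deviation(1)[where m = "1 / (2 ^ n) ^ CARD('n)"]) (auto simp: measure_cell)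
  show ?thesis
    unfolding cell_avg_def using i[OF u] i[OF v] by (simp add: right_diff_distrib)
qed

text \<open>At a fixed generation the averages are bounded by a constant, and a constant is an
  integrable majorant on a sublevel set of finite measure. Dominated convergence towards the
  pointwise limit of the averages gives the Cauchy property.\<close>

lemma bounded_averages_cauchy:
  fixes U :: "nat \<Rightarrow> 'n fn"
  assumes U: "\<And>k. U k \<in> borel_potential s V" and M: "\<And>k. sobolev_form s V (U k) (U k) \<le> M"
    and conv: "\<And>x. \<exists>l. (\<lambda>k. cell_avg n (U k) x) \<longlonglongrightarrow> l" and L: "L > 0" and e: "e > 0"
  shows "\<exists>K. \<forall>j\<ge>K. \<forall>k\<ge>K. (LBINT x. indicator {x. V x \<le> L} x * (cell_avg n (\<lambda>x. U j x - U k x) x)\<^sup>2) < e"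
proof -
  let ?E = "{x. V x \<le> L}"
  have [measurable]: "?E \<in> sets borel" by measurable
  have [measurable]: "U k \<in> borel_measurable borel" for k using borel_potentialD(1)[OF U] .
  define g where "g x = lim (\<lambda>k. cell_avg n (U k) x)" for x
  have g: "(\<lambda>k. cell_avg n (U k) x) \<longlonglongrightarrow> g x" for x
    using conv[of x] by (auto simp: g_def limI)
  have [measurable]: "g \<in> borel_measurable borel"
    by (rule borel_measurable_LIMSEQ_real[OF g]) auto
  define B where "B = (2 ^ n) ^ CARD('n) * (M / V0)"
  have MU: "(LBINT x. (U k x)\<^sup>2) \<le> M / V0" for k
    using sobolev_form_self_ge(1)[OF U, of k] M[of k] V0_pos by (simp add: field_simps)
  have B: "(cell_avg n (U k) x)\<^sup>2 \<le> B" for k x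
  proof -
    have "(cell_avg n (U k) x)\<^sup>2 \<le> (2 ^ n) ^ CARD('n) * (LBINT x. (U k x)\<^sup>2)"
      unfolding cell_avg_def using borel_potentialD(1,2)[OF U] by (intro abs_cell_integral_le)
    also have "\<dots> \<le> B" unfolding B_def by (intro mult_left_mono MU) simp
    finally show ?thesis .
  qed
  have Bg: "(g x)\<^sup>2 \<le> B" for x
    by (rule tendsto_upperbound[OF tendsto_power[OF g]]) (use B in auto)
  have EI: "integrable lborel (indicator ?E :: _ \<Rightarrow> real)"
    using sublevel_finite[OF L] by (intro integrable_real_indicator) auto
  have dom: "(cell_avg n (U k) x - g x)\<^sup>2 \<le> 4 * B" for k x
    using square_diff_le[of "cell_avg n (U k) x" "g x"] B[of k x] Bg[of x] by linarith
  have int: "integrable lborel (\<lambda>x. indicator ?E x * (cell_avg n (U k) x - g x)\<^sup>2)" for k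
    by (rule Bochner_Integration.integrable_bound[OF integrable_mult_right[OF EI, of "4 * B"]])
      (use dom in \<open>auto simp: indicator_def intro: order_trans[OF _ abs_ge_self]\<close>)
  have lim: "(\<lambda>k. LBINT x. indicator ?E x * (cell_avg n (U k) x - g x)\<^sup>2) \<longlonglongrightarrow> (\<integral>x. 0 \<partial>(lborel :: (real^'n) measure))"
  proof (rule integral_dominated_convergence[where w = "\<lambda>x. 4 * B * indicator ?E x"])
    show "AE x in lborel. (\<lambda>k. indicator ?E x * (cell_avg n (U k) x - g x)\<^sup>2) \<longlonglongrightarrow> 0"
    proof (rule AE_I2)
      fix x
      have "(\<lambda>k. indicator ?E x * (cell_avg n (U k) x - g x)\<^sup>2) \<longlonglongrightarrow> indicator ?E x * (g x - g x)\<^sup>2"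
        by (intro tendsto_intros g)
      then show "(\<lambda>k. indicator ?E x * (cell_avg n (U k) x - g x)\<^sup>2) \<longlonglongrightarrow> 0" by simp
    qed
    show "AE x in lborel. norm (indicator ?E x * (cell_avg n (U k) x - g x)\<^sup>2) \<le> 4 * B * indicator ?E x" for k
      using dom by (auto simp: indicator_def)
    show "integrable lborel (\<lambda>x. 4 * B * indicator ?E x)"
      using EI by simp
  qed measurable
  have "\<forall>\<^sub>F k in sequentially. (LBINT x. indicator ?E x * (cell_avg n (U k) x - g x)\<^sup>2) < e / 4"
    using lim e by (intro order_tendstoD) auto
  then obtain K where K: "\<And>k. k \<ge> K \<Longrightarrow> (LBINT x. indicator ?E x * (cell_avg n (U k) x - g x)\<^sup>2) < e / 4"
    by (auto simp: eventually_sequentially)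
  show ?thesis
  proof (intro exI allI impI)
    fix j k assume jk: "K \<le> j" "K \<le> k"
    have "(LBINT x. indicator ?E x * (cell_avg n (\<lambda>x. U j x - U k x) x)\<^sup>2) \<le>
      (LBINT x. 2 * (indicator ?E x * (cell_avg n (U j) x - g x)\<^sup>2) + 2 * (indicator ?E x * (cell_avg n (U k) x - g x)\<^sup>2))"
    proof (rule integral_mono)
      fix x
      show "indicator ?E x * (cell_avg n (\<lambda>x. U j x - U k x) x)\<^sup>2 \<le>
        2 * (indicator ?E x * (cell_avg n (U j) x - g x)\<^sup>2) + 2 * (indicator ?E x * (cell_avg n (U k) x - g x)\<^sup>2)"
        using square_diff_le[of "cell_avg n (U j) x - g x" "cell_avg n (U k) x - g x"]
        by (simp add: cell_avg_diff[OF U U] indicator_def)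
    qed (use int L2_small_by_averages(1)[OF borel_potential_diff[OF U U] L] in auto)
    also have "\<dots> = 2 * (LBINT x. indicator ?E x * (cell_avg n (U j) x - g x)\<^sup>2) +
       2 * (LBINT x. indicator ?E x * (cell_avg n (U k) x - g x)\<^sup>2)"
      using int by simp
    also have "\<dots> < 2 * (e / 4) + 2 * (e / 4)"
      using K[OF jk(1)] K[OF jk(2)] by linarith
    finally show "(LBINT x. indicator ?E x * (cell_avg n (\<lambda>x. U j x - U k x) x)\<^sup>2) < e" by simp
  qed
qed

lemma bounded_has_L2_cauchy_subseq:
  fixes U :: "nat \<Rightarrow> 'n fn"
  assumes U: "\<And>k. U k \<in> borel_potential s V" and M: "\<And>k. sobolev_form s V (U k) (U k) \<le> M"
  obtains \<sigma> :: "nat \<Rightarrow> nat" where "strict_mono \<sigma>"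
    "\<And>e. e > 0 \<Longrightarrow> \<exists>K. \<forall>j\<ge>K. \<forall>k\<ge>K. (LBINT x. (U (\<sigma> j) x - U (\<sigma> k) x)\<^sup>2) < e"
proof -
  \<comment> \<open>All cells of all generations are recorded at once, over a countable index set.
    Cells have volume at most 1, so these integrals, unlike the averages, have one bound valid for
    every generation.\<close>
  define F where "F k = (\<lambda>(n, c). LBINT y. indicator (cell n c) y * U k y)" for k
  have M0: "0 \<le> M" using sobolev_form_self_ge(4)[OF U, of 0] M[of 0] by linarith
  have FB: "norm (F k z) \<le> 1 + M / V0" for k z
  proof (cases z)
    case (Pair n c)
    let ?I = "\<integral>y. indicator (cell n c) y * U k y \<partial>lborel"
    have MU: "(LBINT x. (U k x)\<^sup>2) \<le> M / V0"
      using sobolev_form_self_ge(1)[OF U, of k] M[of k] V0_pos by (simp add: field_simps)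
    have "?I\<^sup>2 \<le> ((2 ^ n) ^ CARD('n))\<^sup>2 * ?I\<^sup>2 / (2 ^ n) ^ CARD('n)"
    proof -
      have "1 \<le> (2 ^ n :: real) ^ CARD('n)" by simp
      then have "1 * ?I\<^sup>2 \<le> (2 ^ n) ^ CARD('n) * ?I\<^sup>2" by (intro mult_right_mono) auto
      then show ?thesis by (simp add: power2_eq_square)
    qed
    also have "\<dots> \<le> (LBINT x. (U k x)\<^sup>2)"
      using abs_cell_integral_le[OF borel_potentialD(1,2)[OF U[of k]], of n c]
      by (simp add: power_mult_distrib divide_le_eq mult.commute)
    finally have "?I\<^sup>2 \<le> M / V0" using MU by linarith
    moreover have "\<bar>?I\<bar> \<le> 1 + ?I\<^sup>2"
      using abs_mult_le_squares[of 1 ?I] by simp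
    ultimately show ?thesis by (simp add: F_def Pair)
  qed
  obtain \<sigma> :: "nat \<Rightarrow> nat" where \<sigma>: "strict_mono \<sigma>"
    and conv: "\<And>z. z \<in> UNIV \<Longrightarrow> \<exists>l. (\<lambda>k. F (\<sigma> k) z) \<longlonglongrightarrow> l"
    by (rule function_convergent_subsequence[of UNIV F "1 + M / V0"]) (use FB in auto)
  show ?thesis
  proof (rule that[OF \<sigma>])
    fix e :: real assume e: "e > 0"
    \<comment> \<open>A third of \<open>e\<close> for each term of
      \<open>L2_small_by_averages\<close>. The form of a difference is at most \<open>4 * M\<close>,
      which fixes \<open>L\<close> and then \<open>n\<close>; the last term carries a factor 2,
      hence the later \<open>e / 6\<close>.\<close>
    define L where "L = 1 + 4 * M / (e / 3)"
    have L: "L > 0" using M0 e by (simp add: L_def add_pos_nonneg)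
    have L2: "4 * M / L < e / 3"
    proof -
      have "4 * M < L * (e / 3)" using e M0 by (simp add: L_def field_simps)
      then show ?thesis using L by (simp add: pos_divide_less_eq mult.commute)
    qed
    define C where "C = 2 * real CARD('n) powr (real CARD('n) + 2 * s) * (4 * M)"
    have "(\<lambda>n. C * (2 powr (- (2 * s))) ^ n) \<longlonglongrightarrow> C * 0"
      using s_pos by (intro tendsto_mult tendsto_const LIMSEQ_power_zero) (simp add: powr_less_one)
    then have "\<forall>\<^sub>F n in sequentially. C * (2 powr (- (2 * s))) ^ n < e / 3"
      using e by (intro order_tendstoD) auto
    then obtain n where "C * (2 powr (- (2 * s))) ^ n < e / 3" by (auto simp: eventually_sequentially)
    then have n: "C * 2 powr (- (2 * s * n)) < e / 3"
      by (simp add: powr_realpow[symmetric] powr_powr)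
    have convn: "\<exists>l. (\<lambda>k. cell_avg n (U (\<sigma> k)) x) \<longlonglongrightarrow> l" for x
    proof -
      obtain l where "(\<lambda>k. F (\<sigma> k) (n, cell_of n x)) \<longlonglongrightarrow> l" using conv by blast
      then have "(\<lambda>k. cell_avg n (U (\<sigma> k)) x) \<longlonglongrightarrow> (2 ^ n) ^ CARD('n) * l"
        unfolding cell_avg_def F_def by (auto intro!: tendsto_intros)
      then show ?thesis ..
    qed
    have "e / 6 > 0" using e by simp
    from bounded_averages_cauchy[of "\<lambda>k. U (\<sigma> k)", OF U M convn L this]
    obtain K where K: "\<And>j k. j \<ge> K \<Longrightarrow> k \<ge> K \<Longrightarrow>
        (LBINT x. indicator {x. V x \<le> L} x * (cell_avg n (\<lambda>x. U (\<sigma> j) x - U (\<sigma> k) x) x)\<^sup>2) < e / 6"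
      by blast
    show "\<exists>K. \<forall>j\<ge>K. \<forall>k\<ge>K. (LBINT x. (U (\<sigma> j) x - U (\<sigma> k) x)\<^sup>2) < e"
    proof (intro exI allI impI)
      fix j k assume jk: "K \<le> j" "K \<le> k"
      let ?w = "\<lambda>x. U (\<sigma> j) x - U (\<sigma> k) x"
      let ?h = "sobolev_form s V ?w ?w"
      have h: "?h \<le> 4 * M" using sobolev_form_diff_le[OF U U, of "\<sigma> j" "\<sigma> k"] M[of "\<sigma> j"] M[of "\<sigma> k"] by linarith
      have "?h / L \<le> 4 * M / L" using h L by (simp add: divide_right_mono)
      moreover have "2 * (real CARD('n) powr (real CARD('n) + 2 * s) * 2 powr (- (2 * s * n)) * ?h) \<le> C * 2 powr (- (2 * s * n))"
        using mult_left_mono[OF h, of "2 * real CARD('n) powr (real CARD('n) + 2 * s) * 2 powr (- (2 * s * n))"]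
        by (simp add: C_def algebra_simps)
      ultimately show "(LBINT x. (?w x)\<^sup>2) < e"
        using L2_small_by_averages(2)[OF borel_potential_diff[OF U U] L, of "\<sigma> j" "\<sigma> k" n] L2 n K[OF jk] by linarith
    qed
  qed
qed

end

section \<open>From Cauchy in the mean to dominated convergence almost everywhere\<close>

lemma AE_lborel_prod:
  fixes P :: "'a::euclidean_space \<Rightarrow> bool"
  assumes "AE x in lborel. P x"
  shows "AE z in (lborel :: ('a \<times> 'a) measure). P (fst z) \<and> P (snd z)"
proof -
  obtain N where N: "N \<in> sets lborel" "emeasure lborel N = 0" "{x. \<not> P x} \<subseteq> N"
    using assms by (auto elim!: AE_E)
  have "emeasure (lborel \<Otimes>\<^sub>M lborel) (N \<times> (UNIV :: 'a set)) = 0"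
    using N by (subst lborel.emeasure_pair_measure_Times) auto
  moreover have "emeasure (lborel \<Otimes>\<^sub>M lborel) ((UNIV :: 'a set) \<times> N) = 0"
    using N by (subst lborel.emeasure_pair_measure_Times) auto
  ultimately have "N \<times> UNIV \<in> null_sets (lborel \<Otimes>\<^sub>M (lborel :: 'a measure))"
    "(UNIV :: 'a set) \<times> N \<in> null_sets (lborel \<Otimes>\<^sub>M (lborel :: 'a measure))"
    using N(1) by (auto simp: null_sets_def)
  then have "N \<times> UNIV \<union> UNIV \<times> N \<in> null_sets (lborel :: ('a \<times> 'a) measure)"
    unfolding lborel_prod by (rule null_sets.Un)
  then show ?thesis
    using N(3) by (intro AE_I') auto
qed

text \<open>The Riesz-Fischer argument, run for two exponents at once. The rate
  \<open>2 powr (- (Suc k * (r + 1)))\<close> pays for the weight \<open>2 ^ Suc k\<close> raised to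
  either exponent and still leaves the summable \<open>(1 / 2) ^ Suc k\<close>.\<close>

lemma geometric_differences_dominated:
  fixes f :: "nat \<Rightarrow> 'a \<Rightarrow> real" and r :: real
  assumes [measurable]: "\<And>k. f k \<in> borel_measurable M" and r: "2 \<le> r"
    and small: "\<And>k e. e \<in> {2, r} \<Longrightarrow> (\<integral>\<^sup>+x. ennreal (\<bar>f (Suc k) x - f k x\<bar> powr e) \<partial>M) \<le> ennreal (2 powr (- (real (Suc k) * (r + 1))))"
  obtains h where "h \<in> borel_measurable M" "\<And>x. 0 \<le> h x"
    "\<And>e. e \<in> {2, r} \<Longrightarrow> (\<integral>\<^sup>+x. ennreal (h x powr e) \<partial>M) < \<infinity>"
    "AE x in M. \<forall>k. \<bar>f (Suc k) x - f k x\<bar> \<le> (1 / 2) ^ Suc k * h x"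
proof -
  define D where "D k x = 2 ^ Suc k * \<bar>f (Suc k) x - f k x\<bar>" for k x
  have [measurable]: "D k \<in> borel_measurable M" for k unfolding D_def by measurable
  define S where "S e x = (\<Sum>k. ennreal (D k x powr e))" for e x
  have [measurable]: "S e \<in> borel_measurable M" for e unfolding S_def by measurable
  have S: "(\<integral>\<^sup>+x. S e x \<partial>M) < \<infinity>" if e: "e \<in> {2, r}" for e
  proof -
    have "(\<integral>\<^sup>+x. S e x \<partial>M) = (\<Sum>k. \<integral>\<^sup>+x. ennreal (D k x powr e) \<partial>M)"
      unfolding S_def by (rule nn_integral_suminf) measurable
    also have "\<dots> \<le> (\<Sum>k. ennreal ((1 / 2) ^ Suc k))"
    proof (rule suminf_le)
      fix k
      have "(\<integral>\<^sup>+x. ennreal (D k x powr e) \<partial>M) = (\<integral>\<^sup>+x. ennreal ((2 ^ Suc k) powr e) * ennreal (\<bar>f (Suc k) x - f k x\<bar> powr e) \<partial>M)"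
        unfolding D_def by (simp add: powr_mult ennreal_mult')
      also have "\<dots> = ennreal ((2 ^ Suc k) powr e) * (\<integral>\<^sup>+x. ennreal (\<bar>f (Suc k) x - f k x\<bar> powr e) \<partial>M)"
        by (rule nn_integral_cmult) measurable
      also have "\<dots> \<le> ennreal ((2 ^ Suc k) powr e) * ennreal (2 powr (- (real (Suc k) * (r + 1))))"
        by (intro mult_left_mono small e) auto
      also have "\<dots> = ennreal (2 powr (real (Suc k) * e - real (Suc k) * (r + 1)))"
        by (simp add: ennreal_mult'[symmetric] powr_realpow[symmetric] powr_powr powr_add[symmetric] del: power_Suc of_nat_Suc)
      also have "\<dots> \<le> ennreal (2 powr (- real (Suc k)))"
      proof (intro ennreal_leI powr_mono)
        have "real (Suc k) * e \<le> real (Suc k) * r"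
          using e r by (intro mult_left_mono) auto
        then show "real (Suc k) * e - real (Suc k) * (r + 1) \<le> - real (Suc k)"
          by (simp add: algebra_simps)
      qed auto
      also have "\<dots> = ennreal ((1 / 2) ^ Suc k)"
        by (simp add: powr_minus powr_realpow power_one_over inverse_eq_divide del: power_Suc of_nat_Suc)
      finally show "(\<integral>\<^sup>+x. ennreal (D k x powr e) \<partial>M) \<le> ennreal ((1 / 2) ^ Suc k)" .
    qed auto
    also have "\<dots> = ennreal 1"
    proof (rule suminf_ennreal_eq)
      show "(\<lambda>k. (1 / 2 :: real) ^ Suc k) sums 1" by (rule power_half_series)
    qed simp
    finally show ?thesis by (rule le_less_trans) simp
  qed
  \<comment> \<open>Each of the two powers already dominates every weighted difference, so their
    minimum does too, and only the minimum is bounded by both and hence integrable to both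
    exponents. Where a sum is infinite, \<open>enn2real\<close> returns 0; this happens on a null
    set.\<close>
  define h where "h x = min (enn2real (S 2 x) powr (1 / 2)) (enn2real (S r x) powr (1 / r))" for x
  have h0: "0 \<le> h x" for x by (simp add: h_def)
  have he: "h x \<le> enn2real (S e x) powr (1 / e)" if "e \<in> {2, r}" for e x
    using that by (auto simp: h_def)
  show ?thesis
  proof (rule that[of h])
    show "h \<in> borel_measurable M" unfolding h_def by measurable
    show "(\<integral>\<^sup>+x. ennreal (h x powr e) \<partial>M) < \<infinity>" if e: "e \<in> {2, r}" for e
    proof -
      have "(\<integral>\<^sup>+x. ennreal (h x powr e) \<partial>M) \<le> (\<integral>\<^sup>+x. S e x \<partial>M)"
      proof (rule nn_integral_mono)
        fix x
        have "h x powr e \<le> (enn2real (S e x) powr (1 / e)) powr e"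
          using he[OF e] h0 e r by (intro powr_mono2) auto
        also have "\<dots> = enn2real (S e x)" using e r by (auto simp: powr_powr)
        finally have "ennreal (h x powr e) \<le> ennreal (enn2real (S e x))" by (rule ennreal_leI)
        also have "\<dots> \<le> S e x" by (simp add: ennreal_enn2real_if)
        finally show "ennreal (h x powr e) \<le> S e x" .
      qed
      then show ?thesis using S[OF e] by (rule le_less_trans)
    qed
    have fin: "AE x in M. S e x \<noteq> \<infinity>" if "e \<in> {2, r}" for e
      using S[OF that] by (intro nn_integral_PInf_AE) auto
    show "AE x in M. \<forall>k. \<bar>f (Suc k) x - f k x\<bar> \<le> (1 / 2) ^ Suc k * h x"
      using fin[OF insertI1] fin[OF insertI2, OF singletonI]
    proof eventually_elim
      case (elim x)
      show ?case
      proof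
        fix k
        have "D k x \<le> enn2real (S e x) powr (1 / e)" if e: "e \<in> {2, r}" for e
        proof -
          have "(\<Sum>k\<in>{k}. ennreal (D k x powr e)) \<le> S e x"
            unfolding S_def by (rule sum_le_suminf) auto
          then have "ennreal (D k x powr e) \<le> S e x" by simp
          moreover have "S e x < top" using elim e by (auto simp: less_top[symmetric])
          ultimately have "enn2real (ennreal (D k x powr e)) \<le> enn2real (S e x)"
            by (rule enn2real_mono)
          then have "D k x powr e \<le> enn2real (S e x)" by simp
          then have "(D k x powr e) powr (1 / e) \<le> enn2real (S e x) powr (1 / e)"
            using e r by (intro powr_mono2) auto
          moreover have "(D k x powr e) powr (1 / e) = D k x"
            using e r by (auto simp: powr_powr D_def)
          ultimately show ?thesis by simp
        qed
        then have "D k x \<le> h x" by (simp add: h_def)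
        then show "\<bar>f (Suc k) x - f k x\<bar> \<le> (1 / 2) ^ Suc k * h x"
          by (simp add: D_def power_one_over field_simps)
      qed
    qed
  qed (fact h0)
qed

lemma geometric_differences_converge:
  fixes a :: "nat \<Rightarrow> real"
  assumes "\<And>k. \<bar>a (Suc k) - a k\<bar> \<le> (1 / 2) ^ Suc k * h"
  shows "convergent a" "\<bar>a k\<bar> \<le> \<bar>a 0\<bar> + h"
proof -
  have sm: "summable (\<lambda>k. (1 / 2) ^ Suc k * h)"
    by (intro summable_mult2) (simp add: summable_geometric)
  then have "summable (\<lambda>k. a (Suc k) - a k)"
    by (rule summable_comparison_test'[where N = 0]) (use assms in auto)
  then have "convergent (\<lambda>n. \<Sum>k<n. a (Suc k) - a k)"
    by (simp add: summable_iff_convergent)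
  then have "convergent (\<lambda>n. a n - a 0)"
    by (simp add: sum_lessThan_telescope)
  then have "convergent (\<lambda>n. (a n - a 0) + a 0)"
    by (intro convergent_add convergent_const)
  then show "convergent a" by simp
  have "0 \<le> (1 / 2) ^ Suc 0 * h" using assms[of 0] by (rule order_trans[OF abs_ge_zero])
  then have h: "0 \<le> h" by simp
  \<comment> \<open>The bound is sharpened by the partial geometric sum to make the induction go
    through.\<close>
  have "\<bar>a k\<bar> \<le> \<bar>a 0\<bar> + (1 - (1 / 2) ^ k) * h" for k
  proof (induction k)
    case (Suc k)
    have "\<bar>a (Suc k)\<bar> \<le> \<bar>a k\<bar> + (1 / 2) ^ Suc k * h" using assms[of k] by linarith
    also have "\<dots> \<le> \<bar>a 0\<bar> + (1 - (1 / 2) ^ k) * h + (1 / 2) ^ Suc k * h" using Suc by linarith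
    finally show ?case by (simp add: algebra_simps)
  qed simp
  from this[of k] h show "\<bar>a k\<bar> \<le> \<bar>a 0\<bar> + h"
    by (smt (verit) mult_left_le_one_le zero_le_power half_gt_zero mult_nonneg_nonneg left_diff_distrib)
qed

lemma fast_subsequence:
  fixes P :: "nat \<Rightarrow> nat \<Rightarrow> nat \<Rightarrow> bool"
  assumes "\<And>k. \<exists>K. \<forall>i\<ge>K. \<forall>j\<ge>K. P k i j"
  obtains \<tau> :: "nat \<Rightarrow> nat" where "strict_mono \<tau>" "\<And>k. P k (\<tau> (Suc k)) (\<tau> k)"
proof -
  obtain K where K: "\<And>k i j. K k \<le> i \<Longrightarrow> K k \<le> j \<Longrightarrow> P k i j"
    using assms by metis
  \<comment> \<open>Partial sums are strictly increasing and exceed the threshold \<open>K k\<close>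
    both at \<open>k\<close> and at \<open>Suc k\<close>, the two places where \<open>P k\<close> is
    evaluated.\<close>
  define \<tau> where "\<tau> k = (\<Sum>i\<le>k. Suc (K i))" for k
  have "strict_mono \<tau>" by (rule strict_mono_Suc_iff[THEN iffD2]) (simp add: \<tau>_def)
  moreover have "K k \<le> \<tau> k" for k
    using member_le_sum[of k "{..k}" "\<lambda>i. Suc (K i)"] by (simp add: \<tau>_def)
  moreover have "K k \<le> \<tau> (Suc k)" for k
    using \<open>K k \<le> \<tau> k\<close> by (simp add: \<tau>_def)
  ultimately show ?thesis using K by (intro that[of \<tau>]) auto
qed

lemma powr_add_le:
  fixes x y r :: real
  assumes "0 \<le> x" "0 \<le> y" "0 < r"
  shows "(x + y) powr r \<le> 2 powr r * (x powr r + y powr r)"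
proof -
  have "(x + y) powr r \<le> (2 * max x y) powr r"
    using assms by (intro powr_mono2) auto
  also have "\<dots> = 2 powr r * max x y powr r"
    using assms by (simp add: powr_mult)
  also have "max x y powr r \<le> x powr r + y powr r"
    by (auto simp: max_def)
  finally show ?thesis by simp
qed

text \<open>Truncation at height \<open>T\<close> replaces the interpolation inequality between
  Lebesgue norms: after integration the first term is small by convergence in the mean square, the
  second because \<open>r < t\<close> and \<open>T\<close> may be taken large.\<close>

lemma powr_interpolate:
  fixes x :: real
  assumes "2 < r" "r < t" "T > 0"
  shows "\<bar>x\<bar> powr r \<le> T powr (r - 2) * x\<^sup>2 + T powr (r - t) * \<bar>x\<bar> powr t"
proof (cases "x = 0")
  case False
  have e: "x\<^sup>2 = \<bar>x\<bar> powr 2" using False by (simp add: powr_numeral)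
  show ?thesis
  proof (cases "\<bar>x\<bar> \<le> T")
    case True
    have "\<bar>x\<bar> powr r = \<bar>x\<bar> powr (r - 2) * \<bar>x\<bar> powr 2" by (subst powr_add[symmetric]) simp
    also have "\<dots> \<le> T powr (r - 2) * x\<^sup>2" unfolding e
      using assms True by (intro mult_right_mono powr_mono2) auto
    finally show ?thesis by (smt (verit) mult_nonneg_nonneg powr_ge_zero)
  next
    case x: False
    have "\<bar>x\<bar> powr r = \<bar>x\<bar> powr (r - t) * \<bar>x\<bar> powr t" by (simp add: powr_add[symmetric])
    also have "\<dots> \<le> T powr (r - t) * \<bar>x\<bar> powr t"
      using assms x by (intro mult_right_mono powr_mono2') auto
    moreover have "0 \<le> T powr (r - 2) * x\<^sup>2" by simp
    ultimately show ?thesis by linarith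
  qed
qed simp

lemma powr_2_abs: "\<bar>x\<bar> powr 2 = (x::real)\<^sup>2"
  by (cases "x = 0") (auto simp: powr_numeral)

section \<open>Compactness up to the subcritical exponent\<close>

context coercive_potential
begin

lemma borel_potential_Lr_bound:
  assumes N: "2 * s < real CARD('n)"
    and r: "2 \<le> r" "r < 2 * real CARD('n) / (real CARD('n) - 2 * s)"
  obtains K where "K > 0"
    "\<And>u. u \<in> borel_potential s V \<Longrightarrow> sobolev_form s V u u \<le> M \<Longrightarrow> integrable lborel (\<lambda>x. \<bar>u x\<bar> powr r)"
    "\<And>u. u \<in> borel_potential s V \<Longrightarrow> sobolev_form s V u u \<le> M \<Longrightarrow> (LBINT x. \<bar>u x\<bar> powr r) \<le> K"
proof -
  define M' where "M' = \<bar>M\<bar> / V0 + \<bar>M\<bar> + 1"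
  have M': "M' > 0" using V0_pos by (simp add: M'_def add_nonneg_pos)
  obtain K where K: "K > 0" "\<And>u :: 'n fn. u \<in> borel_measurable borel \<Longrightarrow> (\<integral>\<^sup>+x. ennreal ((u x)\<^sup>2) \<partial>lborel) \<le> ennreal M' \<Longrightarrow>
       (\<integral>\<^sup>+z. ennreal (gagliardo s u u z) \<partial>lborel) \<le> ennreal M' \<Longrightarrow>
       (\<integral>\<^sup>+x. ennreal (\<bar>u x\<bar> powr r) \<partial>lborel) \<le> ennreal K"
    using sobolev_subcritical[OF s_pos N r M'] by blast
  have *: "(\<integral>\<^sup>+x. ennreal (\<bar>u x\<bar> powr r) \<partial>lborel) \<le> ennreal K" if u: "u \<in> borel_potential s V" "sobolev_form s V u u \<le> M" for u
  proof (rule K(2))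
    show "u \<in> borel_measurable borel" using borel_potentialD(1)[OF u(1)] .
    have "(LBINT x. (u x)\<^sup>2) \<le> \<bar>M\<bar> / V0"
      using sobolev_form_self_ge(1)[OF u(1)] u(2) V0_pos by (simp add: field_simps)
    then have "(LBINT x. (u x)\<^sup>2) \<le> M'" by (simp add: M'_def)
    then show "(\<integral>\<^sup>+x. ennreal ((u x)\<^sup>2) \<partial>lborel) \<le> ennreal M'"
      using borel_potentialD(2)[OF u(1)] by (subst nn_integral_eq_integral) (auto intro: ennreal_leI)
    have "0 \<le> \<bar>M\<bar> / V0" using V0_pos by simp
    then have "(LBINT z. gagliardo s u u z) \<le> M'"
      using sobolev_form_self_ge(2)[OF u(1)] u(2) unfolding M'_def by linarith
    then show "(\<integral>\<^sup>+z. ennreal (gagliardo s u u z) \<partial>lborel) \<le> ennreal M'"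
      using borel_potentialD(3)[OF u(1)] by (subst nn_integral_eq_integral) (auto intro: ennreal_leI)
  qed
  have i: "integrable lborel (\<lambda>x. \<bar>u x\<bar> powr r)" if u: "u \<in> borel_potential s V" "sobolev_form s V u u \<le> M" for u
  proof (rule integrableI_nonneg)
    note [measurable] = borel_potentialD(1)[OF u(1)]
    show "(\<lambda>x. \<bar>u x\<bar> powr r) \<in> borel_measurable lborel" by measurable
    show "(\<integral>\<^sup>+x. ennreal (\<bar>u x\<bar> powr r) \<partial>lborel) < \<infinity>"
      using *[OF u] by (rule le_less_trans) simp
  qed auto
  show ?thesis
  proof (rule that[OF K(1) i])
    fix u assume u: "u \<in> borel_potential s V" "sobolev_form s V u u \<le> M"
    show "(LBINT x. \<bar>u x\<bar> powr r) \<le> K"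
      using *[OF u] i[OF u] K(1) by (subst (asm) nn_integral_eq_integral) auto
  qed
qed

lemma borel_potential_Lr_integrable:
  assumes "2 * s < real CARD('n)" "2 \<le> r" "r < 2 * real CARD('n) / (real CARD('n) - 2 * s)" "u \<in> borel_potential s V"
  shows "integrable lborel (\<lambda>x. \<bar>u x\<bar> powr r)"
  using borel_potential_Lr_bound[OF assms(1-3), of "sobolev_form s V u u"] assms(4) by blast

lemma bounded_has_cauchy_subseq:
  fixes U :: "nat \<Rightarrow> 'n fn"
  assumes N: "2 * s < real CARD('n)" and r: "2 < r" "r < 2 * real CARD('n) / (real CARD('n) - 2 * s)"
    and U: "\<And>k. U k \<in> borel_potential s V" and M: "\<And>k. sobolev_form s V (U k) (U k) \<le> M"
  obtains \<sigma> :: "nat \<Rightarrow> nat" where "strict_mono \<sigma>"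
    "\<And>e. e > 0 \<Longrightarrow> \<exists>K. \<forall>j\<ge>K. \<forall>k\<ge>K. \<forall>t\<in>{2, r}. (LBINT x. \<bar>U (\<sigma> j) x - U (\<sigma> k) x\<bar> powr t) < e"
proof -
  obtain \<sigma> :: "nat \<Rightarrow> nat" where \<sigma>: "strict_mono \<sigma>"
    and c: "\<And>e. e > 0 \<Longrightarrow> \<exists>K. \<forall>j\<ge>K. \<forall>k\<ge>K. (LBINT x. (U (\<sigma> j) x - U (\<sigma> k) x)\<^sup>2) < e"
    using bounded_has_L2_cauchy_subseq[of U M, OF U M] by blast
  \<comment> \<open>Since \<open>r\<close> is strictly subcritical there is room for a larger
    admissible exponent, in which the differences are merely bounded.\<close>
  obtain t where t: "r < t" "t < 2 * real CARD('n) / (real CARD('n) - 2 * s)"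
    using dense[OF r(2)] by blast
  have t2: "2 \<le> t" using t r by simp
  obtain K where K: "K > 0"
    "\<And>u. u \<in> borel_potential s V \<Longrightarrow> sobolev_form s V u u \<le> 4 * M \<Longrightarrow> integrable lborel (\<lambda>x. \<bar>u x\<bar> powr t)"
    "\<And>u. u \<in> borel_potential s V \<Longrightarrow> sobolev_form s V u u \<le> 4 * M \<Longrightarrow> (LBINT x. \<bar>u x\<bar> powr t) \<le> K"
    using borel_potential_Lr_bound[OF N t2 t(2), of "4 * M"] by blast
  show ?thesis
  proof (rule that[OF \<sigma>])
    fix e :: real assume e: "e > 0"
    \<comment> \<open>\<open>T\<close> makes the contribution of large values,
      \<open>T powr (r - t) * K\<close>, equal to \<open>e / 2\<close>; \<open>d\<close> below then
      makes the mean square contribution less than \<open>e / 2\<close>.\<close>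
    define T where "T = (2 * K / e) powr (1 / (t - r))"
    have T: "T > 0" using K e by (simp add: T_def)
    have "1 / (t - r) * (r - t) = - 1"
      using t(1) by (simp add: field_simps)
    then have "T powr (r - t) = (2 * K / e) powr (- 1)"
      unfolding T_def powr_powr by (simp only:)
    then have TK: "T powr (r - t) * K = e / 2"
      using K e by (simp add: powr_minus)
    define d where "d = min e (e / 2 / T powr (r - 2))"
    have d: "d > 0" using e T by (simp add: d_def)
    obtain J where J: "\<And>j k. j \<ge> J \<Longrightarrow> k \<ge> J \<Longrightarrow> (LBINT x. (U (\<sigma> j) x - U (\<sigma> k) x)\<^sup>2) < d"
      using c[OF d] by blast
    show "\<exists>K. \<forall>j\<ge>K. \<forall>k\<ge>K. \<forall>t\<in>{2, r}. (LBINT x. \<bar>U (\<sigma> j) x - U (\<sigma> k) x\<bar> powr t) < e"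
    proof (intro exI allI impI ballI)
      fix j k q assume jk: "J \<le> j" "J \<le> k" and q: "q \<in> {2, r}"
      let ?w = "\<lambda>x. U (\<sigma> j) x - U (\<sigma> k) x"
      have w: "?w \<in> borel_potential s V" by (rule borel_potential_diff[OF U U])
      have h: "sobolev_form s V ?w ?w \<le> 4 * M" using sobolev_form_diff_le[OF U U, of "\<sigma> j" "\<sigma> k"] M[of "\<sigma> j"] M[of "\<sigma> k"] by linarith
      have wd: "(LBINT x. (?w x)\<^sup>2) < d" using J[OF jk] .
      show "(LBINT x. \<bar>?w x\<bar> powr q) < e"
      proof (cases "q = 2")
        case True
        then show ?thesis using wd by (simp add: powr_2_abs d_def)
      next
        case False
        then have q: "q = r" using q by simp
        have "(LBINT x. \<bar>?w x\<bar> powr r) \<le> (LBINT x. T powr (r - 2) * (?w x)\<^sup>2 + T powr (r - t) * \<bar>?w x\<bar> powr t)"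
          using borel_potentialD(2)[OF w] K(2)[OF w h] borel_potential_Lr_integrable[OF N _ r(2) w] r(1)
          by (intro integral_mono powr_interpolate[OF r(1) t(1) T]) auto
        also have "\<dots> = T powr (r - 2) * (LBINT x. (?w x)\<^sup>2) + T powr (r - t) * (LBINT x. \<bar>?w x\<bar> powr t)"
          using borel_potentialD(2)[OF w] K(2)[OF w h] by simp
        also have "\<dots> < T powr (r - 2) * (e / 2 / T powr (r - 2)) + T powr (r - t) * K"
        proof (intro add_less_le_mono mult_strict_left_mono mult_left_mono)
          show "(LBINT x. (?w x)\<^sup>2) < e / 2 / T powr (r - 2)" using wd by (simp add: d_def)
        qed (use T K(3)[OF w h] in auto)
        also have "\<dots> = e" using T TK by simp
        finally show ?thesis by (simp add: q)
      qed
    qed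
  qed
qed

text \<open>Convergence of the form to that of the limit is not claimed. Instead the limit
  \<open>\<nu>\<close> of the forms is returned together with the inequality from Fatou's lemma. The
  common majorant \<open>h\<close>, good for both exponents, lets dominated convergence handle the
  lower order integrals.\<close>

theorem bounded_compact:
  fixes U :: "nat \<Rightarrow> 'n fn"
  assumes N: "2 * s < real CARD('n)" and r: "2 < r" "r < 2 * real CARD('n) / (real CARD('n) - 2 * s)"
    and U: "\<And>k. U k \<in> borel_potential s V" and M: "\<And>k. sobolev_form s V (U k) (U k) \<le> M"
  obtains \<sigma> :: "nat \<Rightarrow> nat" and u h and \<nu> :: real where "strict_mono \<sigma>" "u \<in> borel_potential s V"
    "(\<lambda>k. sobolev_form s V (U (\<sigma> k)) (U (\<sigma> k))) \<longlonglongrightarrow> \<nu>" "sobolev_form s V u u \<le> \<nu>"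
    "h \<in> borel_measurable borel" "\<And>x. 0 \<le> h x" "integrable lborel (\<lambda>x. (h x)\<^sup>2)" "integrable lborel (\<lambda>x. h x powr r)"
    "\<And>k. AE x in lborel. \<bar>U (\<sigma> k) x\<bar> \<le> h x" "AE x in lborel. (\<lambda>k. U (\<sigma> k) x) \<longlonglongrightarrow> u x"
proof -
  \<comment> \<open>Indexing by \<open>bool\<close> makes the two parts of the form converge along
    one subsequence, so that Fatou's lemma can be applied to each part separately.\<close>
  define F where "F k z = (if z then \<integral>z. gagliardo s (U k) (U k) z \<partial>lborel else LBINT x. V x * (U k x)\<^sup>2)" for k z
  have FM: "norm (F k z) \<le> M" for k z
    using sobolev_form_self_ge[OF U, of k] M[of k] by (auto simp: F_def)
  obtain \<rho> :: "nat \<Rightarrow> nat" where \<rho>: "strict_mono \<rho>" and "\<And>z. z \<in> UNIV \<Longrightarrow> \<exists>l. (\<lambda>k. F (\<rho> k) z) \<longlonglongrightarrow> l"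
    by (rule function_convergent_subsequence[of UNIV F M]) (use FM in auto)
  then obtain \<nu>1 \<nu>2 where "(\<lambda>k. F (\<rho> k) True) \<longlonglongrightarrow> \<nu>1" "(\<lambda>k. F (\<rho> k) False) \<longlonglongrightarrow> \<nu>2" by blast
  then have \<nu>: "(\<lambda>k. LBINT z. gagliardo s (U (\<rho> k)) (U (\<rho> k)) z) \<longlonglongrightarrow> \<nu>1"
    "(\<lambda>k. LBINT x. V x * (U (\<rho> k) x)\<^sup>2) \<longlonglongrightarrow> \<nu>2"
    by (simp_all add: F_def)
  obtain \<sigma> :: "nat \<Rightarrow> nat" where \<sigma>: "strict_mono \<sigma>"
    and c: "\<And>e. e > 0 \<Longrightarrow> \<exists>K. \<forall>j\<ge>K. \<forall>k\<ge>K. \<forall>t\<in>{2, r}. (LBINT x. \<bar>U (\<rho> (\<sigma> j)) x - U (\<rho> (\<sigma> k)) x\<bar> powr t) < e"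
    using bounded_has_cauchy_subseq[of r "\<lambda>k. U (\<rho> k)" M, OF N r U M] by blast
  have "\<exists>K. \<forall>i\<ge>K. \<forall>j\<ge>K. \<forall>t\<in>{2, r}. (LBINT x. \<bar>U (\<rho> (\<sigma> i)) x - U (\<rho> (\<sigma> j)) x\<bar> powr t) < 2 powr (- (real (Suc k) * (r + 1)))" for k
    by (rule c) simp
  then obtain \<tau> :: "nat \<Rightarrow> nat" where \<tau>: "strict_mono \<tau>"
    and fast: "\<And>k. \<forall>t\<in>{2, r}. (LBINT x. \<bar>U (\<rho> (\<sigma> (\<tau> (Suc k)))) x - U (\<rho> (\<sigma> (\<tau> k))) x\<bar> powr t) < 2 powr (- (real (Suc k) * (r + 1)))"
    by (rule fast_subsequence[of "\<lambda>k i j. \<forall>t\<in>{2, r}. (LBINT x. \<bar>U (\<rho> (\<sigma> i)) x - U (\<rho> (\<sigma> j)) x\<bar> powr t) < 2 powr (- (real (Suc k) * (r + 1)))"]) blast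
  define \<pi> where "\<pi> k = \<rho> (\<sigma> (\<tau> k))" for k
  have \<pi>: "strict_mono \<pi>" using \<rho> \<sigma> \<tau> by (simp add: \<pi>_def strict_mono_def)
  have sub: "strict_mono (\<lambda>k. \<sigma> (\<tau> k))" using \<sigma> \<tau> by (simp add: strict_mono_def)
  have [measurable]: "U k \<in> borel_measurable borel" for k using borel_potentialD(1)[OF U] .
  have Lr: "integrable lborel (\<lambda>x. \<bar>w x\<bar> powr t)" if "w \<in> borel_potential s V" "t \<in> {2, r}" for w t
    using borel_potential_Lr_integrable[OF N _ r(2) that(1)] borel_potentialD(2)[OF that(1)] r(1) that(2) by (auto simp: powr_2_abs)
  obtain h where h: "h \<in> borel_measurable lborel" "\<And>x. 0 \<le> h x"
    "\<And>e. e \<in> {2, r} \<Longrightarrow> (\<integral>\<^sup>+x. ennreal (h x powr e) \<partial>lborel) < \<infinity>"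
    "AE x in lborel. \<forall>k. \<bar>U (\<pi> (Suc k)) x - U (\<pi> k) x\<bar> \<le> (1 / 2) ^ Suc k * h x"
  proof (rule geometric_differences_dominated[of "\<lambda>k. U (\<pi> k)" lborel r])
    fix k e assume e: "e \<in> {2, r}"
    have "(\<integral>\<^sup>+x. ennreal (\<bar>U (\<pi> (Suc k)) x - U (\<pi> k) x\<bar> powr e) \<partial>lborel) = ennreal (LBINT x. \<bar>U (\<pi> (Suc k)) x - U (\<pi> k) x\<bar> powr e)"
      by (rule nn_integral_eq_integral) (use Lr[OF borel_potential_diff[OF U U] e] in auto)
    also have "\<dots> \<le> ennreal (2 powr (- (real (Suc k) * (r + 1))))"
      using fast[of k] e by (intro ennreal_leI) (auto simp: \<pi>_def less_imp_le)
    finally show "(\<integral>\<^sup>+x. ennreal (\<bar>U (\<pi> (Suc k)) x - U (\<pi> k) x\<bar> powr e) \<partial>lborel) \<le> ennreal (2 powr (- (real (Suc k) * (r + 1))))" .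
  qed (use r in auto)
  have [measurable]: "h \<in> borel_measurable borel" using h(1) by simp
  define g where "g x = \<bar>U (\<pi> 0) x\<bar> + h x" for x
  have [measurable]: "g \<in> borel_measurable borel" unfolding g_def by measurable
  have hi: "integrable lborel (\<lambda>x. h x powr t)" if "t \<in> {2, r}" for t
    using h(3)[OF that] by (intro integrableI_nonneg) auto
  have gi: "integrable lborel (\<lambda>x. g x powr t)" if t: "t \<in> {2, r}" for t
  proof (rule Bochner_Integration.integrable_bound)
    show "integrable lborel (\<lambda>x. 2 powr t * (\<bar>U (\<pi> 0) x\<bar> powr t + h x powr t))"
      using hi[OF t] Lr[OF U t] by simp
    show "AE x in lborel. norm (g x powr t) \<le> norm (2 powr t * (\<bar>U (\<pi> 0) x\<bar> powr t + h x powr t))"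
      using powr_add_le[of "\<bar>U (\<pi> 0) x\<bar>" "h x" t for x] h(2) r t
      by (auto simp: g_def intro!: order_trans[OF powr_add_le])
  qed measurable
  \<comment> \<open>\<open>lim\<close> yields a function that is Borel measurable on the whole
    space; its value at points of divergence is arbitrary but concerns a null set only.\<close>
  define u where "u x = lim (\<lambda>k. U (\<pi> k) x)" for x
  have [measurable]: "u \<in> borel_measurable borel"
    unfolding u_def by (rule borel_measurable_lim_metric) measurable
  have conv: "AE x in lborel. (\<lambda>k. U (\<pi> k) x) \<longlonglongrightarrow> u x"
    using h(4)
  proof eventually_elim
    case (elim x)
    then show ?case
      using geometric_differences_converge(1)[of "\<lambda>k. U (\<pi> k) x" "h x"] unfolding u_def
      by (auto simp: convergent_LIMSEQ_iff)
  qed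
  have bound: "AE x in lborel. \<bar>U (\<pi> k) x\<bar> \<le> g x" for k
    using h(4)
  proof eventually_elim
    case (elim x)
    then show ?case
      using geometric_differences_converge(2)[of "\<lambda>k. U (\<pi> k) x" "h x" k] by (simp add: g_def)
  qed
  have \<nu>': "(\<lambda>k. LBINT z. gagliardo s (U (\<pi> k)) (U (\<pi> k)) z) \<longlonglongrightarrow> \<nu>1"
    "(\<lambda>k. LBINT x. V x * (U (\<pi> k) x)\<^sup>2) \<longlonglongrightarrow> \<nu>2"
    using LIMSEQ_subseq_LIMSEQ[OF \<nu>(1) sub] LIMSEQ_subseq_LIMSEQ[OF \<nu>(2) sub] by (simp_all add: \<pi>_def o_def)
  have \<nu>0: "0 \<le> \<nu>1" "0 \<le> \<nu>2"
    using \<nu>' by (auto intro!: tendsto_lowerbound[OF \<nu>'(1)] tendsto_lowerbound[OF \<nu>'(2)] always_eventually)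
  have G: "(\<integral>\<^sup>+z. ennreal (gagliardo s u u z) \<partial>lborel) \<le> ennreal \<nu>1"
  proof -
    have "(\<integral>\<^sup>+z. ennreal (gagliardo s u u z) \<partial>lborel) = (\<integral>\<^sup>+z. liminf (\<lambda>k. ennreal (gagliardo s (U (\<pi> k)) (U (\<pi> k)) z)) \<partial>lborel)"
    proof (rule nn_integral_cong_AE)
      show "AE z in lborel. ennreal (gagliardo s u u z) = liminf (\<lambda>k. ennreal (gagliardo s (U (\<pi> k)) (U (\<pi> k)) z))"
        using AE_lborel_prod[OF conv]
      proof eventually_elim
        case (elim z)
        have "(\<lambda>k. gagliardo s (U (\<pi> k)) (U (\<pi> k)) z) \<longlonglongrightarrow> gagliardo s u u z"
          using elim by (cases z) (auto simp only: gagliardo_apply divide_inverse fst_conv snd_conv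
              intro!: tendsto_mult tendsto_diff tendsto_const)
        then have "(\<lambda>k. ennreal (gagliardo s (U (\<pi> k)) (U (\<pi> k)) z)) \<longlonglongrightarrow> ennreal (gagliardo s u u z)"
          by (rule tendsto_ennrealI)
        then show ?case by (rule lim_imp_Liminf[OF trivial_limit_sequentially, symmetric])
      qed
    qed
    also have "\<dots> \<le> liminf (\<lambda>k. \<integral>\<^sup>+z. ennreal (gagliardo s (U (\<pi> k)) (U (\<pi> k)) z) \<partial>lborel)"
      by (rule nn_integral_liminf) measurable
    also have "\<dots> = liminf (\<lambda>k. ennreal (LBINT z. gagliardo s (U (\<pi> k)) (U (\<pi> k)) z))"
      using borel_potentialD(3)[OF U] by (simp add: nn_integral_eq_integral)
    also have "\<dots> = ennreal \<nu>1"
      by (rule lim_imp_Liminf[OF trivial_limit_sequentially tendsto_ennrealI[OF \<nu>'(1)]])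
    finally show ?thesis .
  qed
  have P: "(\<integral>\<^sup>+x. ennreal (V x * (u x)\<^sup>2) \<partial>lborel) \<le> ennreal \<nu>2"
  proof -
    have "(\<integral>\<^sup>+x. ennreal (V x * (u x)\<^sup>2) \<partial>lborel) = (\<integral>\<^sup>+x. liminf (\<lambda>k. ennreal (V x * (U (\<pi> k) x)\<^sup>2)) \<partial>lborel)"
    proof (rule nn_integral_cong_AE)
      show "AE x in lborel. ennreal (V x * (u x)\<^sup>2) = liminf (\<lambda>k. ennreal (V x * (U (\<pi> k) x)\<^sup>2))"
        using conv
      proof eventually_elim
        case (elim x)
        have "(\<lambda>k. V x * (U (\<pi> k) x)\<^sup>2) \<longlonglongrightarrow> V x * (u x)\<^sup>2"
          using elim by (intro tendsto_intros)
        then have "(\<lambda>k. ennreal (V x * (U (\<pi> k) x)\<^sup>2)) \<longlonglongrightarrow> ennreal (V x * (u x)\<^sup>2)"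
          by (rule tendsto_ennrealI)
        then show ?case by (rule lim_imp_Liminf[OF trivial_limit_sequentially, symmetric])
      qed
    qed
    also have "\<dots> \<le> liminf (\<lambda>k. \<integral>\<^sup>+x. ennreal (V x * (U (\<pi> k) x)\<^sup>2) \<partial>lborel)"
      by (rule nn_integral_liminf) measurable
    also have "\<dots> = liminf (\<lambda>k. ennreal (LBINT x. V x * (U (\<pi> k) x)\<^sup>2))"
      using borel_potentialD(4)[OF U] by (simp add: nn_integral_eq_integral)
    also have "\<dots> = ennreal \<nu>2"
      by (rule lim_imp_Liminf[OF trivial_limit_sequentially tendsto_ennrealI[OF \<nu>'(2)]])
    finally show ?thesis .
  qed
  have u: "u \<in> borel_potential s V"
    unfolding borel_potential_def
  proof (intro CollectI conjI)
    show "integrable lborel (\<lambda>x. (u x)\<^sup>2)"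
    proof (rule Bochner_Integration.integrable_bound[OF gi[of 2]])
      have "AE x in lborel. \<forall>k. \<bar>U (\<pi> k) x\<bar> \<le> g x"
        using bound by (simp add: AE_all_countable)
      with conv have "AE x in lborel. \<bar>u x\<bar> \<le> g x"
      proof eventually_elim
        case (elim x)
        show ?case
          by (rule tendsto_upperbound[OF tendsto_rabs[OF elim(1)]]) (use elim(2) in auto)
      qed
      then show "AE x in lborel. norm ((u x)\<^sup>2) \<le> norm (g x powr 2)"
      proof eventually_elim
        case (elim x)
        then have "(u x)\<^sup>2 \<le> \<bar>g x\<bar> powr 2"
          by (simp only: powr_2_abs abs_le_square_iff[symmetric])
        moreover have "\<bar>g x\<bar> = g x" using elim by linarith
        ultimately show ?case by simp
      qed
    qed auto
    show "integrable lborel (gagliardo s u u)"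
      using G by (intro integrableI_nonneg) (auto intro: le_less_trans)
    show "integrable lborel (\<lambda>x. V x * (u x)\<^sup>2)"
      using P by (intro integrableI_nonneg) (auto intro: le_less_trans)
  qed measurable
  show ?thesis
  proof (rule that[OF \<pi> u])
    show "(\<lambda>k. sobolev_form s V (U (\<pi> k)) (U (\<pi> k))) \<longlonglongrightarrow> \<nu>1 + \<nu>2"
      using tendsto_add[OF \<nu>'] by (simp add: sobolev_form_def power2_eq_square mult.assoc)
    have "ennreal (sobolev_form s V u u) \<le> ennreal (\<nu>1 + \<nu>2)"
      unfolding ennreal_sobolev_form_self[OF u] using G P \<nu>0 by (simp add: add_mono)
    then show "sobolev_form s V u u \<le> \<nu>1 + \<nu>2" using \<nu>0 by (simp only: ennreal_le_iff add_nonneg_nonneg)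
    show "integrable lborel (\<lambda>x. (g x)\<^sup>2)" using gi[of 2] h(2) by (simp add: g_def powr_numeral)
    show "integrable lborel (\<lambda>x. g x powr r)" using gi[of r] by simp
    show "0 \<le> g x" for x using h(2)[of x] by (simp add: g_def)
  qed (use conv bound in auto)
qed

end

section \<open>Tent functions\<close>

lemma dyadic_between:
  fixes t :: real
  assumes "0 < t"
  shows "(\<exists>n. (1 / 2) ^ Suc n \<le> t \<and> t < (1 / 2) ^ n) \<or> (\<exists>n. 2 ^ n \<le> t \<and> t < 2 ^ Suc n)"
proof (cases "t < 1")
  case True
  define m where "m = (LEAST m. (1 / 2) ^ m \<le> t)"
  obtain k where "(1 / 2) ^ k < t" using real_arch_pow_inv[of t "1 / 2"] assms by auto
  then have m: "(1 / 2) ^ m \<le> t" using LeastI[of "\<lambda>m. (1 / 2) ^ m \<le> t" k] by (simp add: m_def)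
  then have "m \<noteq> 0" using True by (intro notI) simp
  then obtain n where n: "m = Suc n" by (cases m) auto
  have "\<not> (1 / 2) ^ n \<le> t" using not_less_Least[of n "\<lambda>m. (1 / 2) ^ m \<le> t"] n by (simp add: m_def)
  then show ?thesis using m n by auto
next
  case False
  define m where "m = (LEAST m. t < 2 ^ m)"
  obtain k where "t < 2 ^ k" using real_arch_pow[of 2 t] by auto
  then have m: "t < 2 ^ m" using LeastI[of "\<lambda>m. t < 2 ^ m" k] by (simp add: m_def)
  then have "m \<noteq> 0" using False by (intro notI) simp
  then obtain n where n: "m = Suc n" by (cases m) auto
  have "\<not> t < 2 ^ n" using not_less_Least[of n "\<lambda>m. t < 2 ^ m"] n by (simp add: m_def)
  then show ?thesis using m n by auto
qed

text \<open>Dyadic shells. On a shell of radius about \<open>2 powr (- n)\<close> the kernel is at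
  most \<open>a n\<close>, and multiplication by the ball volume leaves a geometric series of ratio
  \<open>2 powr (2 * s - 2)\<close>, convergent because \<open>s < 1\<close>. On outer shells
  \<open>b n\<close> gives the ratio \<open>2 powr (- (2 * s))\<close>, convergent because
  \<open>0 < s\<close>. Ball volumes do not depend on the centre, so the bound is uniform in
  \<open>x\<close>.\<close>

lemma kernel_integral_bound:
  fixes s :: real
  assumes s: "0 < s" "s < 1"
  obtains C where "0 \<le> C" "\<And>x :: real ^ 'n::finite.
    (\<integral>\<^sup>+y. ennreal (min 1 ((norm (x - y))\<^sup>2) / norm (x - y) powr (real CARD('n) + 2 * s)) \<partial>lborel) \<le> ennreal C"
proof -
  define N where "N = real CARD('n)"
  have N: "N > 0" by (simp add: N_def)
  define d where "d = N + 2 * s"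
  have d: "d > 0" using N s by (simp add: d_def)
  define \<omega> where "\<omega> = measure lborel (ball (0::real^'n) 1)"
  have \<omega>: "\<omega> \<ge> 0" by (simp add: \<omega>_def)
  define a where "a n = 2 powr (d + real n * (d - 2))" for n :: nat
  define b where "b n = 2 powr (- (real n * d))" for n :: nat
  have half: "(1 / 2 :: real) ^ n = 2 powr (- real n)" for n
    by (simp add: powr_minus powr_realpow power_one_over inverse_eq_divide)
  have two: "(2 :: real) ^ n = 2 powr real n" for n
    by (simp add: powr_realpow)
  define c where "c n = 2 powr d * \<omega> * (2 powr (2 * s - 2)) ^ n + 2 powr N * \<omega> * (2 powr (- (2 * s))) ^ n" for n
  have sm: "summable c"
    unfolding c_def using s by (intro summable_add summable_mult summable_geometric) (auto simp: powr_less_one)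
  have c0: "0 \<le> c n" for n using \<omega> by (simp add: c_def)
  have "(\<integral>\<^sup>+y. ennreal (min 1 ((norm (x - y))\<^sup>2) / norm (x - y) powr d) \<partial>lborel) \<le> ennreal (suminf c)" for x :: "real^'n"
  proof -
    define f where "f n y = ennreal (a n) * indicator (ball x ((1 / 2) ^ n)) y + ennreal (b n) * indicator (ball x (2 ^ Suc n)) y" for n y
    have pw: "ennreal (min 1 ((norm (x - y))\<^sup>2) / norm (x - y) powr d) \<le> (\<Sum>n. f n y)" for y
    proof (cases "x = y")
      case False
      define t where "t = norm (x - y)"
      have t: "0 < t" using False by (simp add: t_def)
      have "\<exists>n. ennreal (min 1 (t\<^sup>2) / t powr d) \<le> f n y"
        using dyadic_between[OF t]
      proof (elim disjE exE conjE)
        fix n assume n: "(1 / 2) ^ Suc n \<le> t" "t < (1 / 2) ^ n"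
        have "t\<^sup>2 \<le> ((1 / 2) ^ n)\<^sup>2" using n t by (intro power_mono) auto
        also have "\<dots> = 2 powr (- 2 * real n)" unfolding half by (simp add: powr_powr[symmetric] powr_numeral[symmetric] powr_powr mult.commute del: powr_numeral)
        finally have "min 1 (t\<^sup>2) \<le> 2 powr (- 2 * real n)" by simp
        moreover have "t powr (- d) \<le> ((1 / 2) ^ Suc n) powr (- d)"
          using n t d by (intro powr_mono2') auto
        then have "t powr (- d) \<le> 2 powr (real (Suc n) * d)"
          by (simp only: half powr_powr minus_mult_minus)
        ultimately have "min 1 (t\<^sup>2) * t powr (- d) \<le> 2 powr (- 2 * real n) * 2 powr (real (Suc n) * d)"
          by (intro mult_mono) auto
        also have "\<dots> = a n" by (simp add: a_def powr_add[symmetric] algebra_simps)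
        finally have "ennreal (min 1 (t\<^sup>2) / t powr d) \<le> ennreal (a n)"
          by (intro ennreal_leI) (simp add: powr_minus divide_inverse)
        moreover have "y \<in> ball x ((1 / 2) ^ n)" using n by (simp add: t_def dist_norm)
        ultimately have "ennreal (min 1 (t\<^sup>2) / t powr d) \<le> f n y"
          unfolding f_def by (simp add: add_increasing2)
        then show ?thesis ..
      next
        fix n assume n: "2 ^ n \<le> t" "t < 2 ^ Suc n"
        have "t powr (- d) \<le> (2 ^ n) powr (- d)"
          using n t d by (intro powr_mono2') auto
        then have "t powr (- d) \<le> b n"
          unfolding two powr_powr b_def by simp
        then have "min 1 (t\<^sup>2) * t powr (- d) \<le> 1 * b n"
          by (intro mult_mono) auto
        then have "ennreal (min 1 (t\<^sup>2) / t powr d) \<le> ennreal (b n)"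
          by (intro ennreal_leI) (simp add: powr_minus divide_inverse)
        moreover have "y \<in> ball x (2 ^ Suc n)" using n by (simp add: t_def dist_norm)
        ultimately have "ennreal (min 1 (t\<^sup>2) / t powr d) \<le> f n y"
          unfolding f_def by (simp add: add_increasing del: power_Suc)
        then show ?thesis ..
      qed
      then obtain n where n: "ennreal (min 1 (t\<^sup>2) / t powr d) \<le> f n y" ..
      also have "f n y = (\<Sum>n\<in>{n}. f n y)" by simp
      also have "\<dots> \<le> (\<Sum>n. f n y)" by (rule sum_le_suminf) auto
      finally show ?thesis by (simp add: t_def)
    qed simp
    have "(\<integral>\<^sup>+y. ennreal (min 1 ((norm (x - y))\<^sup>2) / norm (x - y) powr d) \<partial>lborel) \<le> (\<integral>\<^sup>+y. (\<Sum>n. f n y) \<partial>lborel)"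
      by (intro nn_integral_mono pw)
    also have "\<dots> = (\<Sum>n. \<integral>\<^sup>+y. f n y \<partial>lborel)"
    proof (rule nn_integral_suminf)
      fix n
      have [measurable]: "ball x e \<in> sets borel" for e by simp
      show "f n \<in> borel_measurable lborel" unfolding f_def by measurable
    qed
    also have "\<dots> = (\<Sum>n. ennreal (c n))"
    proof (rule suminf_cong)
      fix n
      have [measurable]: "ball x e \<in> sets borel" for e by simp
      have m: "(\<lambda>y. ennreal c * indicator (ball x e) y) \<in> borel_measurable lborel" for c e by measurable
      have "(\<integral>\<^sup>+y. f n y \<partial>lborel) = ennreal (a n) * emeasure lborel (ball x ((1 / 2) ^ n)) + ennreal (b n) * emeasure lborel (ball x (2 ^ Suc n))"
        unfolding f_def by (simp add: nn_integral_add[OF m m] nn_integral_cmult_indicator del: power_Suc)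
      also have "\<dots> = ennreal (a n) * ennreal (((1 / 2) ^ n) powr N * \<omega>) + ennreal (b n) * ennreal ((2 ^ Suc n) powr N * \<omega>)"
        by (subst (1 2) emeasure_lborel_ball) (auto simp: N_def \<omega>_def)
      also have "\<dots> = ennreal (a n * (((1 / 2) ^ n) powr N * \<omega>) + b n * ((2 ^ Suc n) powr N * \<omega>))"
        using \<omega> by (simp add: ennreal_mult'[symmetric] a_def b_def flip: ennreal_plus)
      also have "a n * (((1 / 2) ^ n) powr N * \<omega>) = 2 powr d * \<omega> * (2 powr (2 * s - 2)) ^ n"
        unfolding half a_def powr_powr by (simp add: powr_realpow[symmetric] powr_powr powr_add[symmetric] d_def algebra_simps)
      also have "b n * ((2 ^ Suc n) powr N * \<omega>) = 2 powr N * \<omega> * (2 powr (- (2 * s))) ^ n"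
        unfolding two b_def powr_powr by (simp add: powr_realpow[symmetric] powr_powr powr_add[symmetric] d_def algebra_simps)
      finally show "(\<integral>\<^sup>+y. f n y \<partial>lborel) = ennreal (c n)" by (simp add: c_def)
    qed
    also have "\<dots> = ennreal (suminf c)"
      by (rule suminf_ennreal2[OF c0 sm])
    finally show ?thesis .
  qed
  then show ?thesis
    using that[of "suminf c"] suminf_nonneg[OF sm c0] by (simp add: d_def N_def)
qed

text \<open>A compactly supported Lipschitz function, positive on a whole ball. It supplies explicit
  elements of the space: they show that the Nehari set is nonempty, and they test the positivity of
  the minimizer ball by ball.\<close>

definition tent :: "real \<Rightarrow> (real ^ 'n::finite) \<Rightarrow> real" where
  "tent R x = max 0 (R - norm x)"

lemma tent_measurable [measurable]: "tent R \<in> borel_measurable borel"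
  unfolding tent_def by measurable

text \<open>The numerator vanishes unless one of the points lies in the ball, and it is controlled
  by \<open>min 1 ((norm (x - y))\<^sup>2)\<close> because the tent is both bounded and 1-Lipschitz.
  Keeping the point of the ball fixed and integrating the other one reduces both halves to
  \<open>kernel_integral_bound\<close>.\<close>

lemma tent_gagliardo_integrable:
  fixes s R :: real
  assumes s: "0 < s" "s < 1" and R: "R > 0"
  shows "integrable lborel (gagliardo s (tent R) (tent R :: ('n::finite) fn))"
proof (rule integrableI_nonneg)
  let ?t = "tent R :: 'n fn"
  let ?d = "real CARD('n) + 2 * s"
  show "gagliardo s ?t ?t \<in> borel_measurable lborel"
    using gagliardo_measurable[OF tent_measurable tent_measurable] by simp
  obtain C where C: "0 \<le> C" "\<And>x :: real ^ 'n.
    (\<integral>\<^sup>+y. ennreal (min 1 ((norm (x - y))\<^sup>2) / norm (x - y) powr ?d) \<partial>lborel) \<le> ennreal C"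
    using kernel_integral_bound[OF s] by blast
  define B where "B = ball (0::real^'n) R"
  define k where "k = (\<lambda>(x::real^'n, y::real^'n). ennreal (min 1 ((norm (x - y))\<^sup>2) / norm (x - y) powr ?d))"
  have k_sym: "k (x, y) = k (y, x)" for x y by (simp add: k_def norm_minus_commute)
  have [measurable]: "(\<lambda>z::(real^'n)\<times>(real^'n). norm (fst z - snd z)) \<in> borel_measurable borel"
    by (intro borel_measurable_continuous_onI continuous_intros)
  have kb: "k \<in> borel_measurable borel"
    unfolding k_def case_prod_unfold by measurable
  then have [measurable]: "k \<in> borel_measurable (lborel \<Otimes>\<^sub>M lborel)" by (simp add: lborel_prod)
  have [measurable]: "B \<in> sets borel" by (simp add: B_def)
  have lip: "\<bar>tent R x - tent R y\<bar> \<le> norm (x - y)" for x y :: "real^'n"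
    using norm_triangle_ineq3[of x y] by (auto simp: tent_def max_def)
  have bd: "0 \<le> tent R x" "tent R x \<le> R" for x :: "real^'n" using R by (auto simp: tent_def)
  have bound: "ennreal (gagliardo s ?t ?t (x, y)) \<le> ennreal (1 + R\<^sup>2) * (k (x, y) * indicator B x + k (x, y) * indicator B y)" for x y
  proof (cases "x \<in> B \<or> y \<in> B")
    case True
    have 1: "(tent R x - tent R y)\<^sup>2 \<le> (norm (x - y))\<^sup>2"
      using lip[of x y] by (subst abs_le_square_iff[symmetric]) auto
    have 2: "(tent R x - tent R y)\<^sup>2 \<le> R\<^sup>2"
      using bd[of x] bd[of y] by (subst abs_le_square_iff[symmetric]) auto
    have "(tent R x - tent R y)\<^sup>2 \<le> (1 + R\<^sup>2) * min 1 ((norm (x - y))\<^sup>2)"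
    proof (cases "1 \<le> (norm (x - y))\<^sup>2")
      case True
      then show ?thesis using 2 by simp
    next
      case False
      have "1 * (norm (x - y))\<^sup>2 \<le> (1 + R\<^sup>2) * (norm (x - y))\<^sup>2" by (intro mult_right_mono) auto
      then show ?thesis using 1 False by simp
    qed
    then have "(tent R x - tent R y)\<^sup>2 / norm (x - y) powr ?d \<le> (1 + R\<^sup>2) * min 1 ((norm (x - y))\<^sup>2) / norm (x - y) powr ?d"
      by (rule divide_right_mono) simp
    then have "ennreal (gagliardo s ?t ?t (x, y)) \<le> ennreal ((1 + R\<^sup>2) * (min 1 ((norm (x - y))\<^sup>2) / norm (x - y) powr ?d))"
      by (intro ennreal_leI) (simp add: gagliardo_apply power2_eq_square)
    also have "\<dots> = ennreal (1 + R\<^sup>2) * k (x, y)"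
      unfolding k_def prod.case by (rule ennreal_mult') simp
    also have "\<dots> \<le> ennreal (1 + R\<^sup>2) * (k (x, y) * indicator B x + k (x, y) * indicator B y)"
      using True by (intro mult_left_mono) (auto simp: add_increasing add_increasing2 split: split_indicator)
    finally show ?thesis .
  next
    case False
    then show ?thesis by (simp add: gagliardo_apply tent_def B_def dist_norm)
  qed
  have "(\<integral>\<^sup>+z. k z * indicator B (fst z) \<partial>(lborel \<Otimes>\<^sub>M lborel)) = (\<integral>\<^sup>+x. \<integral>\<^sup>+y. k (x, y) * indicator B x \<partial>lborel \<partial>lborel)"
    by (subst lborel.nn_integral_fst[symmetric]) auto
  also have "\<dots> = (\<integral>\<^sup>+x. (\<integral>\<^sup>+y. k (x, y) \<partial>lborel) * indicator B x \<partial>lborel)"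
    by (intro nn_integral_cong nn_integral_multc) measurable
  also have "\<dots> \<le> (\<integral>\<^sup>+x. ennreal C * indicator B x \<partial>lborel)"
    using C(2) by (intro nn_integral_mono mult_right_mono) (auto simp: k_def)
  also have "\<dots> = ennreal C * emeasure lborel B"
    by (simp add: nn_integral_cmult_indicator)
  also have "\<dots> < \<infinity>"
    using emeasure_lborel_ball_finite[of "0::real^'n" R] by (simp add: B_def ennreal_mult_less_top)
  finally have I1: "(\<integral>\<^sup>+z. k z * indicator B (fst z) \<partial>(lborel \<Otimes>\<^sub>M lborel)) < \<infinity>" .
  have "(\<integral>\<^sup>+z. k z * indicator B (snd z) \<partial>(lborel \<Otimes>\<^sub>M lborel)) = (\<integral>\<^sup>+y. \<integral>\<^sup>+x. k (x, y) * indicator B y \<partial>lborel \<partial>lborel)"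
    by (subst lborel_pair.nn_integral_snd[symmetric]) (auto simp: case_prod_unfold)
  also have "\<dots> = (\<integral>\<^sup>+y. (\<integral>\<^sup>+x. k (x, y) \<partial>lborel) * indicator B y \<partial>lborel)"
    by (intro nn_integral_cong nn_integral_multc) measurable
  also have "\<dots> = (\<integral>\<^sup>+y. (\<integral>\<^sup>+x. k (y, x) \<partial>lborel) * indicator B y \<partial>lborel)"
    by (subst k_sym) rule
  also have "\<dots> \<le> (\<integral>\<^sup>+x. ennreal C * indicator B x \<partial>lborel)"
    using C(2) by (intro nn_integral_mono mult_right_mono) (auto simp: k_def)
  also have "\<dots> = ennreal C * emeasure lborel B"
    by (simp add: nn_integral_cmult_indicator)
  also have "\<dots> < \<infinity>"
    using emeasure_lborel_ball_finite[of "0::real^'n" R] by (simp add: B_def ennreal_mult_less_top)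
  finally have I2: "(\<integral>\<^sup>+z. k z * indicator B (snd z) \<partial>(lborel \<Otimes>\<^sub>M lborel)) < \<infinity>" .
  have "(\<integral>\<^sup>+z. ennreal (gagliardo s ?t ?t z) \<partial>lborel) \<le>
    (\<integral>\<^sup>+z. ennreal (1 + R\<^sup>2) * (k z * indicator B (fst z) + k z * indicator B (snd z)) \<partial>(lborel \<Otimes>\<^sub>M lborel))"
    unfolding lborel_prod by (intro nn_integral_mono) (use bound in \<open>auto split: prod.split\<close>)
  also have "\<dots> = ennreal (1 + R\<^sup>2) * ((\<integral>\<^sup>+z. k z * indicator B (fst z) \<partial>(lborel \<Otimes>\<^sub>M lborel)) + (\<integral>\<^sup>+z. k z * indicator B (snd z) \<partial>(lborel \<Otimes>\<^sub>M lborel)))"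
    by (subst nn_integral_cmult, measurable, subst nn_integral_add, measurable)
  also have "\<dots> < \<infinity>"
    using I1 I2 by (simp add: ennreal_mult_less_top)
  finally show "(\<integral>\<^sup>+z. ennreal (gagliardo s ?t ?t z) \<partial>lborel) < \<infinity>" .
qed simp

lemma tent_borel_potential:
  fixes V :: "('n::finite) fn"
  assumes s: "0 < s" "s < 1" and R: "R > 0" and V: "continuous_on UNIV V"
  shows "tent R \<in> borel_potential s V"
proof -
  let ?B = "cball (0::real^'n) R"
  have ct: "continuous_on UNIV (tent R :: 'n fn)"
    unfolding tent_def by (intro continuous_intros)
  have i: "integrable lborel (\<lambda>x::real^'n. f x * (tent R x)\<^sup>2)" if f: "continuous_on UNIV f" for f :: "'n fn"
  proof -
    have "continuous_on ?B (\<lambda>x. f x * (tent R x)\<^sup>2)"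
      by (intro continuous_intros continuous_on_subset[OF f] continuous_on_subset[OF ct]) auto
    then have "integrable lborel (\<lambda>x. indicator ?B x *\<^sub>R (f x * (tent R x)\<^sup>2))"
      using borel_integrable_compact[of ?B "\<lambda>x. f x * (tent R x)\<^sup>2"] by (simp add: indicator_def if_distrib cong: if_cong)
    moreover have "(\<lambda>x. indicator ?B x *\<^sub>R (f x * (tent R x)\<^sup>2)) = (\<lambda>x. f x * (tent R x)\<^sup>2)"
      by (auto simp: indicator_def tent_def fun_eq_iff)
    ultimately show ?thesis by simp
  qed
  show ?thesis
    unfolding borel_potential_def using i[OF V] i[of "\<lambda>_. 1"] tent_gagliardo_integrable[OF s R] by auto
qed

section \<open>Borel representatives\<close>

text \<open>In a completion, equality almost everywhere preserves measurability. The target space is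
  general because real and extended real integrands are both transferred this way.\<close>

lemma measurable_completion_AE:
  assumes g: "g \<in> measurable (completion M) N" and ae: "AE x in M. f x = g x" and f: "\<And>x. x \<in> space M \<Longrightarrow> f x \<in> space N"
  shows "f \<in> measurable (completion M) N"
proof (rule measurableI)
  fix A assume A: "A \<in> sets N"
  show "f -` A \<inter> space (completion M) \<in> sets (completion M)"
  proof (rule completion.in_sets_AE)
    show "g -` A \<inter> space (completion M) \<in> sets (completion M)"
      by (rule measurable_sets[OF g A])
    show "AE x in completion M. (x \<in> g -` A \<inter> space (completion M)) = (x \<in> f -` A \<inter> space (completion M))"
      using AE_completion[OF ae] by eventually_elim auto
  qed auto
qed (use f in auto)

lemma lebesgue_integral_eq_borel:
  fixes f g :: "'a::euclidean_space \<Rightarrow> real"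
  assumes g: "g \<in> borel_measurable borel" and ae: "AE x in lborel. f x = g x"
  shows "integrable lebesgue f \<longleftrightarrow> integrable lborel g" "integral\<^sup>L lebesgue f = integral\<^sup>L lborel g"
    "f \<in> borel_measurable lebesgue"
proof -
  have gl: "g \<in> borel_measurable lborel" using g by simp
  have gL: "g \<in> borel_measurable lebesgue" by (rule measurable_completion[OF gl])
  show fL: "f \<in> borel_measurable lebesgue"
    by (rule measurable_completion_AE[OF gL ae]) simp
  have ae': "AE x in lebesgue. f x = g x" by (rule AE_completion[OF ae])
  show "integrable lebesgue f \<longleftrightarrow> integrable lborel g"
    using integrable_cong_AE[OF fL gL ae'] integrable_completion[OF gl] by simp
  show "integral\<^sup>L lebesgue f = integral\<^sup>L lborel g"
    using integral_cong_AE[OF fL gL ae'] integral_completion[OF gl] by simp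
qed

lemma lebesgue_ex_borel:
  fixes f :: "'a::euclidean_space \<Rightarrow> real"
  assumes "f \<in> borel_measurable lebesgue"
  obtains g where "g \<in> borel_measurable borel" "AE x in lborel. f x = g x"
  using completion_ex_borel_measurable_real[OF assms] by auto

lemma AE_gagliardo_eq:
  assumes "AE x in lborel. u x = u' x" "AE x in lborel. \<phi> x = \<phi>' x"
  shows "AE z in lborel. gagliardo s u \<phi> z = gagliardo s u' \<phi>' z"
  using AE_lborel_prod[OF assms(1)] AE_lborel_prod[OF assms(2)]
  by eventually_elim (auto simp: gagliardo_def split: prod.split)

context positive_potential
begin

lemma potential_space_representative:
  assumes u: "u \<in> potential_space s V"
  obtains u' where "u' \<in> borel_potential s V" "AE x in lborel. u x = u' x"
proof -
  have um: "u \<in> borel_measurable lebesgue" and u2: "integrable lebesgue (\<lambda>x. \<bar>u x\<bar> powr 2)"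
    and ug: "integrable lebesgue (\<lambda>(x, y). (u x - u y)\<^sup>2 / norm (x - y) powr (real CARD('n) + 2 * s))"
    and uV: "integrable lebesgue (\<lambda>x. V x * (u x)\<^sup>2)"
    using u by (auto simp: potential_space_def frac_sobolev_def in_Lp_def)
  obtain u' where u': "u' \<in> borel_measurable borel" "AE x in lborel. u x = u' x"
    using lebesgue_ex_borel[OF um] .
  note [measurable] = u'(1)
  have 1: "integrable lborel (\<lambda>x. (u' x)\<^sup>2)"
  proof -
    have "AE x in lborel. \<bar>u x\<bar> powr 2 = (u' x)\<^sup>2" using u'(2) by eventually_elim (simp add: powr_2_abs)
    then show ?thesis using lebesgue_integral_eq_borel(1)[of "\<lambda>x. (u' x)\<^sup>2"] u2 by simp
  qed
  have 2: "integrable lborel (\<lambda>x. V x * (u' x)\<^sup>2)"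
  proof -
    have "AE x in lborel. V x * (u x)\<^sup>2 = V x * (u' x)\<^sup>2" using u'(2) by eventually_elim simp
    then show ?thesis using lebesgue_integral_eq_borel(1)[of "\<lambda>x. V x * (u' x)\<^sup>2"] uV by simp
  qed
  have 3: "integrable lborel (gagliardo s u' u')"
  proof -
    have "(\<lambda>(x, y). (u x - u y)\<^sup>2 / norm (x - y) powr (real CARD('n) + 2 * s)) = gagliardo s u u"
      by (auto simp: gagliardo_def power2_eq_square)
    then show ?thesis
      using lebesgue_integral_eq_borel(1)[OF gagliardo_measurable[OF u'(1) u'(1)] AE_gagliardo_eq[OF u'(2) u'(2)]] ug by simp
  qed
  show ?thesis using that[OF _ u'(2)] u'(1) 1 2 3 by (simp add: borel_potential_def)
qed

lemma borel_potential_potential_space: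
  assumes u: "u \<in> borel_potential s V"
  shows "u \<in> potential_space s V"
proof -
  note [measurable] = borel_potentialD(1)[OF u]
  have "(\<lambda>(x, y). (u x - u y)\<^sup>2 / norm (x - y) powr (real CARD('n) + 2 * s)) = gagliardo s u u"
    by (auto simp: gagliardo_def power2_eq_square)
  moreover have "integrable lebesgue (gagliardo s u u)"
    using lebesgue_integral_eq_borel(1)[OF gagliardo_measurable[OF borel_potentialD(1)[OF u] borel_potentialD(1)[OF u], of s], of "gagliardo s u u"] borel_potentialD(3)[OF u] by simp
  moreover have "integrable lebesgue (\<lambda>x. (u x)\<^sup>2)" "integrable lebesgue (\<lambda>x. V x * (u x)\<^sup>2)"
    using lebesgue_integral_eq_borel(1)[of "\<lambda>x. (u x)\<^sup>2" "\<lambda>x. (u x)\<^sup>2"] borel_potentialD[OF u]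
      lebesgue_integral_eq_borel(1)[of "\<lambda>x. V x * (u x)\<^sup>2" "\<lambda>x. V x * (u x)\<^sup>2"] by auto
  moreover have "u \<in> borel_measurable lebesgue"
    using lebesgue_integral_eq_borel(3)[of u u] by simp
  ultimately show ?thesis
    by (simp add: potential_space_def frac_sobolev_def in_Lp_def powr_2_abs)
qed

end

section \<open>Fibering maps\<close>

text \<open>The tangent at 0 of the convex function \<open>exp\<close>. Concavity of the fibre
  slopes in \<open>ln t\<close> is used only through this inequality.\<close>

lemma powr_ge_one_plus_ln:
  assumes "0 < (t::real)"
  shows "1 + c * ln t \<le> t powr c"
  using exp_ge_add_one_self[of "c * ln t"] assms by (simp add: powr_def)

text \<open>One-variable calculus on a single fibre: below, \<open>n\<close>, \<open>A\<close>,
  \<open>B\<close>, \<open>C\<close> stand for the squared norm, the two singular integrals and the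
  coupling integral of a pair, and \<open>r\<close> for \<open>\<alpha> + \<beta>\<close>.\<close>

locale fibering =
  fixes lam \<theta> p q r :: real
  assumes lam_pos: "0 < lam" and \<theta>_pos: "0 < \<theta>" and p_pos: "0 < p" and pq: "p \<le> q" and q1: "q < 1" and r2: "2 < r"
begin

definition fibre_energy :: "real \<Rightarrow> real \<Rightarrow> real \<Rightarrow> real \<Rightarrow> real \<Rightarrow> real" where
  "fibre_energy n A B C t = t\<^sup>2 * n / 2 - lam / (1 - p) * (t powr (1 - p) * A) - lam / (1 - q) * (t powr (1 - q) * B)
     - \<theta> / r * (t powr r * C)"

text \<open>\<open>t * fibre_slope n A B C t\<close> is the derivative of \<open>fibre_energy n A B C\<close>; the factor \<open>t\<close> is split off because
  \<open>fibre_slope n A B C\<close> is concave as a function of \<open>ln t\<close>.\<close>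

definition fibre_slope :: "real \<Rightarrow> real \<Rightarrow> real \<Rightarrow> real \<Rightarrow> real \<Rightarrow> real" where
  "fibre_slope n A B C t = n - lam * (t powr (- 1 - p) * A) - lam * (t powr (- 1 - q) * B) - \<theta> * (t powr (r - 2) * C)"

text \<open>The derivative of the slope at 1. If the slope vanishes at 1, eliminating
  \<open>n\<close> from the formula for \<open>energy''\<close> gives exactly this expression, so
  its sign describes \<open>nehari_minus\<close>.\<close>

definition fibre_slope_deriv :: "real \<Rightarrow> real \<Rightarrow> real \<Rightarrow> real" where
  "fibre_slope_deriv A B C = lam * (1 + p) * A + lam * (1 + q) * B - \<theta> * (r - 2) * C"

lemma fibre_slope_tangent_one:
  assumes "0 < t" "0 \<le> A" "0 \<le> B" "0 \<le> C"
  shows "fibre_slope n A B C t \<le> fibre_slope n A B C 1 + ln t * fibre_slope_deriv A B C"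
proof -
  have 1: "lam * ((1 + (- 1 - p) * ln t) * A) \<le> lam * (t powr (- 1 - p) * A)"
    using assms lam_pos by (intro mult_left_mono mult_right_mono powr_ge_one_plus_ln) auto
  have 2: "lam * ((1 + (- 1 - q) * ln t) * B) \<le> lam * (t powr (- 1 - q) * B)"
    using assms lam_pos by (intro mult_left_mono mult_right_mono powr_ge_one_plus_ln) auto
  have 3: "\<theta> * ((1 + (r - 2) * ln t) * C) \<le> \<theta> * (t powr (r - 2) * C)"
    using assms \<theta>_pos by (intro mult_left_mono mult_right_mono powr_ge_one_plus_ln) auto
  have "fibre_slope n A B C t \<le> n - lam * ((1 + (- 1 - p) * ln t) * A) - lam * ((1 + (- 1 - q) * ln t) * B) - \<theta> * ((1 + (r - 2) * ln t) * C)"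
    unfolding fibre_slope_def using 1 2 3 by linarith
  also have "\<dots> = fibre_slope n A B C 1 + ln t * fibre_slope_deriv A B C"
    by (simp add: fibre_slope_def fibre_slope_deriv_def algebra_simps)
  finally show ?thesis .
qed

text \<open>\<open>t\<^sup>2\<close> times the derivative of the slope in \<open>ln t\<close> at
  \<open>t\<close>, expressed through the data of the pair multiplied by \<open>t\<close>.
  Statements at the parameter 1 thus move to any other parameter.\<close>

definition scaled_fibre_slope_deriv :: "real \<Rightarrow> real \<Rightarrow> real \<Rightarrow> real \<Rightarrow> real" where
  "scaled_fibre_slope_deriv A B C t = fibre_slope_deriv (t powr (1 - p) * A) (t powr (1 - q) * B) (t powr r * C)"

lemma powr_scale_shift:
  assumes "0 < c" "0 < (t::real)"
  shows "t powr x * c powr (x + 2) = c\<^sup>2 * (c * t) powr x"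
  using assms by (simp add: powr_mult powr_add powr_numeral mult_ac)

lemma fibre_slope_scale:
  assumes "0 < c" "0 < t"
  shows "fibre_slope (c\<^sup>2 * n) (c powr (1 - p) * A) (c powr (1 - q) * B) (c powr r * C) t = c\<^sup>2 * fibre_slope n A B C (c * t)"
proof -
  have "t powr (- 1 - p) * c powr (1 - p) = c\<^sup>2 * (c * t) powr (- 1 - p)"
    "t powr (- 1 - q) * c powr (1 - q) = c\<^sup>2 * (c * t) powr (- 1 - q)"
    "t powr (r - 2) * c powr r = c\<^sup>2 * (c * t) powr (r - 2)"
    using powr_scale_shift[OF assms, of "- 1 - p"] powr_scale_shift[OF assms, of "- 1 - q"]
      powr_scale_shift[OF assms, of "r - 2"] by simp_all
  then show ?thesis
    unfolding fibre_slope_def mult.assoc[symmetric] by (simp add: algebra_simps)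
qed

lemma fibre_energy_scale:
  assumes "0 < c" "0 < t"
  shows "fibre_energy (c\<^sup>2 * n) (c powr (1 - p) * A) (c powr (1 - q) * B) (c powr r * C) t = fibre_energy n A B C (c * t)"
  using assms unfolding fibre_energy_def by (simp add: powr_mult power_mult_distrib algebra_simps)

lemma fibre_slope_tangent:
  assumes "0 < t" "0 < c" "0 \<le> A" "0 \<le> B" "0 \<le> C"
  shows "c\<^sup>2 * fibre_slope n A B C t \<le> c\<^sup>2 * fibre_slope n A B C c + ln (t / c) * scaled_fibre_slope_deriv A B C c"
  using fibre_slope_tangent_one[of "t / c" "c powr (1 - p) * A" "c powr (1 - q) * B" "c powr r * C" "c\<^sup>2 * n"] assms
  by (simp add: fibre_slope_scale scaled_fibre_slope_deriv_def)

lemma fibre_energy_has_derivative: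
  assumes t: "0 < t"
  shows "(fibre_energy n A B C has_real_derivative t * fibre_slope n A B C t) (at t)"
proof -
  have e: "t * (t powr (- 1 - p)) = t powr (- p)" "t * (t powr (- 1 - q)) = t powr (- q)" "t * (t powr (r - 2)) = t powr (r - 1)"
    using t by (simp_all add: powr_mult_base)
  have 1: "((\<lambda>t. t powr (1 - p)) has_real_derivative (1 - p) * t powr (1 - p - 1)) (at t)"
    "((\<lambda>t. t powr (1 - q)) has_real_derivative (1 - q) * t powr (1 - q - 1)) (at t)"
    "((\<lambda>t. t powr r) has_real_derivative r * t powr (r - 1)) (at t)"
    by (rule has_real_derivative_powr[OF t])+
  have 0: "((\<lambda>t. t\<^sup>2 * n / 2) has_real_derivative 2 * t * n / 2) (at t)"
    by (auto intro!: derivative_eq_intros)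
  have "(fibre_energy n A B C has_real_derivative (2 * t * n / 2 - lam / (1 - p) * (((1 - p) * t powr (1 - p - 1)) * A)
     - lam / (1 - q) * (((1 - q) * t powr (1 - q - 1)) * B) - \<theta> / r * ((r * t powr (r - 1)) * C))) (at t)"
    unfolding fibre_energy_def
    by (rule DERIV_diff[OF DERIV_diff[OF DERIV_diff[OF 0 DERIV_cmult[OF DERIV_cmult_right[OF 1(1)]]]
          DERIV_cmult[OF DERIV_cmult_right[OF 1(2)]]] DERIV_cmult[OF DERIV_cmult_right[OF 1(3)]]])
  moreover have "2 * t * n / 2 - lam / (1 - p) * (((1 - p) * t powr (1 - p - 1)) * A)
     - lam / (1 - q) * (((1 - q) * t powr (1 - q - 1)) * B) - \<theta> / r * ((r * t powr (r - 1)) * C)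
     = t * n - lam * (t powr (- p) * A) - lam * (t powr (- q) * B) - \<theta> * (t powr (r - 1) * C)"
    using p_pos pq q1 r2 by simp
  moreover have "t * fibre_slope n A B C t = t * n - lam * (t powr (- p) * A) - lam * (t powr (- q) * B) - \<theta> * (t powr (r - 1) * C)"
    unfolding e[symmetric] fibre_slope_def by (simp add: algebra_simps)
  ultimately show ?thesis by (simp only:)
qed

lemma fibre_slope_has_derivative_one: "(fibre_slope n A B C has_real_derivative fibre_slope_deriv A B C) (at 1)"
proof -
  have 1: "((\<lambda>t. t powr c) has_real_derivative c) (at 1)" for c :: real
    using has_real_derivative_powr[of 1 c] by simp
  show ?thesis
    unfolding fibre_slope_def by (auto intro!: derivative_eq_intros 1 simp: fibre_slope_deriv_def algebra_simps)
qed

lemma continuous_on_fibre_slope: "continuous_on {0<..} (fibre_slope n A B C)"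
  unfolding fibre_slope_def by (intro continuous_intros) auto

lemma continuous_on_fibre_energy: "continuous_on {0<..} (fibre_energy n A B C)"
  unfolding fibre_energy_def by (intro continuous_intros) auto

lemma fibre_energy_increasing:
  assumes "0 < s" "s \<le> t" "\<And>x. s \<le> x \<Longrightarrow> x \<le> t \<Longrightarrow> 0 \<le> fibre_slope n A B C x"
  shows "fibre_energy n A B C s \<le> fibre_energy n A B C t"
proof (rule DERIV_nonneg_imp_nondecreasing[OF assms(2)])
  fix x assume x: "s \<le> x" "x \<le> t"
  then show "\<exists>y. (fibre_energy n A B C has_real_derivative y) (at x) \<and> 0 \<le> y"
    using assms(1) assms(3)[OF x] by (intro exI[of _ "x * fibre_slope n A B C x"] conjI fibre_energy_has_derivative) auto
qed

lemma fibre_energy_decreasing: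
  assumes "0 < s" "s \<le> t" "\<And>x. s \<le> x \<Longrightarrow> x \<le> t \<Longrightarrow> fibre_slope n A B C x \<le> 0"
  shows "fibre_energy n A B C t \<le> fibre_energy n A B C s"
proof (rule DERIV_nonpos_imp_nonincreasing[OF assms(2)])
  fix x assume x: "s \<le> x" "x \<le> t"
  then show "\<exists>y. (fibre_energy n A B C has_real_derivative y) (at x) \<and> y \<le> 0"
    using assms(1) assms(3)[OF x] by (intro exI[of _ "x * fibre_slope n A B C x"] conjI fibre_energy_has_derivative) (auto simp: mult_le_0_iff)
qed

lemma fibre_slope_neg_after:
  assumes "0 \<le> A" "0 \<le> B" "0 \<le> C" "fibre_slope n A B C 1 = 0" "fibre_slope_deriv A B C < 0" "1 < t"
  shows "fibre_slope n A B C t < 0"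
  using fibre_slope_tangent_one[of t A B C n] assms mult_pos_neg[of "ln t" "fibre_slope_deriv A B C"] by simp

text \<open>Concavity in \<open>ln t\<close> makes the set of nonnegative slope an interval, and the
  negative derivative at 1 makes 1 its right end. The energy therefore does not decrease from
  \<open>t\<close> up to 1.\<close>

lemma fibre_max:
  assumes ABC: "0 \<le> A" "0 \<le> B" "0 \<le> C" and h1: "fibre_slope n A B C 1 = 0" and d: "fibre_slope_deriv A B C < 0"
    and t: "0 < t" and ht: "0 \<le> fibre_slope n A B C t"
  shows "t \<le> 1" "fibre_energy n A B C t \<le> fibre_energy n A B C 1"
proof -
  show t1: "t \<le> 1" using fibre_slope_neg_after[OF ABC h1 d, of t] ht by force
  show "fibre_energy n A B C t \<le> fibre_energy n A B C 1"
  proof (rule fibre_energy_increasing[OF t t1])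
    fix x assume x: "t \<le> x" "x \<le> 1"
    show "0 \<le> fibre_slope n A B C x"
    proof (rule ccontr)
      assume "\<not> ?thesis"
      then have neg: "fibre_slope n A B C x < 0" by simp
      then have x': "t < x" "x < 1" using x ht h1 by (auto simp: less_le)
      have x0: "0 < x" using t x by simp
      have n: "x\<^sup>2 * fibre_slope n A B C x < 0" using neg x0 by (simp add: mult_pos_neg)
      have "0 \<le> x\<^sup>2 * fibre_slope n A B C t" using ht by simp
      \<comment> \<open>The tangent at \<open>x\<close> starts from a negative value. The
        nonnegative slope at \<open>t\<close>, on its left, forces it to fall; the zero at 1, on its
        right, forces it to rise.\<close>
      then have "0 < ln (t / x) * scaled_fibre_slope_deriv A B C x" using fibre_slope_tangent[OF t x0 ABC, of n] n by linarith
      moreover have "ln (t / x) < 0" using x' t by simp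
      ultimately have "scaled_fibre_slope_deriv A B C x < 0" by (simp add: zero_less_mult_iff)
      moreover have "0 < ln (1 / x) * scaled_fibre_slope_deriv A B C x" using fibre_slope_tangent[of 1 x A B C n] x0 ABC n h1 by simp
      moreover have "ln (1 / x) > 0" using x' x0 by (simp add: ln_div)
      ultimately show False by (simp add: zero_less_mult_iff)
    qed
  qed
qed

text \<open>The intermediate value theorem alone yields a zero. That the slope decreases strictly
  there comes from its tangent at the zero, which must lie above the positive value at
  \<open>t0\<close>.\<close>

lemma fibre_crossing:
  assumes ABC: "0 \<le> A" "0 \<le> B" "0 \<le> C" and t: "0 < t0" "t0 < t1" and h: "0 < fibre_slope n A B C t0" "fibre_slope n A B C t1 < 0"
  obtains t where "t0 < t" "t < t1" "fibre_slope n A B C t = 0" "scaled_fibre_slope_deriv A B C t < 0"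
proof -
  have "continuous_on {t0..t1} (fibre_slope n A B C)"
    by (rule continuous_on_subset[OF continuous_on_fibre_slope]) (use t in auto)
  then obtain t where t': "t0 \<le> t" "t \<le> t1" "fibre_slope n A B C t = 0"
    using IVT2'[of "fibre_slope n A B C" t1 0 t0] h t by auto
  have tt: "t0 < t" "t < t1" using t' h by (auto simp: less_le)
  have "0 < t\<^sup>2 * fibre_slope n A B C t0" using h(1) tt t by simp
  then have "0 < ln (t0 / t) * scaled_fibre_slope_deriv A B C t"
    using fibre_slope_tangent[of t0 t A B C n] ABC t tt t'(3) by simp
  moreover have "ln (t0 / t) < 0" using tt t by simp
  ultimately have "scaled_fibre_slope_deriv A B C t < 0" by (simp add: zero_less_mult_iff)
  then show ?thesis using that tt t'(3) by blast
qed

lemma fibre_projection: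
  assumes ABC: "0 \<le> A" "0 \<le> B" "0 < C" and t: "0 < t0" and h: "0 < fibre_slope n A B C t0"
  obtains t where "t0 < t" "fibre_slope n A B C t = 0" "scaled_fibre_slope_deriv A B C t < 0"
proof -
  \<comment> \<open>\<open>T\<close> solves
    \<open>\<theta> * C * T powr (r - 2) = \<bar>n\<bar> + 1\<close>, so from \<open>T\<close> on
    the coupling term alone outweighs \<open>n\<close>.\<close>
  define T where "T = ((\<bar>n\<bar> + 1) / (\<theta> * C)) powr (1 / (r - 2))"
  define t1 where "t1 = max (t0 + 1) T"
  have t1: "t0 < t1" "0 < t1" using t by (auto simp: t1_def)
  have "(\<bar>n\<bar> + 1) / (\<theta> * C) = T powr (r - 2)"
    using r2 ABC \<theta>_pos by (simp add: T_def powr_powr)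
  also have "\<dots> \<le> t1 powr (r - 2)"
    using r2 by (intro powr_mono2) (auto simp: t1_def T_def)
  finally have "\<bar>n\<bar> + 1 \<le> \<theta> * (t1 powr (r - 2) * C)"
    using ABC \<theta>_pos by (simp add: field_simps)
  moreover have "0 \<le> lam * (t1 powr (- 1 - p) * A)" "0 \<le> lam * (t1 powr (- 1 - q) * B)"
    using lam_pos ABC by auto
  ultimately have "fibre_slope n A B C t1 < 0" unfolding fibre_slope_def by linarith
  then show ?thesis
    using fibre_crossing[of A B C t0 t1 n] ABC t t1 h that by (metis less_imp_le)
qed

text \<open>The energy is at most \<open>t\<^sup>2 * n / 2\<close>, so it has no positive limit at 0
  and an initial decreasing piece runs below zero. A nonnegative value can only be taken where the
  slope is nonnegative or beyond 1, and there the value at 1 dominates.\<close>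

lemma fibre_energy_le_one_if_nonneg:
  assumes ABC: "0 \<le> A" "0 \<le> B" "0 \<le> C" and h1: "fibre_slope n A B C 1 = 0" and d: "fibre_slope_deriv A B C < 0"
    and n: "0 \<le> n" and t: "0 < t" and et: "0 \<le> fibre_energy n A B C t"
  shows "fibre_energy n A B C t \<le> fibre_energy n A B C 1"
proof (cases "0 \<le> fibre_slope n A B C t")
  case True
  then show ?thesis using fibre_max[OF ABC h1 d t] by simp
next
  case False
  then have neg: "fibre_slope n A B C t < 0" by simp
  show ?thesis
  proof (cases "1 < t")
    case True
    then show ?thesis
      using fibre_slope_neg_after[OF ABC h1 d] h1 by (intro fibre_energy_decreasing) (auto simp: less_le intro: order.order_iff_strict[THEN iffD2] less_imp_le)
  next
    case False
    then have t1: "t < 1" using h1 neg by (cases "t = 1") auto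
    have tn: "t\<^sup>2 * fibre_slope n A B C t < 0" using neg t by (simp add: mult_pos_neg)
    then have "0 < ln (1 / t) * scaled_fibre_slope_deriv A B C t" using fibre_slope_tangent[of 1 t A B C n] t ABC h1 by simp
    moreover have "ln (1 / t) > 0" using t1 t by (simp add: ln_div)
    ultimately have ds: "scaled_fibre_slope_deriv A B C t > 0" by (simp add: zero_less_mult_iff)
    have hneg: "fibre_slope n A B C x < 0" if x: "0 < x" "x \<le> t" for x
    proof -
      have "ln (x / t) * scaled_fibre_slope_deriv A B C t \<le> 0" using x t ds by (intro mult_nonpos_nonneg) auto
      then have "t\<^sup>2 * fibre_slope n A B C x < 0" using fibre_slope_tangent[OF x(1) t ABC, of n] tn by linarith
      then show ?thesis by (simp add: mult_less_0_iff)
    qed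
    \<comment> \<open>Comparison with the behaviour at 0 yields only \<open>\<le> 0\<close> at
      \<open>t / 2\<close>; the strict drop from \<open>t / 2\<close> to \<open>t\<close> is what
      contradicts a nonnegative energy at \<open>t\<close>.\<close>
    have lt: "fibre_energy n A B C t < fibre_energy n A B C (t / 2)"
    proof (rule DERIV_neg_imp_decreasing[where f = "fibre_energy n A B C"])
      fix x assume x: "t / 2 \<le> x" "x \<le> t"
      then show "\<exists>y. (fibre_energy n A B C has_real_derivative y) (at x) \<and> y < 0"
        using t hneg[of x] by (intro exI[of _ "x * fibre_slope n A B C x"] conjI fibre_energy_has_derivative) (auto simp: mult_less_0_iff)
    qed (use t in simp)
    have "fibre_energy n A B C (t / 2) \<le> (t / 2 / real (Suc k))\<^sup>2 * n / 2" for k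
    proof -
      let ?x = "t / 2 / real (Suc k)"
      have x: "0 < ?x" "?x \<le> t / 2" using t by (auto simp: field_simps)
      have "fibre_energy n A B C (t / 2) \<le> fibre_energy n A B C ?x"
      proof (rule fibre_energy_decreasing[OF x])
        fix y assume "?x \<le> y" "y \<le> t / 2"
        then show "fibre_slope n A B C y \<le> 0"
          using hneg[of y] x(1) t by linarith
      qed
      also have "\<dots> \<le> ?x\<^sup>2 * n / 2"
      proof -
        have "0 \<le> lam / (1 - p) * (?x powr (1 - p) * A)" "0 \<le> lam / (1 - q) * (?x powr (1 - q) * B)" "0 \<le> \<theta> / r * (?x powr r * C)"
          using ABC lam_pos \<theta>_pos p_pos pq q1 r2 by auto
        then show ?thesis unfolding fibre_energy_def by linarith
      qed
      finally show ?thesis .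
    qed
    moreover have "(\<lambda>k. (t / 2 / real (Suc k))\<^sup>2 * n / 2) \<longlonglongrightarrow> 0\<^sup>2 * n / 2"
      by (intro tendsto_intros LIMSEQ_Suc[OF lim_const_over_n]) auto
    ultimately have "fibre_energy n A B C (t / 2) \<le> 0"
      using LIMSEQ_le_const[of _ "0\<^sup>2 * n / 2" "fibre_energy n A B C (t / 2)"] by fastforce
    then show ?thesis using lt et by linarith
  qed
qed

lemma fibre_slope_pos_left_of_one:
  assumes h1: "fibre_slope n A B C 1 = 0" and d: "fibre_slope_deriv A B C < 0"
  obtains \<delta> where "0 < \<delta>" "\<delta> < 1" "\<And>t. 1 - \<delta> < t \<Longrightarrow> t < 1 \<Longrightarrow> 0 < fibre_slope n A B C t"
proof -
  obtain \<delta> where \<delta>: "\<delta> > 0" "\<And>x. 0 < x \<Longrightarrow> x < \<delta> \<Longrightarrow> fibre_slope n A B C 1 < fibre_slope n A B C (1 - x)"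
    using DERIV_neg_dec_left[OF fibre_slope_has_derivative_one d] by blast
  show ?thesis
  proof (rule that[of "min \<delta> (1/2)"])
    show "0 < fibre_slope n A B C t" if "1 - min \<delta> (1/2) < t" "t < 1" for t
      using \<delta>(2)[of "1 - t"] that h1 by auto
  qed (use \<delta>(1) in auto)
qed

lemma fibre_energy_le_near_one:
  assumes ABC: "0 \<le> A" "0 \<le> B" "0 \<le> C" and h1: "fibre_slope n A B C 1 = 0" and d: "fibre_slope_deriv A B C < 0"
  obtains \<delta> where "0 < \<delta>" "\<delta> < 1" "\<And>t. 1 - \<delta> < t \<Longrightarrow> fibre_energy n A B C t \<le> fibre_energy n A B C 1"
proof -
  obtain \<delta> where \<delta>: "0 < \<delta>" "\<delta> < 1" "\<And>t. 1 - \<delta> < t \<Longrightarrow> t < 1 \<Longrightarrow> 0 < fibre_slope n A B C t"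
    using fibre_slope_pos_left_of_one[OF h1 d] by blast
  show ?thesis
  proof (rule that[OF \<delta>(1,2)])
    fix t assume t: "1 - \<delta> < t"
    show "fibre_energy n A B C t \<le> fibre_energy n A B C 1"
    proof (cases "t < 1")
      case True
      then show ?thesis using \<delta> t by (intro fibre_max(2)[OF ABC h1 d]) (auto intro: less_imp_le)
    next
      case False
      have "fibre_slope n A B C x \<le> 0" if "1 \<le> x" for x
        using fibre_slope_neg_after[OF ABC h1 d, of x] h1 that by (cases "x = 1") auto
      then show ?thesis using False by (intro fibre_energy_decreasing) auto
    qed
  qed
qed

text \<open>If the Rayleigh quotient of the energy comes arbitrarily close to \<open>lam\<close> on the fibre, it
  attains \<open>lam\<close> there, because it is at most \<open>lam / 2\<close> outside a compact set of parameters.\<close>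

lemma fibre_energy_one_nonneg:
  assumes ABC: "0 < A" "0 \<le> B" "0 < C" and h1: "fibre_slope n A B C 1 = 0" and d: "fibre_slope_deriv A B C < 0" and n: "0 < n"
  defines "D \<equiv> \<lambda>t. t powr (1 - p) * A / (1 - p) + t powr (1 - q) * B / (1 - q)"
  assumes approx: "\<And>e. e > 0 \<Longrightarrow> \<exists>t>0. fibre_energy n A B C t + e * D t > 0"
  shows "0 \<le> fibre_energy n A B C 1"
proof -
  have p1: "p < 1" using pq q1 by simp
  define e where "e t = t\<^sup>2 * n / 2 - \<theta> / r * (t powr r * C)" for t
  have fibre_energy: "fibre_energy n A B C t = e t - lam * D t" for t
    by (simp add: fibre_energy_def e_def D_def algebra_simps)
  have Dpos: "0 < D t" if "0 < t" for t
  proof -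
    have "0 < t powr (1 - p) * A / (1 - p)" "0 \<le> t powr (1 - q) * B / (1 - q)" using that ABC p1 q1 by auto
    then show ?thesis unfolding D_def by linarith
  qed
  \<comment> \<open>Where \<open>e\<close> exceeds half of \<open>lam * D\<close>, the parameter is
    bounded below, because the part of \<open>D\<close> with \<open>A\<close> has order
    \<open>1 - p < 2\<close>, and above, because \<open>e > 0\<close> bounds
    \<open>t powr (r - 2)\<close>. \<open>T0\<close> and \<open>T1\<close> are the solutions of the
    two resulting equalities.\<close>
  define T0 where "T0 = (lam * A / (1 - p) / n) powr (1 / (1 + p))"
  define T1 where "T1 = (r * n / (2 * \<theta> * C)) powr (1 / (r - 2))"
  have T0: "T0 > 0" using lam_pos ABC n p1 by (simp add: T0_def)
  have loc: "T0 \<le> t \<and> t \<le> T1" if t: "0 < t" "e t > lam / 2 * D t" for t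
  proof
    have "t powr (1 - p) * A / (1 - p) \<le> D t" using ABC q1 by (simp add: D_def)
    then have "lam / 2 * (t powr (1 - p) * A / (1 - p)) \<le> lam / 2 * D t"
      using lam_pos by (intro mult_left_mono) auto
    moreover have "0 \<le> \<theta> / r * (t powr r * C)" using \<theta>_pos r2 ABC by simp
    ultimately have "lam / 2 * (t powr (1 - p) * A / (1 - p)) \<le> t\<^sup>2 * n / 2"
      using t(2) unfolding e_def by linarith
    then have 1: "lam * A / (1 - p) / n * t powr (1 - p) \<le> t\<^sup>2"
      using n p1 by (simp add: field_simps)
    have "t\<^sup>2 = t powr (1 + p) * t powr (1 - p)" using t by (simp add: powr_add[symmetric] powr_numeral)
    with 1 have "lam * A / (1 - p) / n * t powr (1 - p) \<le> t powr (1 + p) * t powr (1 - p)" by simp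
    then have "lam * A / (1 - p) / n \<le> t powr (1 + p)"
      by (rule mult_right_le_imp_le) (use t in simp)
    then have "T0 \<le> (t powr (1 + p)) powr (1 / (1 + p))"
      unfolding T0_def using lam_pos ABC n p1 p_pos by (intro powr_mono2) auto
    then show "T0 \<le> t" using t p_pos by (simp add: powr_powr)
    have "0 < lam / 2 * D t" using Dpos[OF t(1)] lam_pos by simp
    then have "\<theta> / r * (t powr r * C) < t\<^sup>2 * n / 2" using t(2) unfolding e_def by linarith
    moreover have "t powr r = t powr (r - 2) * t\<^sup>2" using t by (simp add: powr_diff powr_numeral)
    ultimately have "(\<theta> / r * C * t powr (r - 2)) * t\<^sup>2 < (n / 2) * t\<^sup>2" by (simp add: algebra_simps)
    then have "\<theta> / r * C * t powr (r - 2) < n / 2"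
      by (rule mult_right_less_imp_less) simp
    then have "t powr (r - 2) \<le> r * n / (2 * \<theta> * C)" using \<theta>_pos ABC r2 by (simp add: field_simps)
    then have "(t powr (r - 2)) powr (1 / (r - 2)) \<le> T1"
      unfolding T1_def using r2 by (intro powr_mono2) auto
    then show "t \<le> T1" using t r2 by (simp add: powr_powr)
  qed
  define R where "R t = e t / D t" for t
  have apR: "\<exists>t>0. R t > lam - \<epsilon>" if \<epsilon>: "\<epsilon> > 0" for \<epsilon>
  proof -
    obtain t where t: "t > 0" "fibre_energy n A B C t + \<epsilon> * D t > 0" using approx[OF \<epsilon>] by blast
    then have "(lam - \<epsilon>) * D t < e t" unfolding fibre_energy by (simp add: algebra_simps)
    then show ?thesis using t(1) Dpos[OF t(1)] by (intro exI[of _ t]) (simp add: R_def field_simps)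
  qed
  have locR: "T0 \<le> t \<and> t \<le> T1" if "0 < t" "R t > lam / 2" for t
    using loc[of t] that Dpos[of t] by (simp add: R_def field_simps)
  have "continuous_on {T0..T1} R"
    unfolding R_def e_def D_def
  proof (intro continuous_intros ballI)
    fix t assume "t \<in> {T0..T1}"
    then show "t powr (1 - p) * A / (1 - p) + t powr (1 - q) * B / (1 - q) \<noteq> 0"
      using Dpos[of t] T0 by (auto simp: D_def)
  qed (use T0 p1 q1 in auto)
  moreover have "{T0..T1} \<noteq> {}"
  proof -
    obtain t where "t > 0" "R t > lam - lam / 2" using apR[of "lam / 2"] lam_pos by auto
    then show ?thesis using locR[of t] by auto
  qed
  ultimately obtain t where t: "T0 \<le> t" "t \<le> T1" "\<And>x. T0 \<le> x \<Longrightarrow> x \<le> T1 \<Longrightarrow> R x \<le> R t"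
    using continuous_attains_sup[of "{T0..T1}" R] by auto
  have t0: "0 < t" using t T0 by simp
  have "lam \<le> R t"
  proof (rule ccontr)
    assume "\<not> ?thesis"
    then have "min (lam - R t) (lam / 2) > 0" using lam_pos by simp
    from apR[OF this] obtain x where x: "x > 0" "R x > lam - min (lam - R t) (lam / 2)" by blast
    then have "R x > lam / 2" "R x > R t" by auto
    with locR[OF x(1)] t(3)[of x] show False by auto
  qed
  then have "0 \<le> fibre_energy n A B C t" using Dpos[OF t0] by (simp add: fibre_energy R_def field_simps)
  then show ?thesis
    using fibre_energy_le_one_if_nonneg[of A B C n t] ABC h1 d n t0 by simp
qed

end

section \<open>Minimization on the Nehari set\<close>

definition singular_integral :: "('n::finite) fn \<Rightarrow> real \<Rightarrow> 'n fn \<Rightarrow> real" where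
  "singular_integral a p u = (LBINT x. a x * \<bar>u x\<bar> powr (1 - p))"

definition coupling_integral :: "real \<Rightarrow> real \<Rightarrow> ('n::finite) fn \<Rightarrow> 'n fn \<Rightarrow> real" where
  "coupling_integral \<alpha> \<beta> u v = (LBINT x. \<bar>u x\<bar> powr \<alpha> * \<bar>v x\<bar> powr \<beta>)"

text \<open>Young's inequality with the conjugate exponents \<open>2 / (1 + p)\<close> and
  \<open>2 / (1 - p)\<close>; the first is the integrability assumed of the weight. A small
  \<open>d\<close> later lets the norm absorb the quadratic part.\<close>

lemma sublinear_young:
  fixes x y p d :: real
  assumes x: "0 \<le> x" and y: "0 \<le> y" and p: "0 < p" "p < 1" and d: "0 < d"
  shows "x * y powr (1 - p) \<le> d powr (- ((1 - p) / (1 + p))) * x powr (2 / (1 + p)) + d * y\<^sup>2"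
proof (cases "x = 0 \<or> y = 0")
  case True
  then show ?thesis using d p by auto
next
  case False
  then have xy: "0 < x" "0 < y" using x y by auto
  have y2: "y\<^sup>2 = y powr (1 + p) * y powr (1 - p)" using xy by (simp add: powr_add[symmetric] powr_numeral)
  show ?thesis
  proof (cases "x \<le> d * y powr (1 + p)")
    case True
    then have "x * y powr (1 - p) \<le> d * y powr (1 + p) * y powr (1 - p)" by (intro mult_right_mono) auto
    also have "\<dots> = d * y\<^sup>2" by (simp add: y2)
    finally show ?thesis by (smt (verit) mult_nonneg_nonneg powr_ge_zero)
  next
    case False
    have "y powr (1 - p) = (y powr (1 + p)) powr ((1 - p) / (1 + p))" using p by (simp add: powr_powr)
    also have "\<dots> \<le> (x / d) powr ((1 - p) / (1 + p))"
      using False d p xy by (intro powr_mono2) (auto simp: field_simps)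
    finally have "x * y powr (1 - p) \<le> x * (x / d) powr ((1 - p) / (1 + p))" using x by (rule mult_left_mono)
    also have "\<dots> = d powr (- ((1 - p) / (1 + p))) * (x powr 1 * x powr ((1 - p) / (1 + p)))"
    proof -
      have "(x / d) powr k = d powr (- k) * x powr k" for k
        using xy d by (simp add: powr_divide powr_minus field_simps)
      then show ?thesis using xy by simp
    qed
    also have "x powr 1 * x powr ((1 - p) / (1 + p)) = x powr (2 / (1 + p))"
    proof -
      have "1 + (1 - p) / (1 + p) = 2 / (1 + p)" using p by (simp add: field_simps)
      then show ?thesis by (simp only: powr_add[symmetric])
    qed
    finally show ?thesis using d by (smt (verit) mult_nonneg_nonneg zero_le_power2)
  qed
qed

lemma
  fixes a u :: "('n::finite) fn"
  assumes [measurable]: "a \<in> borel_measurable borel" "u \<in> borel_measurable borel"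
    and a: "\<And>x. 0 \<le> a x" "integrable lborel (\<lambda>x. a x powr (2 / (1 + p)))"
    and u: "integrable lborel (\<lambda>x. (u x)\<^sup>2)" and p: "0 < p" "p < 1"
  shows singular_integral_integrable: "integrable lborel (\<lambda>x. a x * \<bar>u x\<bar> powr (1 - p))"
    and singular_integral_le: "0 < d \<Longrightarrow> singular_integral a p u \<le> d powr (- ((1 - p) / (1 + p))) * (LBINT x. a x powr (2 / (1 + p))) + d * (LBINT x. (u x)\<^sup>2)"
proof -
  show i: "integrable lborel (\<lambda>x. a x * \<bar>u x\<bar> powr (1 - p))"
  proof (rule Bochner_Integration.integrable_bound)
    show "integrable lborel (\<lambda>x. a x powr (2 / (1 + p)) + (u x)\<^sup>2)" using a u by simp
    show "AE x in lborel. norm (a x * \<bar>u x\<bar> powr (1 - p)) \<le> norm (a x powr (2 / (1 + p)) + (u x)\<^sup>2)"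
      using sublinear_young[OF a(1) abs_ge_zero p, of 1] a(1) by (intro AE_I2) (simp add: abs_mult)
  qed measurable
  assume d: "0 < d"
  have "singular_integral a p u \<le> (LBINT x. d powr (- ((1 - p) / (1 + p))) * a x powr (2 / (1 + p)) + d * (u x)\<^sup>2)"
    unfolding singular_integral_def using a u i sublinear_young[OF a(1) abs_ge_zero p d]
    by (intro integral_mono) auto
  then show "singular_integral a p u \<le> d powr (- ((1 - p) / (1 + p))) * (LBINT x. a x powr (2 / (1 + p))) + d * (LBINT x. (u x)\<^sup>2)"
    using a u by simp
qed

lemma singular_integral_scale: "0 < t \<Longrightarrow> singular_integral a p (\<lambda>x. t * u x) = t powr (1 - p) * singular_integral a p u"
  unfolding singular_integral_def
  by (subst integral_mult_right_zero[symmetric], rule Bochner_Integration.integral_cong)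
    (auto simp: abs_mult powr_mult)

lemma singular_integral_nonneg: "(\<And>x. 0 \<le> a x) \<Longrightarrow> 0 \<le> singular_integral a p u"
  unfolding singular_integral_def by (intro Bochner_Integration.integral_nonneg) auto

lemma singular_integral_abs [simp]: "singular_integral a p (\<lambda>x. \<bar>u x\<bar>) = singular_integral a p u"
  by (simp add: singular_integral_def)

lemma singular_integral_tendsto:
  fixes a u h :: "('n::finite) fn"
  assumes [measurable]: "a \<in> borel_measurable borel" "u \<in> borel_measurable borel" "h \<in> borel_measurable borel" "\<And>k. U k \<in> borel_measurable borel"
    and a: "\<And>x. 0 \<le> a x" "integrable lborel (\<lambda>x. a x powr (2 / (1 + p)))"
    and h: "integrable lborel (\<lambda>x. (h x)\<^sup>2)" "\<And>x. 0 \<le> h x" and p: "0 < p" "p < 1"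
    and dom: "\<And>k. AE x in lborel. \<bar>U k x\<bar> \<le> h x" and lim: "AE x in lborel. (\<lambda>k. U k x) \<longlonglongrightarrow> u x"
  shows "(\<lambda>k. singular_integral a p (U k)) \<longlonglongrightarrow> singular_integral a p u"
  unfolding singular_integral_def
proof (rule integral_dominated_convergence[where w = "\<lambda>x. a x * \<bar>h x\<bar> powr (1 - p)"])
  show "integrable lborel (\<lambda>x. a x * \<bar>h x\<bar> powr (1 - p))"
    by (rule singular_integral_integrable) (use a h p in auto)
  show "AE x in lborel. (\<lambda>k. a x * \<bar>U k x\<bar> powr (1 - p)) \<longlonglongrightarrow> a x * \<bar>u x\<bar> powr (1 - p)"
    using lim
  proof eventually_elim
    case (elim x)
    then show ?case using p by (intro tendsto_mult tendsto_const tendsto_powr2 tendsto_rabs) auto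
  qed
  show "AE x in lborel. norm (a x * \<bar>U k x\<bar> powr (1 - p)) \<le> a x * \<bar>h x\<bar> powr (1 - p)" for k
    using dom[of k]
  proof eventually_elim
    case (elim x)
    have "\<bar>U k x\<bar> powr (1 - p) \<le> \<bar>h x\<bar> powr (1 - p)" using elim p by (intro powr_mono2) auto
    then show ?case using a(1)[of x] by (simp add: abs_mult mult_left_mono)
  qed
qed measurable

lemma powr_mult_powr_le:
  fixes x y :: real
  assumes "0 \<le> x" "0 \<le> y" "0 < \<alpha>" "0 < \<beta>"
  shows "x powr \<alpha> * y powr \<beta> \<le> x powr (\<alpha> + \<beta>) + y powr (\<alpha> + \<beta>)"
proof -
  have "x powr \<alpha> * y powr \<beta> \<le> max x y powr \<alpha> * max x y powr \<beta>"
    using assms by (intro mult_mono powr_mono2) auto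
  also have "\<dots> = max x y powr (\<alpha> + \<beta>)" by (simp add: powr_add)
  also have "\<dots> \<le> x powr (\<alpha> + \<beta>) + y powr (\<alpha> + \<beta>)" by (auto simp: max_def)
  finally show ?thesis .
qed

lemma coupling_integral_integrable:
  fixes u v :: "('n::finite) fn"
  assumes [measurable]: "u \<in> borel_measurable borel" "v \<in> borel_measurable borel"
    and "0 < \<alpha>" "0 < \<beta>"
    and i: "integrable lborel (\<lambda>x. \<bar>u x\<bar> powr (\<alpha> + \<beta>))" "integrable lborel (\<lambda>x. \<bar>v x\<bar> powr (\<alpha> + \<beta>))"
  shows "integrable lborel (\<lambda>x. \<bar>u x\<bar> powr \<alpha> * \<bar>v x\<bar> powr \<beta>)"
proof (rule Bochner_Integration.integrable_bound)
  show "integrable lborel (\<lambda>x. \<bar>u x\<bar> powr (\<alpha> + \<beta>) + \<bar>v x\<bar> powr (\<alpha> + \<beta>))" using i by simp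
  show "AE x in lborel. norm (\<bar>u x\<bar> powr \<alpha> * \<bar>v x\<bar> powr \<beta>) \<le> norm (\<bar>u x\<bar> powr (\<alpha> + \<beta>) + \<bar>v x\<bar> powr (\<alpha> + \<beta>))"
    using powr_mult_powr_le[OF abs_ge_zero abs_ge_zero \<open>0 < \<alpha>\<close> \<open>0 < \<beta>\<close>] by (intro AE_I2) simp
qed measurable

lemma coupling_integral_scale: "0 < t \<Longrightarrow> coupling_integral \<alpha> \<beta> (\<lambda>x. t * u x) (\<lambda>x. t * v x) = t powr (\<alpha> + \<beta>) * coupling_integral \<alpha> \<beta> u v"
  unfolding coupling_integral_def by (simp add: abs_mult powr_mult powr_add mult_ac flip: integral_mult_right_zero)

lemma coupling_integral_nonneg: "0 \<le> coupling_integral \<alpha> \<beta> u v"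
  unfolding coupling_integral_def by (intro Bochner_Integration.integral_nonneg) auto

lemma coupling_integral_abs [simp]: "coupling_integral \<alpha> \<beta> (\<lambda>x. \<bar>u x\<bar>) (\<lambda>x. \<bar>v x\<bar>) = coupling_integral \<alpha> \<beta> u v"
  by (simp add: coupling_integral_def)

lemma coupling_integral_tendsto:
  fixes u v g h :: "('n::finite) fn"
  assumes [measurable]: "u \<in> borel_measurable borel" "v \<in> borel_measurable borel" "\<And>k. U k \<in> borel_measurable borel" "\<And>k. W k \<in> borel_measurable borel"
    and ab: "0 < \<alpha>" "0 < \<beta>"
    and gh: "integrable lborel (\<lambda>x. g x powr (\<alpha> + \<beta>))" "integrable lborel (\<lambda>x. h x powr (\<alpha> + \<beta>))"
    and dom: "\<And>k. AE x in lborel. \<bar>U k x\<bar> \<le> g x" "\<And>k. AE x in lborel. \<bar>W k x\<bar> \<le> h x"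
    and lim: "AE x in lborel. (\<lambda>k. U k x) \<longlonglongrightarrow> u x" "AE x in lborel. (\<lambda>k. W k x) \<longlonglongrightarrow> v x"
  shows "(\<lambda>k. coupling_integral \<alpha> \<beta> (U k) (W k)) \<longlonglongrightarrow> coupling_integral \<alpha> \<beta> u v"
  unfolding coupling_integral_def
proof (rule integral_dominated_convergence[where w = "\<lambda>x. g x powr (\<alpha> + \<beta>) + h x powr (\<alpha> + \<beta>)"])
  show "integrable lborel (\<lambda>x. g x powr (\<alpha> + \<beta>) + h x powr (\<alpha> + \<beta>))" using gh by simp
  show "AE x in lborel. (\<lambda>k. \<bar>U k x\<bar> powr \<alpha> * \<bar>W k x\<bar> powr \<beta>) \<longlonglongrightarrow> \<bar>u x\<bar> powr \<alpha> * \<bar>v x\<bar> powr \<beta>"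
    using lim
  proof eventually_elim
    case (elim x)
    then show ?case using ab by (intro tendsto_mult tendsto_const tendsto_powr2 tendsto_rabs) auto
  qed
  show "AE x in lborel. norm (\<bar>U k x\<bar> powr \<alpha> * \<bar>W k x\<bar> powr \<beta>) \<le> g x powr (\<alpha> + \<beta>) + h x powr (\<alpha> + \<beta>)" for k
    using dom(1)[of k] dom(2)[of k]
  proof eventually_elim
    case (elim x)
    have "\<bar>U k x\<bar> powr \<alpha> * \<bar>W k x\<bar> powr \<beta> \<le> \<bar>U k x\<bar> powr (\<alpha> + \<beta>) + \<bar>W k x\<bar> powr (\<alpha> + \<beta>)"
      using ab by (intro powr_mult_powr_le) auto
    also have "\<dots> \<le> g x powr (\<alpha> + \<beta>) + h x powr (\<alpha> + \<beta>)"
      using elim ab by (intro add_mono powr_mono2) auto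
    finally show ?case by simp
  qed
qed measurable

text \<open>The system for Borel data. The upper bound on \<open>lam\<close> enters only as
  \<open>extremal\<close>: every fibre with positive coupling rises somewhere.\<close>

locale singular_system = fibering lam \<theta> p q "\<alpha> + \<beta>" + F1: coercive_potential s V0 V1 + F2: coercive_potential s V0 V2
  for lam \<theta> p q \<alpha> \<beta> s V0 :: real and V1 V2 :: "('n::finite) fn" +
  fixes a b :: "'n fn"
  assumes \<alpha>1: "1 < \<alpha>" and \<beta>1: "1 < \<beta>" and s1: "s < 1"
    and dim: "2 * s < real CARD('n)"
    and subcritical: "\<alpha> + \<beta> < 2 * real CARD('n) / (real CARD('n) - 2 * s)"
    and a_borel [measurable]: "a \<in> borel_measurable borel" and a_pos: "\<And>x. 0 < a x"
    and a_int: "integrable lborel (\<lambda>x. a x powr (2 / (1 + p)))"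
    and b_borel [measurable]: "b \<in> borel_measurable borel" and b_pos: "\<And>x. 0 < b x"
    and b_int: "integrable lborel (\<lambda>x. b x powr (2 / (1 + q)))"
    and V1_cont: "continuous_on UNIV V1" and V2_cont: "continuous_on UNIV V2"
    and extremal: "\<And>u v. u \<in> borel_potential s V1 \<Longrightarrow> v \<in> borel_potential s V2 \<Longrightarrow> 0 < coupling_integral \<alpha> \<beta> u v \<Longrightarrow>
      \<exists>t>0. 0 < fibre_slope (sobolev_form s V1 u u + sobolev_form s V2 v v) (singular_integral a p u) (singular_integral b q v) (coupling_integral \<alpha> \<beta> u v) t"
begin

abbreviation "X1 \<equiv> borel_potential s V1"
abbreviation "X2 \<equiv> borel_potential s V2"
definition "norm_square u v = sobolev_form s V1 u u + sobolev_form s V2 v v"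
abbreviation "A \<equiv> singular_integral a p"
abbreviation "B \<equiv> singular_integral b q"
abbreviation "C \<equiv> coupling_integral \<alpha> \<beta>"
abbreviation "energy_along u v \<equiv> fibre_energy (norm_square u v) (A u) (B v) (C u v)"
abbreviation "slope_along u v \<equiv> fibre_slope (norm_square u v) (A u) (B v) (C u v)"
definition "J u v = energy_along u v 1"
text \<open>\<open>nehari_minus\<close> for Borel pairs, read off the fibre at the parameter 1. Such
  a pair is automatically nonzero, because the strict inequality forces
  \<open>C u v > 0\<close>.\<close>

definition "minus_pair u v \<longleftrightarrow> u \<in> X1 \<and> v \<in> X2 \<and> slope_along u v 1 = 0 \<and> fibre_slope_deriv (A u) (B v) (C u v) < 0"

lemma p1: "p < 1" and q0: "0 < q" using pq q1 p_pos by auto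

lemma A_nonneg [simp]: "0 \<le> A u" and B_nonneg [simp]: "0 \<le> B u"
  using a_pos b_pos by (simp_all add: singular_integral_nonneg less_imp_le)

lemma C_nonneg [simp]: "0 \<le> C u v"
  by (rule coupling_integral_nonneg)

lemma A_integrable: "u \<in> X1 \<Longrightarrow> integrable lborel (\<lambda>x. a x * \<bar>u x\<bar> powr (1 - p))"
  using F1.borel_potentialD a_int a_pos p_pos p1 by (intro singular_integral_integrable) (auto intro: less_imp_le)

lemma Lr1: "u \<in> X1 \<Longrightarrow> integrable lborel (\<lambda>x. \<bar>u x\<bar> powr (\<alpha> + \<beta>))"
  using F1.borel_potential_Lr_integrable[OF dim _ subcritical] r2 by auto

lemma Lr2: "u \<in> X2 \<Longrightarrow> integrable lborel (\<lambda>x. \<bar>u x\<bar> powr (\<alpha> + \<beta>))"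
  using F2.borel_potential_Lr_integrable[OF dim _ subcritical] r2 by auto

lemma C_integrable: "u \<in> X1 \<Longrightarrow> v \<in> X2 \<Longrightarrow> integrable lborel (\<lambda>x. \<bar>u x\<bar> powr \<alpha> * \<bar>v x\<bar> powr \<beta>)"
  using F1.borel_potentialD F2.borel_potentialD Lr1 Lr2 \<alpha>1 \<beta>1 by (intro coupling_integral_integrable) auto

lemma norm_square_scale: "u \<in> X1 \<Longrightarrow> v \<in> X2 \<Longrightarrow> norm_square (\<lambda>x. t * u x) (\<lambda>x. t * v x) = t\<^sup>2 * norm_square u v"
  by (simp add: norm_square_def F1.sobolev_form_scale_scale F2.sobolev_form_scale_scale distrib_left)

lemma J_scale:
  assumes "u \<in> X1" "v \<in> X2" "0 < t"
  shows "J (\<lambda>x. t * u x) (\<lambda>x. t * v x) = energy_along u v t"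
  using fibre_energy_scale[of t 1] assms by (simp add: J_def norm_square_scale singular_integral_scale coupling_integral_scale)

lemma minus_pair_scale:
  assumes "u \<in> X1" "v \<in> X2" "0 < t"
  shows "minus_pair (\<lambda>x. t * u x) (\<lambda>x. t * v x) \<longleftrightarrow> slope_along u v t = 0 \<and> scaled_fibre_slope_deriv (A u) (B v) (C u v) t < 0"
  using fibre_slope_scale[of t 1] assms F1.borel_potential_scale F2.borel_potential_scale
  by (simp add: minus_pair_def norm_square_scale singular_integral_scale coupling_integral_scale scaled_fibre_slope_deriv_def)

lemma A_pos:
  assumes u: "u \<in> X1" and v: "v \<in> X2" and C: "0 < C u v"
  shows "0 < A u"
proof (rule ccontr)
  assume "\<not> ?thesis"
  then have "A u = 0" using A_nonneg[of u] by linarith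
  then have "AE x in lborel. a x * \<bar>u x\<bar> powr (1 - p) = 0"
    unfolding singular_integral_def using A_integrable[OF u] a_pos
    by (subst (asm) integral_nonneg_eq_0_iff_AE) (auto simp: less_imp_le)
  then have "AE x in lborel. \<bar>u x\<bar> powr \<alpha> * \<bar>v x\<bar> powr \<beta> = 0"
  proof eventually_elim
    case (elim x)
    then show ?case using a_pos[of x] by auto
  qed
  then have "C u v = 0" unfolding coupling_integral_def by (rule integral_eq_zero_AE)
  then show False using C by simp
qed

text \<open>The strict inequality puts a nonnegative combination of the singular integrals below a
  positive multiple of \<open>C u v\<close>, which makes the coupling positive; the Nehari identity
  then makes the norm positive.\<close>

lemma minus_pairD:
  assumes "minus_pair u v"
  shows "u \<in> X1" "v \<in> X2" "norm_square u v = lam * A u + lam * B v + \<theta> * C u v"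
    "lam * (1 + p) * A u + lam * (1 + q) * B v < \<theta> * (\<alpha> + \<beta> - 2) * C u v" "0 < C u v" "0 < norm_square u v"
proof -
  show 1: "u \<in> X1" "v \<in> X2" "norm_square u v = lam * A u + lam * B v + \<theta> * C u v"
    and 2: "lam * (1 + p) * A u + lam * (1 + q) * B v < \<theta> * (\<alpha> + \<beta> - 2) * C u v"
    using assms by (auto simp: minus_pair_def fibre_slope_def fibre_slope_deriv_def)
  have "0 \<le> lam * (1 + p) * A u" "0 \<le> lam * (1 + q) * B v"
    using lam_pos p_pos q0 by auto
  then have "0 < \<theta> * (\<alpha> + \<beta> - 2) * C u v" using 2 by linarith
  then show 3: "0 < C u v" using \<theta>_pos r2 C_nonneg[of u v] by (simp add: zero_less_mult_iff)
  have "0 \<le> lam * A u" "0 \<le> lam * B v" "0 < \<theta> * C u v" using lam_pos \<theta>_pos 3 by auto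
  then show "0 < norm_square u v" using 1 by linarith
qed

lemma minus_pair_fibre_max:
  assumes "minus_pair u v" "0 < t" "0 \<le> slope_along u v t"
  shows "energy_along u v t \<le> J u v"
  unfolding J_def using assms by (intro fibre_max(2)) (auto simp: minus_pair_def)

text \<open>The Sobolev estimate holds on bounded sets only; scaling the pair to norm 1 and using
  homogeneity of both sides turns it into an inequality with the right power.\<close>

lemma C_le_powr_norm_square:
  obtains K where "K > 0" "\<And>u v. u \<in> X1 \<Longrightarrow> v \<in> X2 \<Longrightarrow> 0 < norm_square u v \<Longrightarrow> C u v \<le> K * norm_square u v powr ((\<alpha> + \<beta>) / 2)"
proof -
  have r: "2 \<le> \<alpha> + \<beta>" using r2 by simp
  obtain K1 where K1: "K1 > 0" "\<And>u. u \<in> X1 \<Longrightarrow> sobolev_form s V1 u u \<le> 1 \<Longrightarrow> (LBINT x. \<bar>u x\<bar> powr (\<alpha> + \<beta>)) \<le> K1"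
    using F1.borel_potential_Lr_bound[OF dim r subcritical, of 1] by metis
  obtain K2 where K2: "K2 > 0" "\<And>u. u \<in> X2 \<Longrightarrow> sobolev_form s V2 u u \<le> 1 \<Longrightarrow> (LBINT x. \<bar>u x\<bar> powr (\<alpha> + \<beta>)) \<le> K2"
    using F2.borel_potential_Lr_bound[OF dim r subcritical, of 1] by metis
  show ?thesis
  proof (rule that[of "K1 + K2"])
    fix u v assume u: "u \<in> X1" and v: "v \<in> X2" and n: "0 < norm_square u v"
    define t where "t = norm_square u v powr (- (1 / 2))"
    have t: "0 < t" using n by (simp add: t_def)
    let ?u = "\<lambda>x. t * u x" and ?v = "\<lambda>x. t * v x"
    have uv: "?u \<in> X1" "?v \<in> X2" using u v F1.borel_potential_scale F2.borel_potential_scale by auto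
    have "norm_square ?u ?v = 1"
    proof -
      have "t\<^sup>2 = norm_square u v powr (- 1)" using n t by (simp add: t_def powr_powr flip: powr_numeral)
      then show ?thesis using n by (simp add: norm_square_scale[OF u v] powr_minus)
    qed
    then have h1: "sobolev_form s V1 ?u ?u \<le> 1" "sobolev_form s V2 ?v ?v \<le> 1"
      using F1.sobolev_form_self_ge(4)[OF uv(1)] F2.sobolev_form_self_ge(4)[OF uv(2)] by (auto simp: norm_square_def)
    have "C ?u ?v \<le> (LBINT x. \<bar>?u x\<bar> powr (\<alpha> + \<beta>) + \<bar>?v x\<bar> powr (\<alpha> + \<beta>))"
      unfolding coupling_integral_def
    proof (rule integral_mono)
      show "integrable lborel (\<lambda>x. \<bar>?u x\<bar> powr \<alpha> * \<bar>?v x\<bar> powr \<beta>)" by (rule C_integrable[OF uv])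
      show "integrable lborel (\<lambda>x. \<bar>?u x\<bar> powr (\<alpha> + \<beta>) + \<bar>?v x\<bar> powr (\<alpha> + \<beta>))"
        using Lr1[OF uv(1)] Lr2[OF uv(2)] by simp
    qed (use \<alpha>1 \<beta>1 in \<open>auto intro: powr_mult_powr_le\<close>)
    also have "\<dots> = (LBINT x. \<bar>?u x\<bar> powr (\<alpha> + \<beta>)) + (LBINT x. \<bar>?v x\<bar> powr (\<alpha> + \<beta>))"
      using Lr1[OF uv(1)] Lr2[OF uv(2)] by simp
    also have "\<dots> \<le> K1 + K2" using K1(2)[OF uv(1) h1(1)] K2(2)[OF uv(2) h1(2)] by simp
    finally have "t powr (\<alpha> + \<beta>) * C u v \<le> K1 + K2" by (simp add: coupling_integral_scale[OF t])
    then have "t powr (- (\<alpha> + \<beta>)) * (t powr (\<alpha> + \<beta>) * C u v) \<le> t powr (- (\<alpha> + \<beta>)) * (K1 + K2)"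
      by (rule mult_left_mono) simp
    moreover have "t powr (- (\<alpha> + \<beta>)) * (t powr (\<alpha> + \<beta>) * C u v) = C u v"
    proof -
      have "t powr (- (\<alpha> + \<beta>)) * t powr (\<alpha> + \<beta>) = 1" using t by (simp flip: powr_add)
      then show ?thesis unfolding mult.assoc[symmetric] by (simp only: mult_1)
    qed
    moreover have "t powr (- (\<alpha> + \<beta>)) = norm_square u v powr ((\<alpha> + \<beta>) / 2)"
    proof -
      have "- (1 / 2) * - (\<alpha> + \<beta>) = (\<alpha> + \<beta>) / 2" by (simp add: field_simps)
      then show ?thesis unfolding t_def powr_powr by (simp only:)
    qed
    ultimately show "C u v \<le> (K1 + K2) * norm_square u v powr ((\<alpha> + \<beta>) / 2)" by (simp only: mult.commute[of "K1 + K2"])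
  qed (use K1 K2 in simp)
qed

text \<open>On \<open>minus_pair\<close> the squared norm is at most a multiple of \<open>C\<close>,
  while \<open>C\<close> is at most a multiple of the squared norm to the power
  \<open>r / 2 > 1\<close>. Two such bounds keep \<open>C\<close> away from 0.\<close>

lemma minus_pair_C_lower_bound:
  obtains c where "c > 0" "\<And>u v. minus_pair u v \<Longrightarrow> c \<le> C u v"
proof -
  define r where "r = \<alpha> + \<beta>"
  have r: "2 < r" using r2 by (simp add: r_def)
  obtain K where K: "K > 0" "\<And>u v. u \<in> X1 \<Longrightarrow> v \<in> X2 \<Longrightarrow> 0 < norm_square u v \<Longrightarrow> C u v \<le> K * norm_square u v powr (r / 2)"
    using C_le_powr_norm_square unfolding r_def by metis
  \<comment> \<open>Multiply the Nehari identity by \<open>1 + p\<close>, enlarge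
    \<open>1 + p\<close> to \<open>1 + q\<close> in front of \<open>B\<close>, and insert the strict
    inequality: \<open>(1 + p) * norm_square u v\<close> is at most
    \<open>\<theta> * (r - 2) * C u v + (1 + p) * \<theta> * C u v\<close>.\<close>
  define k where "k = \<theta> * (r - 1 + p) / (1 + p)"
  have k: "k > 0" using \<theta>_pos p_pos r by (simp add: k_def)
  define e where "e = r / 2 - 1"
  have e: "e > 0" using r by (simp add: e_def)
  define L where "L = K * k powr (r / 2)"
  have L: "L > 0" using K k by (simp add: L_def)
  show ?thesis
  proof (rule that[of "(1 / L) powr (1 / e)"])
    fix u v assume N: "minus_pair u v"
    note D = minus_pairD[OF N]
    have "lam * (1 + p) * B v \<le> lam * (1 + q) * B v"
      using lam_pos pq by (intro mult_right_mono mult_left_mono) auto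
    then have "(1 + p) * norm_square u v \<le> \<theta> * (r - 1 + p) * C u v"
      using D(3,4) by (simp add: r_def algebra_simps)
    then have "norm_square u v \<le> k * C u v" using p_pos by (simp add: k_def field_simps)
    then have "norm_square u v powr (r / 2) \<le> (k * C u v) powr (r / 2)" using D(6) r by (intro powr_mono2) auto
    then have "K * norm_square u v powr (r / 2) \<le> K * (k * C u v) powr (r / 2)" using K(1) by (intro mult_left_mono) auto
    then have "C u v \<le> K * (k * C u v) powr (r / 2)" using K(2)[OF D(1,2,6)] by linarith
    also have "\<dots> = L * C u v powr (e + 1)" using k D(5) by (simp add: L_def e_def powr_mult)
    also have "\<dots> = L * C u v powr e * C u v" using D(5) by (simp add: powr_add)
    finally have "1 * C u v \<le> (L * C u v powr e) * C u v" by simp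
    then have "1 \<le> L * C u v powr e" using D(5) by (rule mult_right_le_imp_le)
    then have "1 / L \<le> C u v powr e" using L by (simp add: field_simps)
    then have "(1 / L) powr (1 / e) \<le> (C u v powr e) powr (1 / e)" using L e by (intro powr_mono2) auto
    then show "(1 / L) powr (1 / e) \<le> C u v" using e D(5) by (simp add: powr_powr)
  qed (use L in simp)
qed

lemma singular_integral_small:
  assumes "0 < e"
  obtains K where "0 \<le> K" "\<And>u v. u \<in> X1 \<Longrightarrow> v \<in> X2 \<Longrightarrow> A u / (1 - p) + B v / (1 - q) \<le> K + e * norm_square u v"
proof -
  \<comment> \<open>\<open>V0\<close> converts the mean square into the form and
    \<open>1 - q\<close> cancels the denominator of \<open>B\<close>; since
    \<open>p \<le> q\<close>, the same \<open>d\<close> serves the denominator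
    \<open>1 - p\<close>.\<close>
  define d where "d = e * V0 * (1 - q)"
  have d: "d > 0" using assms F1.V0_pos q1 by (simp add: d_def)
  define Ka where "Ka = d powr (- ((1 - p) / (1 + p))) * (LBINT x. a x powr (2 / (1 + p)))"
  define Kb where "Kb = d powr (- ((1 - q) / (1 + q))) * (LBINT x. b x powr (2 / (1 + q)))"
  have K0: "0 \<le> Ka" "0 \<le> Kb" unfolding Ka_def Kb_def by (auto intro!: mult_nonneg_nonneg Bochner_Integration.integral_nonneg)
  show ?thesis
  proof (rule that[of "Ka / (1 - p) + Kb / (1 - q)"])
    fix u v assume u: "u \<in> X1" and v: "v \<in> X2"
    have ed: "d / (1 - p) / V0 \<le> e" "d / (1 - q) / V0 = e"
    proof -
      show "d / (1 - q) / V0 = e" using q1 F1.V0_pos by (simp add: d_def)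
      have "(1 - q) / (1 - p) \<le> 1" using pq p1 by simp
      then have "e * ((1 - q) / (1 - p)) \<le> e * 1" using assms by (intro mult_left_mono) auto
      then show "d / (1 - p) / V0 \<le> e" using F1.V0_pos p1 by (simp add: d_def)
    qed
    have iu: "(LBINT x. (u x)\<^sup>2) \<le> sobolev_form s V1 u u / V0" using F1.sobolev_form_self_ge(1)[OF u] F1.V0_pos by (simp add: field_simps)
    have iv: "(LBINT x. (v x)\<^sup>2) \<le> sobolev_form s V2 v v / V0" using F2.sobolev_form_self_ge(1)[OF v] F1.V0_pos by (simp add: field_simps)
    have "A u \<le> Ka + d * (LBINT x. (u x)\<^sup>2)"
      unfolding Ka_def using F1.borel_potentialD[OF u] a_pos a_int p_pos p1 d by (intro singular_integral_le) (auto intro: less_imp_le)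
    also have "\<dots> \<le> Ka + d * (sobolev_form s V1 u u / V0)" using iu d by (intro add_left_mono mult_left_mono) auto
    finally have "A u / (1 - p) \<le> (Ka + d * (sobolev_form s V1 u u / V0)) / (1 - p)" using p1 by (intro divide_right_mono) auto
    also have "\<dots> = Ka / (1 - p) + d / (1 - p) / V0 * sobolev_form s V1 u u" by (simp add: add_divide_distrib)
    also have "\<dots> \<le> Ka / (1 - p) + e * sobolev_form s V1 u u"
      using ed F1.sobolev_form_self_ge(4)[OF u] by (intro add_left_mono mult_right_mono) auto
    finally have 1: "A u / (1 - p) \<le> Ka / (1 - p) + e * sobolev_form s V1 u u" .
    have "B v \<le> Kb + d * (LBINT x. (v x)\<^sup>2)"
      unfolding Kb_def using F2.borel_potentialD[OF v] b_pos b_int q0 q1 d by (intro singular_integral_le) (auto intro: less_imp_le)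
    also have "\<dots> \<le> Kb + d * (sobolev_form s V2 v v / V0)" using iv d by (intro add_left_mono mult_left_mono) auto
    finally have "B v / (1 - q) \<le> (Kb + d * (sobolev_form s V2 v v / V0)) / (1 - q)" using q1 by (intro divide_right_mono) auto
    also have "\<dots> = Kb / (1 - q) + d / (1 - q) / V0 * sobolev_form s V2 v v" by (simp add: add_divide_distrib)
    finally have 2: "B v / (1 - q) \<le> Kb / (1 - q) + e * sobolev_form s V2 v v" unfolding ed(2) .
    show "A u / (1 - p) + B v / (1 - q) \<le> Ka / (1 - p) + Kb / (1 - q) + e * norm_square u v"
      using 1 2 by (simp add: norm_square_def distrib_left)
  qed (use K0 p1 q1 in simp)
qed

text \<open>Eliminating \<open>C\<close> by the Nehari identity leaves the positive multiple
  \<open>1 / 2 - 1 / (\<alpha> + \<beta>)\<close> of the squared norm. The singular terms are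
  sublinear and consume at most half of it, hence the final division by 2 in
  \<open>c\<close>.\<close>

lemma minus_pair_coercive:
  obtains c K where "0 < c" "0 \<le> K" "\<And>u v. minus_pair u v \<Longrightarrow> c * norm_square u v \<le> J u v + K"
proof -
  define c where "c = (1 / 2 - 1 / (\<alpha> + \<beta>)) / 2"
  have c: "c > 0" using r2 by (simp add: c_def field_simps)
  have "c / lam > 0" using c lam_pos by simp
  then obtain K where K: "0 \<le> K" "\<And>u v. u \<in> X1 \<Longrightarrow> v \<in> X2 \<Longrightarrow> A u / (1 - p) + B v / (1 - q) \<le> K + c / lam * norm_square u v"
    by (rule singular_integral_small) blast
  show ?thesis
  proof (rule that[OF c, of "lam * K"])
    fix u v assume N: "minus_pair u v"
    note D = minus_pairD[OF N]
    have "\<theta> * C u v = norm_square u v - lam * A u - lam * B v" using D(3) by simp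
    then have "\<theta> / (\<alpha> + \<beta>) * C u v = norm_square u v / (\<alpha> + \<beta>) - lam * A u / (\<alpha> + \<beta>) - lam * B v / (\<alpha> + \<beta>)"
      by (simp add: diff_divide_distrib[symmetric])
    then have "J u v = 2 * c * norm_square u v - lam * (A u / (1 - p) + B v / (1 - q)) + lam * A u / (\<alpha> + \<beta>) + lam * B v / (\<alpha> + \<beta>)"
    proof -
      assume 1: "\<theta> / (\<alpha> + \<beta>) * C u v = norm_square u v / (\<alpha> + \<beta>) - lam * A u / (\<alpha> + \<beta>) - lam * B v / (\<alpha> + \<beta>)"
      have "J u v = norm_square u v / 2 - lam / (1 - p) * A u - lam / (1 - q) * B v - \<theta> / (\<alpha> + \<beta>) * C u v"
        by (simp add: J_def fibre_energy_def)
      moreover have "2 * c * norm_square u v = norm_square u v / 2 - norm_square u v / (\<alpha> + \<beta>)" by (simp add: c_def left_diff_distrib)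
      moreover have "lam * (A u / (1 - p) + B v / (1 - q)) = lam / (1 - p) * A u + lam / (1 - q) * B v"
        by (simp add: distrib_left)
      ultimately show ?thesis using 1 by linarith
    qed
    moreover have "0 \<le> lam * A u / (\<alpha> + \<beta>)" "0 \<le> lam * B v / (\<alpha> + \<beta>)" using lam_pos r2 by auto
    moreover have "lam * (A u / (1 - p) + B v / (1 - q)) \<le> lam * (K + c / lam * norm_square u v)"
      using K(2)[OF D(1,2)] lam_pos by (intro mult_left_mono) auto
    moreover have "lam * (K + c / lam * norm_square u v) = lam * K + c * norm_square u v" using lam_pos by (simp add: distrib_left)
    ultimately show "c * norm_square u v \<le> J u v + lam * K" by linarith
  qed (use K lam_pos in simp)
qed

lemma project_to_minus_pair:
  assumes "u \<in> X1" "v \<in> X2" "0 < C u v"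
  obtains t where "0 < t" "minus_pair (\<lambda>x. t * u x) (\<lambda>x. t * v x)"
proof -
  obtain t0 where t0: "t0 > 0" "0 < slope_along u v t0"
    using extremal[OF assms] by (auto simp: norm_square_def)
  obtain t where t: "t0 < t" "slope_along u v t = 0" "scaled_fibre_slope_deriv (A u) (B v) (C u v) t < 0"
    using fibre_projection[OF A_nonneg B_nonneg assms(3) t0] by blast
  show ?thesis
    by (rule that[of t]) (use t t0 minus_pair_scale[OF assms(1,2), of t] in auto)
qed

lemma minus_pair_nonempty: "\<exists>u v. minus_pair u v"
proof -
  let ?t = "tent 1 :: 'n fn"
  have t1: "?t \<in> X1" and t2: "?t \<in> X2"
    using tent_borel_potential[OF F1.s_pos s1 _ V1_cont, of 1] tent_borel_potential[OF F1.s_pos s1 _ V2_cont, of 1] by auto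
  have "0 < C ?t ?t"
  proof (rule ccontr)
    assume "\<not> ?thesis"
    then have "C ?t ?t = 0" using C_nonneg[of ?t ?t] by linarith
    then have "AE x in lborel. \<bar>?t x\<bar> powr \<alpha> * \<bar>?t x\<bar> powr \<beta> = 0"
      unfolding coupling_integral_def using C_integrable[OF t1 t2] by (subst (asm) integral_nonneg_eq_0_iff_AE) auto
    then have "AE x in lborel. x \<notin> ball (0::real^'n) 1"
      by eventually_elim (auto simp: tent_def)
    then have "emeasure lborel (ball (0::real^'n) 1) = 0"
      by (subst (asm) AE_iff_measurable[OF _ refl]) (auto simp: ball_def dist_norm)
    then have "measure lborel (ball (0::real^'n) 1) = 0" by (simp add: measure_def)
    then show False using content_ball_pos[of 1 "0::real^'n"] by simp
  qed
  then show ?thesis using project_to_minus_pair[OF t1 t2] by blast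
qed

theorem minimizer_exists:
  obtains z w where "minus_pair z w" "\<And>x. 0 \<le> z x" "\<And>x. 0 \<le> w x" "\<And>u v. minus_pair u v \<Longrightarrow> J z w \<le> J u v"
proof -
  obtain c K where cK: "0 < c" "0 \<le> K" "\<And>u v. minus_pair u v \<Longrightarrow> c * norm_square u v \<le> J u v + K"
    by (rule minus_pair_coercive) blast
  define S where "S = {J u v |u v. minus_pair u v}"
  have S: "S \<noteq> {}" using minus_pair_nonempty by (auto simp: S_def)
  have "- K \<le> J u v" if "minus_pair u v" for u v
    using cK(3)[OF that] cK(1) minus_pairD(6)[OF that] mult_pos_pos[of c "norm_square u v"] by linarith
  then have bdd: "bdd_below S" by (auto simp: S_def intro!: bdd_belowI[of _ "- K"])
  define m where "m = Inf S"
  have m_le: "m \<le> J u v" if "minus_pair u v" for u v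
    unfolding m_def using that bdd by (intro cInf_lower) (auto simp: S_def)
  have "\<exists>u v. minus_pair u v \<and> J u v < m + 1 / real (Suc k)" for k
    using cInf_lessD[OF S, of "m + 1 / real (Suc k)"] by (auto simp: S_def m_def)
  then obtain u v where uv: "\<And>k. minus_pair (u k) (v k)" "\<And>k. J (u k) (v k) < m + 1 / real (Suc k)" by metis
  have Jle: "J (u k) (v k) < m + 1" for k
  proof -
    have "1 / real (Suc k) \<le> 1" by simp
    then show ?thesis using uv(2)[of k] by linarith
  qed
  have nb: "norm_square (u k) (v k) \<le> (m + 1 + K) / c" for k
    using cK(3)[OF uv(1), of k] Jle[of k] cK(1) by (simp add: field_simps)
  note D = minus_pairD[OF uv(1)]
  have hb: "sobolev_form s V1 (u k) (u k) \<le> (m + 1 + K) / c" "sobolev_form s V2 (v k) (v k) \<le> (m + 1 + K) / c" for k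
    using nb[of k] F1.sobolev_form_self_ge(4)[OF D(1)[of k]] F2.sobolev_form_self_ge(4)[OF D(2)[of k]] by (auto simp: norm_square_def)
  obtain \<sigma> :: "nat \<Rightarrow> nat" and u0 g and \<nu>1 :: real where s1: "strict_mono \<sigma>" "u0 \<in> X1"
    "(\<lambda>k. sobolev_form s V1 (u (\<sigma> k)) (u (\<sigma> k))) \<longlonglongrightarrow> \<nu>1" "sobolev_form s V1 u0 u0 \<le> \<nu>1"
    "g \<in> borel_measurable borel" "\<And>x. 0 \<le> g x" "integrable lborel (\<lambda>x. (g x)\<^sup>2)" "integrable lborel (\<lambda>x. g x powr (\<alpha> + \<beta>))"
    "\<And>k. AE x in lborel. \<bar>u (\<sigma> k) x\<bar> \<le> g x" "AE x in lborel. (\<lambda>k. u (\<sigma> k) x) \<longlonglongrightarrow> u0 x"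
    by (rule F1.bounded_compact[of "\<alpha> + \<beta>" u, OF dim r2 subcritical D(1) hb(1)]) blast
  obtain \<tau> :: "nat \<Rightarrow> nat" and v0 h and \<nu>2 :: real where s2: "strict_mono \<tau>" "v0 \<in> X2"
    "(\<lambda>k. sobolev_form s V2 (v (\<sigma> (\<tau> k))) (v (\<sigma> (\<tau> k)))) \<longlonglongrightarrow> \<nu>2" "sobolev_form s V2 v0 v0 \<le> \<nu>2"
    "h \<in> borel_measurable borel" "\<And>x. 0 \<le> h x" "integrable lborel (\<lambda>x. (h x)\<^sup>2)" "integrable lborel (\<lambda>x. h x powr (\<alpha> + \<beta>))"
    "\<And>k. AE x in lborel. \<bar>v (\<sigma> (\<tau> k)) x\<bar> \<le> h x" "AE x in lborel. (\<lambda>k. v (\<sigma> (\<tau> k)) x) \<longlonglongrightarrow> v0 x"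
    by (rule F2.bounded_compact[of "\<alpha> + \<beta>" "\<lambda>k. v (\<sigma> k)", OF dim r2 subcritical D(2) hb(2)]) blast
  define U where "U k = u (\<sigma> (\<tau> k))" for k
  define W where "W k = v (\<sigma> (\<tau> k))" for k
  have NUW: "minus_pair (U k) (W k)" for k by (simp add: U_def W_def uv)
  note DD = minus_pairD[OF NUW]
  have Ulim: "AE x in lborel. (\<lambda>k. U k x) \<longlonglongrightarrow> u0 x"
    using s1(10)
  proof eventually_elim
    case (elim x)
    then show ?case using LIMSEQ_subseq_LIMSEQ[OF elim s2(1)] by (simp add: U_def o_def)
  qed
  have Wlim: "AE x in lborel. (\<lambda>k. W k x) \<longlonglongrightarrow> v0 x" using s2(10) by (simp add: W_def)
  have Udom: "AE x in lborel. \<bar>U k x\<bar> \<le> g x" for k using s1(9) by (simp add: U_def)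
  have Wdom: "AE x in lborel. \<bar>W k x\<bar> \<le> h x" for k using s2(9) by (simp add: W_def)
  have nlim: "(\<lambda>k. norm_square (U k) (W k)) \<longlonglongrightarrow> \<nu>1 + \<nu>2"
    unfolding norm_square_def using LIMSEQ_subseq_LIMSEQ[OF s1(3) s2(1)] s2(3)
    by (intro tendsto_add) (auto simp: U_def W_def o_def)
  note [measurable] = F1.borel_potentialD(1)[OF s1(2)] F2.borel_potentialD(1)[OF s2(2)] F1.borel_potentialD(1)[OF DD(1)] F2.borel_potentialD(1)[OF DD(2)] s1(5) s2(5)
  have Alim: "(\<lambda>k. A (U k)) \<longlonglongrightarrow> A u0"
    using a_pos a_int s1(7,6) p_pos p1 Udom Ulim by (intro singular_integral_tendsto[of a u0 g U]) (auto intro: less_imp_le)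
  have Blim: "(\<lambda>k. B (W k)) \<longlonglongrightarrow> B v0"
    using b_pos b_int s2(7,6) q0 q1 Wdom Wlim by (intro singular_integral_tendsto[of b v0 h W]) (auto intro: less_imp_le)
  have Clim: "(\<lambda>k. C (U k) (W k)) \<longlonglongrightarrow> C u0 v0"
    using \<alpha>1 \<beta>1 s1(8) s2(8) Udom Wdom Ulim Wlim by (intro coupling_integral_tendsto[of u0 v0 U W \<alpha> \<beta> g h]) auto
  have Jlim: "(\<lambda>k. J (U k) (W k)) \<longlonglongrightarrow> m"
  proof -
    have "(\<lambda>k. J (u k) (v k)) \<longlonglongrightarrow> m"
    proof (rule tendsto_sandwich[of "\<lambda>_. m" _ _ "\<lambda>k. m + 1 / real (Suc k)"])
      have "(\<lambda>k. m + 1 / real (Suc k)) \<longlonglongrightarrow> m + 0"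
        by (intro tendsto_intros LIMSEQ_Suc[OF lim_const_over_n])
      then show "(\<lambda>k. m + 1 / real (Suc k)) \<longlonglongrightarrow> m" by simp
    qed (use uv m_le in \<open>auto intro!: always_eventually less_imp_le\<close>)
    from LIMSEQ_subseq_LIMSEQ[OF LIMSEQ_subseq_LIMSEQ[OF this s1(1)] s2(1)]
    show ?thesis by (simp add: U_def W_def o_def)
  qed
  obtain c' where c': "c' > 0" "\<And>u v. minus_pair u v \<Longrightarrow> c' \<le> C u v" by (rule minus_pair_C_lower_bound) blast
  have C0: "0 < C u0 v0"
    using tendsto_lowerbound[OF Clim, of c'] c' NUW by fastforce
  \<comment> \<open>Absolute values leave the three integrals unchanged and do not increase the
    norm, so the minimizer is made nonnegative at no cost.\<close>
  define z where "z x = \<bar>u0 x\<bar>" for x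
  define w where "w x = \<bar>v0 x\<bar>" for x
  have z: "z \<in> X1" and w: "w \<in> X2" unfolding z_def w_def by (auto intro: F1.borel_potential_abs F2.borel_potential_abs s1 s2)
  have zw: "A z = A u0" "B w = B v0" "C z w = C u0 v0" by (simp_all add: z_def[abs_def] w_def[abs_def])
  have nzw: "norm_square z w \<le> \<nu>1 + \<nu>2"
    using F1.borel_potential_lipschitz(2)[OF s1(2), of abs, OF abs_triangle_ineq3 abs_zero] F2.borel_potential_lipschitz(2)[OF s2(2), of abs, OF abs_triangle_ineq3 abs_zero] s1(4) s2(4)
    by (simp add: norm_square_def z_def[abs_def] w_def[abs_def])
  obtain t where t: "0 < t" "minus_pair (\<lambda>x. t * z x) (\<lambda>x. t * w x)"
    using project_to_minus_pair[OF z w] C0 zw by metis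
  let ?h = "slope_along z w" and ?e = "energy_along z w"
  have ht: "?h t = 0" "scaled_fibre_slope_deriv (A z) (B w) (C z w) t < 0" using t(2) minus_pair_scale[OF z w t(1)] by auto
  \<comment> \<open>Replacing the squared norm of the limit by the larger
    \<open>\<nu>1 + \<nu>2\<close> raises slope and energy. The raised slope is the limit of the
    slopes of the sequence, which are thus eventually positive at \<open>x\<close>; there each
    energy is at most the corresponding \<open>J\<close>. Strong convergence plays no part.\<close>
  have le: "?e x \<le> m" if x: "0 < x" "0 < ?h x" for x
  proof -
    have "(\<lambda>k. slope_along (U k) (W k) x) \<longlonglongrightarrow> fibre_slope (\<nu>1 + \<nu>2) (A u0) (B v0) (C u0 v0) x"
      unfolding fibre_slope_def by (intro tendsto_intros nlim Alim Blim Clim)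
    moreover have "0 < fibre_slope (\<nu>1 + \<nu>2) (A u0) (B v0) (C u0 v0) x"
      using x(2) nzw by (simp add: zw fibre_slope_def)
    ultimately have ev: "\<forall>\<^sub>F k in sequentially. 0 < slope_along (U k) (W k) x"
      by (rule order_tendstoD)
    have "(\<lambda>k. energy_along (U k) (W k) x) \<longlonglongrightarrow> fibre_energy (\<nu>1 + \<nu>2) (A u0) (B v0) (C u0 v0) x"
      unfolding fibre_energy_def by (intro tendsto_intros nlim Alim Blim Clim) auto
    then have "fibre_energy (\<nu>1 + \<nu>2) (A u0) (B v0) (C u0 v0) x \<le> m"
    proof (rule tendsto_le[OF trivial_limit_sequentially Jlim])
      show "\<forall>\<^sub>F k in sequentially. energy_along (U k) (W k) x \<le> J (U k) (W k)"
        using ev by eventually_elim (use NUW x in \<open>auto intro!: minus_pair_fibre_max\<close>)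
    qed
    moreover have "?e x \<le> fibre_energy (\<nu>1 + \<nu>2) (A u0) (B v0) (C u0 v0) x"
      using mult_left_mono[OF nzw, of "x\<^sup>2 / 2"] by (simp add: fibre_energy_def zw)
    ultimately show ?thesis by linarith
  qed
  \<comment> \<open>At \<open>t\<close> itself the slope vanishes and \<open>le\<close> does not
    apply. It is used just to the left of \<open>t\<close>, and continuity of the energy closes the
    gap.\<close>
  have "?e t \<le> m"
  proof -
    have sc: "fibre_slope (t\<^sup>2 * norm_square z w) (t powr (1 - p) * A z) (t powr (1 - q) * B w) (t powr (\<alpha> + \<beta>) * C z w) y = t\<^sup>2 * ?h (t * y)" if "0 < y" for y
      using fibre_slope_scale[OF t(1) that] .
    obtain \<delta> where \<delta>: "0 < \<delta>" "\<delta> < 1" "\<And>y. 1 - \<delta> < y \<Longrightarrow> y < 1 \<Longrightarrow>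
        0 < fibre_slope (t\<^sup>2 * norm_square z w) (t powr (1 - p) * A z) (t powr (1 - q) * B w) (t powr (\<alpha> + \<beta>) * C z w) y"
      using fibre_slope_pos_left_of_one[of "t\<^sup>2 * norm_square z w" "t powr (1 - p) * A z" "t powr (1 - q) * B w" "t powr (\<alpha> + \<beta>) * C z w"]
        ht sc[of 1] by (auto simp: scaled_fibre_slope_deriv_def)
    \<comment> \<open>The denominators start at 2, so that \<open>y k\<close> stays strictly above
      \<open>1 - \<delta>\<close>.\<close>
    define y where "y k = 1 - \<delta> / real (Suc (Suc k))" for k
    have y: "1 - \<delta> < y k" "y k < 1" for k
      using \<delta> by (auto simp: y_def divide_less_eq)
    have yp: "0 < y k" for k using y(1)[of k] \<delta>(2) by linarith
    have "0 < ?h (t * y k)" for k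
      using \<delta>(3)[OF y] sc[OF yp] t(1) by (simp add: zero_less_mult_iff)
    then have lek: "?e (t * y k) \<le> m" for k using le[of "t * y k"] t(1) yp[of k] by simp
    have "y \<longlonglongrightarrow> 1 - 0"
      unfolding y_def by (intro tendsto_intros LIMSEQ_Suc[OF LIMSEQ_Suc[OF lim_const_over_n]])
    then have "(\<lambda>k. t * y k) \<longlonglongrightarrow> t * (1 - 0)" by (intro tendsto_intros)
    then have "(\<lambda>k. t * y k) \<longlonglongrightarrow> t" by simp
    moreover have "isCont ?e t"
      using continuous_on_fibre_energy[of "norm_square z w" "A z" "B w" "C z w"] t(1) by (simp add: continuous_on_eq_continuous_at)
    ultimately have "(\<lambda>k. ?e (t * y k)) \<longlonglongrightarrow> ?e t"
      by (rule isCont_tendsto_compose[rotated])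
    then show ?thesis by (rule LIMSEQ_le_const2) (use lek in auto)
  qed
  then have "J (\<lambda>x. t * z x) (\<lambda>x. t * w x) \<le> m" by (simp add: J_scale[OF z w t(1)])
  then show ?thesis
    using that[OF t(2)] t(1) m_le by (force simp: z_def w_def)
qed

end

section \<open>The first variation at a minimizer\<close>

lemma powr_increment_mvt:
  fixes z e c :: real
  assumes "0 < z" "0 < e"
  obtains x where "z < x" "x < z + e" "(z + e) powr c - z powr c = e * (c * x powr (c - 1))"
proof -
  have "\<exists>x>z. x < z + e \<and> (z + e) powr c - z powr c = (z + e - z) * (c * x powr (c - 1))"
    using assms by (intro MVT2) (auto intro!: has_real_derivative_powr)
  then show ?thesis using that by auto
qed

text \<open>The derivative is taken at the far endpoint \<open>z + e\<close>, where it is finite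
  even for \<open>z = 0\<close>. This gives a lower bound for increments of the singular integrals
  before the minimizer is known to be positive.\<close>

lemma powr_concave_increment:
  fixes z e p :: real
  assumes "0 \<le> z" "0 \<le> e" "0 < p" "p < 1"
  shows "(1 - p) * (e * (z + e) powr (- p)) \<le> (z + e) powr (1 - p) - z powr (1 - p)"
proof (cases "e = 0 \<or> z = 0")
  case True
  then show ?thesis
  proof
    assume z: "z = 0"
    show ?thesis
    proof (cases "e = 0")
      case False
      have "e * e powr (- p) = e powr (1 - p)" using powr_mult_base[of e "- p"] assms False by simp
      then have "(1 - p) * (e * e powr (- p)) \<le> 1 * e powr (1 - p)" using assms by (intro mult_mono) auto
      then show ?thesis using z by simp
    qed simp
  qed simp
next
  case False
  then have ze: "0 < z" "0 < e" using assms by auto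
  obtain x where x: "z < x" "x < z + e" "(z + e) powr (1 - p) - z powr (1 - p) = e * ((1 - p) * x powr (1 - p - 1))"
    using powr_increment_mvt[OF ze] .
  have "(z + e) powr (- p) \<le> x powr (- p)" using x ze assms by (intro powr_mono2') auto
  then have "(e * (1 - p)) * (z + e) powr (- p) \<le> (e * (1 - p)) * x powr (- p)"
    using assms by (intro mult_left_mono) auto
  then show ?thesis using x(3) by (simp add: mult_ac)
qed

lemma powr_convex_increment:
  fixes z e c :: real
  assumes "0 \<le> z" "0 \<le> e" "1 < c"
  shows "c * z powr (c - 1) * e \<le> (z + e) powr c - z powr c"
proof (cases "e = 0 \<or> z = 0")
  case False
  then have ze: "0 < z" "0 < e" using assms by auto
  obtain x where x: "z < x" "x < z + e" "(z + e) powr c - z powr c = e * (c * x powr (c - 1))"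
    using powr_increment_mvt[OF ze] .
  have "z powr (c - 1) \<le> x powr (c - 1)" using x ze assms by (intro powr_mono2) auto
  then have "(e * c) * z powr (c - 1) \<le> (e * c) * x powr (c - 1)"
    using assms by (intro mult_left_mono) auto
  then show ?thesis using x(3) by (simp add: mult_ac)
qed (use assms in auto)

text \<open>The integrand \<open>coupling_test_integrand\<close> for nonnegative \<open>z\<close>
  and \<open>w\<close>, with \<open>\<bar>z\<bar> powr (\<alpha> - 2) * z\<close> contracted to a
  single power.\<close>

definition coupling_test :: "real \<Rightarrow> real \<Rightarrow> ('n::finite) fn \<Rightarrow> 'n fn \<Rightarrow> 'n fn \<Rightarrow> 'n fn \<Rightarrow> 'n fn" where
  "coupling_test \<alpha> \<beta> z w \<phi> \<psi> x = \<alpha> * z x powr (\<alpha> - 1) * \<phi> x * w x powr \<beta> + \<beta> * z x powr \<alpha> * w x powr (\<beta> - 1) * \<psi> x"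

text \<open>The product is changed one factor at a time, and convexity of each power bounds its
  increment from below. In nonnegative directions minimality uses nothing but such lower
  bounds.\<close>

lemma coupling_test_increment:
  fixes z w \<phi> \<psi> :: "('n::finite) fn"
  assumes "0 \<le> z x" "0 \<le> w x" "0 \<le> \<phi> x" "0 \<le> \<psi> x" "0 \<le> e" "1 < \<alpha>" "1 < \<beta>"
  shows "e * coupling_test \<alpha> \<beta> z w \<phi> \<psi> x \<le> (z x + e * \<phi> x) powr \<alpha> * (w x + e * \<psi> x) powr \<beta> - z x powr \<alpha> * w x powr \<beta>"
proof -
  let ?z = "z x + e * \<phi> x" and ?w = "w x + e * \<psi> x"
  have ep: "0 \<le> e * \<phi> x" "0 \<le> e * \<psi> x" using assms by auto
  have 1: "(\<alpha> * z x powr (\<alpha> - 1) * (e * \<phi> x)) * w x powr \<beta> \<le> (?z powr \<alpha> - z x powr \<alpha>) * w x powr \<beta>"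
    by (intro mult_right_mono powr_convex_increment ep assms) auto
  have 2: "z x powr \<alpha> * (\<beta> * w x powr (\<beta> - 1) * (e * \<psi> x)) \<le> ?z powr \<alpha> * (?w powr \<beta> - w x powr \<beta>)"
    using assms ep by (intro mult_mono powr_convex_increment powr_mono2) auto
  have "e * coupling_test \<alpha> \<beta> z w \<phi> \<psi> x = (\<alpha> * z x powr (\<alpha> - 1) * (e * \<phi> x)) * w x powr \<beta> + z x powr \<alpha> * (\<beta> * w x powr (\<beta> - 1) * (e * \<psi> x))"
    by (simp add: coupling_test_def algebra_simps)
  also have "\<dots> \<le> (?z powr \<alpha> - z x powr \<alpha>) * w x powr \<beta> + ?z powr \<alpha> * (?w powr \<beta> - w x powr \<beta>)"
    using 1 2 by (rule add_mono)
  also have "\<dots> = ?z powr \<alpha> * ?w powr \<beta> - z x powr \<alpha> * w x powr \<beta>" by (simp add: algebra_simps)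
  finally show ?thesis .
qed

lemma coupling_test_nonneg: "0 \<le> \<phi> x \<Longrightarrow> 0 \<le> \<psi> x \<Longrightarrow> 1 < \<alpha> \<Longrightarrow> 1 < \<beta> \<Longrightarrow> 0 \<le> coupling_test \<alpha> \<beta> z w \<phi> \<psi> x"
  unfolding coupling_test_def by (intro add_nonneg_nonneg mult_nonneg_nonneg) auto

lemma coupling_test_measurable [measurable]:
  assumes [measurable]: "z \<in> borel_measurable borel" "w \<in> borel_measurable borel" "\<phi> \<in> borel_measurable borel" "\<psi> \<in> borel_measurable borel"
  shows "coupling_test \<alpha> \<beta> z w \<phi> \<psi> \<in> borel_measurable borel"
  unfolding coupling_test_def by measurable

text \<open>The negative part has slopes 0 and -1 only, so its difference quotients lie between -1
  and 0; \<open>- c\<close> is this quotient.\<close>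

lemma negative_part_slope:
  fixes s t :: real
  obtains c where "0 \<le> c" "c \<le> 1" "max 0 (- s) - max 0 (- t) = - c * (s - t)"
proof (cases "s = t")
  case True
  then show ?thesis using that[of 0] by simp
next
  case False
  let ?c = "- (max 0 (- s) - max 0 (- t)) / (s - t)"
  show ?thesis
  proof (rule that[of ?c])
    show "0 \<le> ?c" "?c \<le> 1" using False by (auto simp: divide_simps max_def)
    show "max 0 (- s) - max 0 (- t) = - ?c * (s - t)" using False by simp
  qed
qed

section \<open>Testing against negative parts\<close>

context positive_potential
begin

text \<open>The negative part is a decreasing Lipschitz function, so testing \<open>u\<close> against the negative part of
  \<open>u + e * \<phi>\<close> produces, up to a term of order \<open>e\<close> carried by \<open>{u + e * \<phi> < 0}\<close>, a nonpositive
  contribution; this set shrinks to a null set because \<open>u > 0\<close>.\<close>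

lemma negative_part_remainder:
  assumes u: "u \<in> borel_potential s V" and \<phi>: "\<phi> \<in> borel_potential s V" and pos: "AE x in lborel. 0 < u x"
  obtains \<rho> :: "nat \<Rightarrow> real" where "\<rho> \<longlonglongrightarrow> 0"
    "\<And>k. sobolev_form s V u (\<lambda>x. max 0 (- (u x + 1 / real (Suc k) * \<phi> x))) \<le> 1 / real (Suc k) * \<rho> k"
proof -
  note [measurable] = borel_potentialD(1)[OF u] borel_potentialD(1)[OF \<phi>]
  define e where "e k = 1 / real (Suc k)" for k
  have e: "0 < e k" for k by (simp add: e_def)
  define \<Omega> where "\<Omega> k = {x. u x + e k * \<phi> x < 0}" for k
  have [measurable]: "\<Omega> k \<in> sets borel" for k unfolding \<Omega>_def by measurable
  define N where "N k x = max 0 (- (u x + e k * \<phi> x))" for k x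
  have N: "N k \<in> borel_potential s V" for k
    unfolding N_def[abs_def] using borel_potential_neg[OF borel_potential_lincomb[OF u \<phi>, of 1 "e k"]] by simp
  \<comment> \<open>Outside this union of two cylinders both values of the negative part vanish. Its
    indicators tend to 0 almost everywhere, so the integrals of \<open>g1\<close> do as
    well.\<close>
  define D where "D k = {z. fst z \<in> \<Omega> k \<or> snd z \<in> \<Omega> k}" for k
  have [measurable]: "D k \<in> sets borel" for k
  proof -
    have "D k = \<Omega> k \<times> UNIV \<union> UNIV \<times> \<Omega> k" by (auto simp: D_def)
    also have "\<dots> \<in> sets (borel \<Otimes>\<^sub>M borel)" by (intro sets.Un pair_measureI) auto
    finally show ?thesis unfolding borel_prod .
  qed
  define g1 where "g1 k z = indicator (D k) z * \<bar>gagliardo s u \<phi> z\<bar>" for k z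
  define g2 where "g2 k x = indicator (\<Omega> k) x * \<bar>V x * u x * \<phi> x\<bar>" for k x
  note gi = gagliardo_integrable[OF u \<phi>] and Vi = potential_integrable[OF u \<phi>]
  have [measurable]: "gagliardo s u \<phi> \<in> borel_measurable borel" by measurable
  have i1: "integrable lborel (g1 k)" for k
    unfolding g1_def by (rule Bochner_Integration.integrable_bound[OF gi]) (auto simp: indicator_def)
  have i2: "integrable lborel (g2 k)" for k
    unfolding g2_def by (rule Bochner_Integration.integrable_bound[OF Vi]) (auto simp: indicator_def)
  have ev: "AE x in lborel. \<forall>\<^sub>F k in sequentially. x \<notin> \<Omega> k"
    using pos
  proof eventually_elim
    case (elim x)
    have "(\<lambda>k. u x + e k * \<phi> x) \<longlonglongrightarrow> u x + 0 * \<phi> x"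
      unfolding e_def by (intro tendsto_intros LIMSEQ_Suc[OF lim_const_over_n])
    then have "\<forall>\<^sub>F k in sequentially. 0 < u x + e k * \<phi> x"
      using elim by (intro order_tendstoD(1)) auto
    then show ?case by eventually_elim (simp add: \<Omega>_def)
  qed
  have l1: "(\<lambda>k. LBINT z. g1 k z) \<longlonglongrightarrow> (\<integral>z. 0 \<partial>(lborel :: ((real^'n) \<times> (real^'n)) measure))"
  proof (rule integral_dominated_convergence[where w = "\<lambda>z. \<bar>gagliardo s u \<phi> z\<bar>"])
    show "AE z in lborel. (\<lambda>k. g1 k z) \<longlonglongrightarrow> 0"
      using AE_lborel_prod[OF ev]
    proof eventually_elim
      case (elim z)
      then have "\<forall>\<^sub>F k in sequentially. fst z \<notin> \<Omega> k \<and> snd z \<notin> \<Omega> k" by (simp add: eventually_conj)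
      then have "\<forall>\<^sub>F k in sequentially. g1 k z = 0" by eventually_elim (simp add: g1_def D_def)
      then show ?case by (rule tendsto_eventually)
    qed
    show "AE z in lborel. norm (g1 k z) \<le> \<bar>gagliardo s u \<phi> z\<bar>" for k by (auto simp: g1_def indicator_def)
  qed (use gi i1 in auto)
  have l2: "(\<lambda>k. LBINT x. g2 k x) \<longlonglongrightarrow> (\<integral>x. 0 \<partial>(lborel :: (real^'n) measure))"
  proof (rule integral_dominated_convergence[where w = "\<lambda>x. \<bar>V x * u x * \<phi> x\<bar>"])
    show "AE x in lborel. (\<lambda>k. g2 k x) \<longlonglongrightarrow> 0"
      using ev
    proof eventually_elim
      case (elim x)
      then have "\<forall>\<^sub>F k in sequentially. g2 k x = 0" by eventually_elim (simp add: g2_def)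
      then show ?case by (rule tendsto_eventually)
    qed
    show "AE x in lborel. norm (g2 k x) \<le> \<bar>V x * u x * \<phi> x\<bar>" for k by (auto simp: g2_def indicator_def)
  qed (use Vi i2 in auto)
  have p1: "gagliardo s u (N k) z \<le> e k * g1 k z" for k z
  proof (cases z)
    case (Pair x y)
    show ?thesis
    proof (cases "z \<in> D k")
      case True
      \<comment> \<open>The representation turns the numerator into \<open>- c * d\<^sup>2\<close>,
        which has the favourable sign and is dropped, and a cross term of size at most
        \<open>e k * \<bar>d * f\<bar>\<close>.\<close>
      obtain c where c: "0 \<le> c" "c \<le> 1" "N k x - N k y = - c * ((u x + e k * \<phi> x) - (u y + e k * \<phi> y))"
        unfolding N_def by (rule negative_part_slope)
      define d where "d = u x - u y"
      define f where "f = \<phi> x - \<phi> y"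
      have "d * (N k x - N k y) = - (c * d\<^sup>2) - c * e k * (d * f)"
        unfolding c(3) d_def f_def by (simp add: power2_eq_square algebra_simps)
      also have "\<dots> \<le> 0 + c * e k * \<bar>d * f\<bar>"
      proof -
        have "- (c * e k * (d * f)) \<le> c * e k * \<bar>d * f\<bar>"
          using mult_left_mono[of "- (d * f)" "\<bar>d * f\<bar>" "c * e k"] c e[of k] by simp
        moreover have "0 \<le> c * d\<^sup>2" using c by simp
        ultimately show ?thesis by linarith
      qed
      also have "\<dots> \<le> 0 + 1 * e k * \<bar>d * f\<bar>"
        using c e[of k] by (intro add_left_mono mult_right_mono) auto
      finally have "d * (N k x - N k y) \<le> e k * \<bar>d * f\<bar>" by simp
      then have "d * (N k x - N k y) / norm (x - y) powr (real CARD('n) + 2 * s) \<le> e k * \<bar>d * f\<bar> / norm (x - y) powr (real CARD('n) + 2 * s)"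
        by (rule divide_right_mono) simp
      then show ?thesis using True by (simp add: Pair gagliardo_apply g1_def d_def f_def)
    next
      case False
      then have "N k x = 0" "N k y = 0" by (auto simp: Pair D_def \<Omega>_def N_def max_def)
      then show ?thesis using False by (simp add: Pair gagliardo_apply g1_def)
    qed
  qed
  have p2: "V x * u x * N k x \<le> e k * g2 k x" for k x
  proof (cases "x \<in> \<Omega> k")
    case True
    have "u x * N k x = - (u x)\<^sup>2 - e k * (u x * \<phi> x)"
      using True by (simp add: N_def \<Omega>_def max_def power2_eq_square algebra_simps)
    also have "\<dots> \<le> e k * \<bar>u x * \<phi> x\<bar>"
    proof -
      have "e k * - (u x * \<phi> x) \<le> e k * \<bar>u x * \<phi> x\<bar>"
        using e[of k] by (intro mult_left_mono abs_ge_minus_self) auto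
      moreover have "e k * - (u x * \<phi> x) = - (e k * (u x * \<phi> x))" by simp
      ultimately show ?thesis using zero_le_power2[of "u x"] by linarith
    qed
    finally have "V x * (u x * N k x) \<le> V x * (e k * \<bar>u x * \<phi> x\<bar>)" by (rule mult_left_mono) simp
    then show ?thesis using True by (simp add: g2_def abs_mult mult_ac)
  next
    case False
    then have "N k x = 0" by (simp add: \<Omega>_def N_def max_def)
    then show ?thesis using False by (simp add: g2_def)
  qed
  define \<rho> where "\<rho> k = (LBINT z. g1 k z) + (LBINT x. g2 k x)" for k
  show ?thesis
  proof (rule that[of \<rho>])
    show "\<rho> \<longlonglongrightarrow> 0" unfolding \<rho>_def using tendsto_add[OF l1 l2] by simp
    fix k
    have "(LBINT z. gagliardo s u (N k) z) \<le> (LBINT z. e k * g1 k z)"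
      using gagliardo_integrable[OF u N] i1 p1 by (intro integral_mono) auto
    moreover have "(LBINT x. V x * u x * N k x) \<le> (LBINT x. e k * g2 k x)"
      using potential_integrable[OF u N] i2 p2 by (intro integral_mono) auto
    ultimately have "sobolev_form s V u (N k) \<le> e k * \<rho> k"
      by (simp add: sobolev_form_def \<rho>_def distrib_left)
    then show "sobolev_form s V u (\<lambda>x. max 0 (- (u x + 1 / real (Suc k) * \<phi> x))) \<le> 1 / real (Suc k) * \<rho> k"
      by (simp add: N_def[abs_def] e_def)
  qed
qed

end

section \<open>Increments and limits of the singular integrals\<close>

lemma
  fixes a z \<phi> :: "('n::finite) fn"
  assumes [measurable]: "a \<in> borel_measurable borel" "z \<in> borel_measurable borel" "\<phi> \<in> borel_measurable borel"
    and a: "\<And>x. 0 \<le> a x" "integrable lborel (\<lambda>x. a x powr (2 / (1 + p)))"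
    and z: "integrable lborel (\<lambda>x. (z x)\<^sup>2)" "\<And>x. 0 \<le> z x"
    and \<phi>: "integrable lborel (\<lambda>x. (\<phi> x)\<^sup>2)" "\<And>x. 0 \<le> \<phi> x" and p: "0 < p" "p < 1" and e: "0 < e"
  shows singular_integral_increment_integrable: "integrable lborel (\<lambda>x. a x * (\<phi> x * (z x + e * \<phi> x) powr (- p)))"
    and singular_integral_increment: "(1 - p) * e * (LBINT x. a x * (\<phi> x * (z x + e * \<phi> x) powr (- p)))
      \<le> singular_integral a p (\<lambda>x. z x + e * \<phi> x) - singular_integral a p z"
proof -
  have ze: "integrable lborel (\<lambda>x. (z x + e * \<phi> x)\<^sup>2)"
  proof (rule Bochner_Integration.integrable_bound)
    show "integrable lborel (\<lambda>x. 2 * (z x)\<^sup>2 + 2 * (e\<^sup>2 * (\<phi> x)\<^sup>2))" using z \<phi> by simp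
    show "AE x in lborel. norm ((z x + e * \<phi> x)\<^sup>2) \<le> norm (2 * (z x)\<^sup>2 + 2 * (e\<^sup>2 * (\<phi> x)\<^sup>2))"
      using square_diff_le[of "z x" "- (e * \<phi> x)" for x] by (intro AE_I2) (simp add: power_mult_distrib)
  qed measurable
  have i1: "integrable lborel (\<lambda>x. a x * \<bar>z x + e * \<phi> x\<bar> powr (1 - p))"
    by (rule singular_integral_integrable) (use a ze p in auto)
  have i0: "integrable lborel (\<lambda>x. a x * \<bar>z x\<bar> powr (1 - p))"
    by (rule singular_integral_integrable) (use a z p in auto)
  have pw: "(1 - p) * e * (a x * (\<phi> x * (z x + e * \<phi> x) powr (- p))) \<le> a x * \<bar>z x + e * \<phi> x\<bar> powr (1 - p) - a x * \<bar>z x\<bar> powr (1 - p)" for x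
  proof -
    have "0 \<le> e * \<phi> x" using e \<phi> by simp
    then have "(1 - p) * ((e * \<phi> x) * (z x + e * \<phi> x) powr (- p)) \<le> (z x + e * \<phi> x) powr (1 - p) - z x powr (1 - p)"
      by (intro powr_concave_increment z p)
    then have "a x * ((1 - p) * ((e * \<phi> x) * (z x + e * \<phi> x) powr (- p))) \<le> a x * ((z x + e * \<phi> x) powr (1 - p) - z x powr (1 - p))"
      using a(1) by (rule mult_left_mono)
    then show ?thesis using z(2)[of x] \<open>0 \<le> e * \<phi> x\<close> by (simp add: algebra_simps)
  qed
  have norm_square: "0 \<le> a x * (\<phi> x * (z x + e * \<phi> x) powr (- p))" for x using a \<phi> by simp
  show i: "integrable lborel (\<lambda>x. a x * (\<phi> x * (z x + e * \<phi> x) powr (- p)))"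
  proof (rule Bochner_Integration.integrable_bound)
    show "integrable lborel (\<lambda>x. 1 / ((1 - p) * e) * (a x * \<bar>z x + e * \<phi> x\<bar> powr (1 - p)))" using i1 by simp
    show "AE x in lborel. norm (a x * (\<phi> x * (z x + e * \<phi> x) powr (- p))) \<le> norm (1 / ((1 - p) * e) * (a x * \<bar>z x + e * \<phi> x\<bar> powr (1 - p)))"
    proof (rule AE_I2)
      fix x
      have "0 \<le> a x * \<bar>z x\<bar> powr (1 - p)" using a by simp
      then have "(1 - p) * e * (a x * (\<phi> x * (z x + e * \<phi> x) powr (- p))) \<le> a x * \<bar>z x + e * \<phi> x\<bar> powr (1 - p)"
        using pw[of x] by linarith
      then have "a x * (\<phi> x * (z x + e * \<phi> x) powr (- p)) \<le> 1 / ((1 - p) * e) * (a x * \<bar>z x + e * \<phi> x\<bar> powr (1 - p))"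
        using p e by (simp add: field_simps)
      then show "norm (a x * (\<phi> x * (z x + e * \<phi> x) powr (- p))) \<le> norm (1 / ((1 - p) * e) * (a x * \<bar>z x + e * \<phi> x\<bar> powr (1 - p)))"
        using norm_square[of x] by (simp only: real_norm_def abs_of_nonneg)
    qed
  qed measurable
  have "(LBINT x. (1 - p) * e * (a x * (\<phi> x * (z x + e * \<phi> x) powr (- p))))
      \<le> (LBINT x. a x * \<bar>z x + e * \<phi> x\<bar> powr (1 - p) - a x * \<bar>z x\<bar> powr (1 - p))"
    using i i0 i1 pw by (intro integral_mono) auto
  then show "(1 - p) * e * (LBINT x. a x * (\<phi> x * (z x + e * \<phi> x) powr (- p)))
      \<le> singular_integral a p (\<lambda>x. z x + e * \<phi> x) - singular_integral a p z"
    using i0 i1 by (simp add: singular_integral_def)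
qed

lemma singular_integrand_antimono:
  fixes z \<phi> e d p :: real
  assumes "0 \<le> z" "0 \<le> \<phi>" "0 < e" "e \<le> d" "0 < p"
  shows "\<phi> * (z + d * \<phi>) powr (- p) \<le> \<phi> * (z + e * \<phi>) powr (- p)"
proof (cases "\<phi> = 0")
  case False
  then have "0 < e * \<phi>" using assms by simp
  moreover have "e * \<phi> \<le> d * \<phi>" using assms by (intro mult_right_mono) auto
  ultimately show ?thesis using assms by (intro mult_left_mono powr_mono2') auto
qed simp

text \<open>On \<open>{x. z x = 0}\<close> the regularized integrand is \<open>e powr (- p)\<close>,
  with \<open>e = 1 / Suc k\<close>, times a fixed function that is positive inside the ball of
  radius \<open>R\<close>. Bounded integrals therefore force the integral of that function over the
  zero set below \<open>e powr p * L\<close>, hence to 0. Integer radii exhaust the space.\<close>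

lemma positive_if_singular_bounded:
  fixes a z :: "('n::finite) fn"
  assumes [measurable]: "a \<in> borel_measurable borel" "z \<in> borel_measurable borel"
    and a: "\<And>x. 0 < a x" and z: "\<And>x. 0 \<le> z x" and p: "0 < p"
    and i: "\<And>R k. 0 < R \<Longrightarrow> integrable lborel (\<lambda>x. a x * (tent R x * (z x + 1 / real (Suc k) * tent R x) powr (- p)))"
    and L: "\<And>R. 0 < R \<Longrightarrow> \<exists>L. \<forall>k. (LBINT x. a x * (tent R x * (z x + 1 / real (Suc k) * tent R x) powr (- p))) \<le> L"
  shows "AE x in lborel. 0 < z x"
proof -
  have "AE x in lborel. norm x < real (Suc n) \<longrightarrow> 0 < z x" for n :: nat
  proof -
    define R where "R = real (Suc n)"
    have R: "0 < R" by (simp add: R_def)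
    define e where "e k = 1 / real (Suc k)" for k
    have e: "0 < e k" for k by (simp add: e_def)
    obtain L where L: "\<And>k. (LBINT x. a x * (tent R x * (z x + e k * tent R x) powr (- p))) \<le> L"
      using L[OF R] unfolding e_def by blast
    define f where "f x = indicator {x. z x = 0} x * (a x * (tent R x * tent R x powr (- p)))" for x
    have [measurable]: "f \<in> borel_measurable borel" unfolding f_def by measurable
    have t0: "0 \<le> tent R x" for x :: "real^'n" by (simp add: tent_def)
    have f0: "0 \<le> f x" for x using a[of x] t0[of x] by (simp add: f_def)
    have fle: "f x \<le> e k powr p * (a x * (tent R x * (z x + e k * tent R x) powr (- p)))" for k x
    proof (cases "z x = 0")
      case True
      have "e k powr p * e k powr (- p) = 1" using e[of k] by (simp flip: powr_add)
      then have "e k powr p * (e k * tent R x) powr (- p) = tent R x powr (- p)"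
        using e[of k] t0[of x] by (simp add: powr_mult flip: mult.assoc)
      then have "f x = e k powr p * (a x * (tent R x * (z x + e k * tent R x) powr (- p)))"
        using True by (simp add: f_def mult_ac)
      then show ?thesis by simp
    next
      case False
      then show ?thesis using a[of x] t0[of x] by (simp add: f_def)
    qed
    have fi: "integrable lborel f"
    proof (rule Bochner_Integration.integrable_bound)
      show "integrable lborel (\<lambda>x. e 0 powr p * (a x * (tent R x * (z x + e 0 * tent R x) powr (- p))))"
        using i[OF R, of 0] unfolding e_def by (rule integrable_mult_right)
      show "AE x in lborel. norm (f x) \<le> norm (e 0 powr p * (a x * (tent R x * (z x + e 0 * tent R x) powr (- p))))"
        using fle[of _ 0] f0 by (intro AE_I2) (simp add: order_trans[OF _ abs_ge_self])
    qed simp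
    have "(LBINT x. f x) \<le> e k powr p * L" for k
    proof -
      have "(LBINT x. f x) \<le> (LBINT x. e k powr p * (a x * (tent R x * (z x + e k * tent R x) powr (- p))))"
        using fi i[OF R, of k] fle unfolding e_def by (intro integral_mono integrable_mult_right) auto
      also have "\<dots> = e k powr p * (LBINT x. a x * (tent R x * (z x + e k * tent R x) powr (- p)))"
        by simp
      also have "\<dots> \<le> e k powr p * L" by (intro mult_left_mono L) simp
      finally show ?thesis .
    qed
    moreover have "(\<lambda>k. e k powr p * L) \<longlonglongrightarrow> 0 powr p * L"
      unfolding e_def using p by (intro tendsto_mult tendsto_const tendsto_powr2 LIMSEQ_Suc[OF lim_const_over_n]) auto
    ultimately have "(LBINT x. f x) \<le> 0 powr p * L"
      by (intro LIMSEQ_le_const) auto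
    then have "(LBINT x. f x) = 0"
      using p f0 by (intro antisym Bochner_Integration.integral_nonneg) auto
    then have "AE x in lborel. f x = 0"
      using fi f0 by (subst (asm) integral_nonneg_eq_0_iff_AE) auto
    then show ?thesis
    proof eventually_elim
      case (elim x)
      show ?case
      proof
        assume "norm x < real (Suc n)"
        then have "0 < tent R x" by (simp add: tent_def R_def)
        then have "z x \<noteq> 0" using elim a[of x] by (auto simp: f_def)
        then show "0 < z x" using z[of x] by simp
      qed
    qed
  qed
  then have "AE x in lborel. \<forall>n. norm x < real (Suc n) \<longrightarrow> 0 < z x"
    unfolding AE_all_countable by (rule allI)
  then show ?thesis
  proof eventually_elim
    case (elim x)
    obtain n where "norm x < real n" using reals_Archimedean2 by blast
    then have "norm x < real (Suc n)" by simp
    then show ?case using elim by blast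
  qed
qed

text \<open>Monotone convergence: the integrands increase as the step shrinks. Positivity of
  \<open>z\<close> almost everywhere identifies the limit, since at a zero of \<open>z\<close> the
  convention \<open>0 powr (- p) = 0\<close> would give a wrong value.\<close>

lemma singular_integrals_tendsto:
  fixes a z \<phi> :: "('n::finite) fn"
  assumes [measurable]: "a \<in> borel_measurable borel" "z \<in> borel_measurable borel" "\<phi> \<in> borel_measurable borel"
    and a: "\<And>x. 0 < a x" and z: "\<And>x. 0 \<le> z x" "AE x in lborel. 0 < z x" and \<phi>: "\<And>x. 0 \<le> \<phi> x" and p: "0 < p"
    and i: "\<And>k. integrable lborel (\<lambda>x. a x * (\<phi> x * (z x + 1 / real (Suc k) * \<phi> x) powr (- p)))"
    and L: "\<And>k. (LBINT x. a x * (\<phi> x * (z x + 1 / real (Suc k) * \<phi> x) powr (- p))) \<le> L"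
  shows "integrable lborel (\<lambda>x. a x * (\<phi> x * z x powr (- p)))"
    "(\<lambda>k. LBINT x. a x * (\<phi> x * (z x + 1 / real (Suc k) * \<phi> x) powr (- p))) \<longlonglongrightarrow> (LBINT x. a x * (\<phi> x * z x powr (- p)))"
proof -
  let ?f = "\<lambda>k x. a x * (\<phi> x * (z x + 1 / real (Suc k) * \<phi> x) powr (- p))"
  have mono: "?f j x \<le> ?f k x" if "j \<le> k" for j k x
    using a[of x] z(1)[of x] \<phi>[of x] p that
    by (intro mult_left_mono singular_integrand_antimono) (auto simp: frac_le)
  have inc: "incseq (\<lambda>k. LBINT x. ?f k x)"
    unfolding incseq_def using mono i by (auto intro!: integral_mono)
  obtain l where l: "(\<lambda>k. LBINT x. ?f k x) \<longlonglongrightarrow> l"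
    by (rule incseq_convergent[OF inc allI[OF L]])
  have lim: "AE x in lborel. (\<lambda>k. ?f k x) \<longlonglongrightarrow> a x * (\<phi> x * z x powr (- p))"
    using z(2)
  proof eventually_elim
    case (elim x)
    have "(\<lambda>k. z x + 1 / real (Suc k) * \<phi> x) \<longlonglongrightarrow> z x + 0 * \<phi> x"
      by (intro tendsto_intros LIMSEQ_Suc[OF lim_const_over_n])
    then have "(\<lambda>k. z x + 1 / real (Suc k) * \<phi> x) \<longlonglongrightarrow> z x" by simp
    then show ?case using elim by (intro tendsto_mult tendsto_const tendsto_powr) auto
  qed
  have m: "AE x in lborel. mono (\<lambda>k. ?f k x)"
    using mono by (intro AE_I2 monoI) blast
  have pos: "AE x in lborel. 0 \<le> ?f k x" for k
    using a \<phi> by (intro AE_I2 mult_nonneg_nonneg) (auto intro: less_imp_le)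
  have meas: "(\<lambda>x. a x * (\<phi> x * z x powr (- p))) \<in> borel_measurable lborel" by measurable
  note mc = integral_monotone_convergence_nonneg[OF i m pos lim l meas]
  show "integrable lborel (\<lambda>x. a x * (\<phi> x * z x powr (- p)))" by (rule mc(1))
  show "(\<lambda>k. LBINT x. ?f k x) \<longlonglongrightarrow> (LBINT x. a x * (\<phi> x * z x powr (- p)))"
    using l by (simp only: mc(2))
qed

section \<open>The one-sided first variation\<close>

locale nehari_minimizer = singular_system lam \<theta> p q \<alpha> \<beta> s V0 V1 V2 a b
  for lam \<theta> p q \<alpha> \<beta> s V0 :: real and V1 V2 a b :: "('n::finite) fn" +
  fixes z w :: "'n fn"
  assumes zw: "minus_pair z w" and z_nonneg: "\<And>x. 0 \<le> z x" and w_nonneg: "\<And>x. 0 \<le> w x"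
    and minimal: "\<And>u v. minus_pair u v \<Longrightarrow> J z w \<le> J u v"
begin

lemmas zX = minus_pairD(1)[OF zw] and wX = minus_pairD(2)[OF zw]

lemmas z_borel [measurable] = F1.borel_potentialD(1)[OF zX] and w_borel [measurable] = F2.borel_potentialD(1)[OF wX]

definition "ell \<phi> \<psi> = sobolev_form s V1 z \<phi> + sobolev_form s V2 w \<psi>"
definition "T \<phi> \<psi> = (LBINT x. coupling_test \<alpha> \<beta> z w \<phi> \<psi> x)"
text \<open>The singular term regularized by evaluating the power at the perturbed point: exactly
  what concavity provides for the step \<open>1 / Suc k\<close>. It increases with \<open>k\<close>
  for nonnegative test functions.\<close>

definition "G k \<phi> = (LBINT x. a x * (\<phi> x * (z x + 1 / real (Suc k) * \<phi> x) powr (- p)))"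
definition "H k \<psi> = (LBINT x. b x * (\<psi> x * (w x + 1 / real (Suc k) * \<psi> x) powr (- q)))"

text \<open>The unit step in \<open>coupling_test_increment\<close> already supplies an integrable
  majorant, the coupling integrand of the pair shifted by the test functions.\<close>

lemma coupling_test_integrable_nonneg:
  assumes \<phi>: "\<phi> \<in> X1" "\<And>x. 0 \<le> \<phi> x" and \<psi>: "\<psi> \<in> X2" "\<And>x. 0 \<le> \<psi> x"
  shows "integrable lborel (coupling_test \<alpha> \<beta> z w \<phi> \<psi>)"
proof (rule Bochner_Integration.integrable_bound)
  note [measurable] = F1.borel_potentialD(1)[OF \<phi>(1)] F2.borel_potentialD(1)[OF \<psi>(1)]
  show "integrable lborel (\<lambda>x. \<bar>z x + \<phi> x\<bar> powr \<alpha> * \<bar>w x + \<psi> x\<bar> powr \<beta>)"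
    by (rule C_integrable[OF F1.borel_potential_add[OF zX \<phi>(1)] F2.borel_potential_add[OF wX \<psi>(1)]])
  show "AE x in lborel. norm (coupling_test \<alpha> \<beta> z w \<phi> \<psi> x) \<le> norm (\<bar>z x + \<phi> x\<bar> powr \<alpha> * \<bar>w x + \<psi> x\<bar> powr \<beta>)"
  proof (rule AE_I2)
    fix x
    have "0 \<le> z x powr \<alpha> * w x powr \<beta>" by simp
    moreover have "coupling_test \<alpha> \<beta> z w \<phi> \<psi> x \<le> (z x + \<phi> x) powr \<alpha> * (w x + \<psi> x) powr \<beta> - z x powr \<alpha> * w x powr \<beta>"
      using coupling_test_increment[of z x w \<phi> \<psi> 1 \<alpha> \<beta>] z_nonneg w_nonneg \<phi>(2) \<psi>(2) \<alpha>1 \<beta>1 by simp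
    ultimately have "coupling_test \<alpha> \<beta> z w \<phi> \<psi> x \<le> (z x + \<phi> x) powr \<alpha> * (w x + \<psi> x) powr \<beta>"
      by linarith
    then show "norm (coupling_test \<alpha> \<beta> z w \<phi> \<psi> x) \<le> norm (\<bar>z x + \<phi> x\<bar> powr \<alpha> * \<bar>w x + \<psi> x\<bar> powr \<beta>)"
      using coupling_test_nonneg[of \<phi> x \<psi> \<alpha> \<beta> z w] z_nonneg[of x] w_nonneg[of x] \<phi>(2)[of x] \<psi>(2)[of x] \<alpha>1 \<beta>1 by simp
  qed
  show "coupling_test \<alpha> \<beta> z w \<phi> \<psi> \<in> borel_measurable lborel" by measurable
qed

lemma coupling_test_integrable:
  assumes \<phi>: "\<phi> \<in> X1" and \<psi>: "\<psi> \<in> X2"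
  shows "integrable lborel (coupling_test \<alpha> \<beta> z w \<phi> \<psi>)"
proof (rule Bochner_Integration.integrable_bound)
  note [measurable] = F1.borel_potentialD(1)[OF \<phi>(1)] F2.borel_potentialD(1)[OF \<psi>(1)]
  show "integrable lborel (coupling_test \<alpha> \<beta> z w (\<lambda>x. \<bar>\<phi> x\<bar>) (\<lambda>x. \<bar>\<psi> x\<bar>))"
    by (rule coupling_test_integrable_nonneg[OF F1.borel_potential_abs[OF \<phi>] _ F2.borel_potential_abs[OF \<psi>]]) auto
  show "AE x in lborel. norm (coupling_test \<alpha> \<beta> z w \<phi> \<psi> x) \<le> norm (coupling_test \<alpha> \<beta> z w (\<lambda>x. \<bar>\<phi> x\<bar>) (\<lambda>x. \<bar>\<psi> x\<bar>) x)"
  proof (rule AE_I2)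
    fix x
    have "\<bar>coupling_test \<alpha> \<beta> z w \<phi> \<psi> x\<bar> \<le> \<bar>\<alpha> * z x powr (\<alpha> - 1) * \<phi> x * w x powr \<beta>\<bar> + \<bar>\<beta> * z x powr \<alpha> * w x powr (\<beta> - 1) * \<psi> x\<bar>"
      unfolding coupling_test_def by (rule abs_triangle_ineq)
    also have "\<dots> = coupling_test \<alpha> \<beta> z w (\<lambda>x. \<bar>\<phi> x\<bar>) (\<lambda>x. \<bar>\<psi> x\<bar>) x"
      using \<alpha>1 \<beta>1 by (simp add: coupling_test_def abs_mult)
    finally show "norm (coupling_test \<alpha> \<beta> z w \<phi> \<psi> x) \<le> norm (coupling_test \<alpha> \<beta> z w (\<lambda>x. \<bar>\<phi> x\<bar>) (\<lambda>x. \<bar>\<psi> x\<bar>) x)"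
      by simp
  qed
  show "coupling_test \<alpha> \<beta> z w \<phi> \<psi> \<in> borel_measurable lborel" by measurable
qed

lemma
  assumes \<phi>: "\<phi> \<in> X1" "\<And>x. 0 \<le> \<phi> x"
  shows G_integrable: "integrable lborel (\<lambda>x. a x * (\<phi> x * (z x + 1 / real (Suc k) * \<phi> x) powr (- p)))"
    and G_increment: "(1 - p) * (1 / real (Suc k)) * G k \<phi> \<le> A (\<lambda>x. z x + 1 / real (Suc k) * \<phi> x) - A z"
    and G_nonneg: "0 \<le> G k \<phi>"
    and G_mono: "j \<le> k \<Longrightarrow> G j \<phi> \<le> G k \<phi>"
proof -
  note [measurable] = F1.borel_potentialD(1)[OF \<phi>(1)]
  show i: "integrable lborel (\<lambda>x. a x * (\<phi> x * (z x + 1 / real (Suc k) * \<phi> x) powr (- p)))" for k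
    using a_pos a_int F1.borel_potentialD(2)[OF zX] F1.borel_potentialD(2)[OF \<phi>(1)] z_nonneg \<phi>(2) p_pos p1
    by (intro singular_integral_increment_integrable) (auto intro: less_imp_le)
  show "(1 - p) * (1 / real (Suc k)) * G k \<phi> \<le> A (\<lambda>x. z x + 1 / real (Suc k) * \<phi> x) - A z"
    unfolding G_def using a_pos a_int F1.borel_potentialD(2)[OF zX] F1.borel_potentialD(2)[OF \<phi>(1)] z_nonneg \<phi>(2) p_pos p1
    by (intro singular_integral_increment) (auto intro: less_imp_le)
  show "0 \<le> G k \<phi>"
    unfolding G_def using a_pos \<phi>(2) by (intro Bochner_Integration.integral_nonneg mult_nonneg_nonneg) (auto intro: less_imp_le)
  show "j \<le> k \<Longrightarrow> G j \<phi> \<le> G k \<phi>"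
    unfolding G_def using i a_pos z_nonneg \<phi>(2) p_pos
    by (intro integral_mono mult_left_mono singular_integrand_antimono) (auto simp: frac_le intro: less_imp_le)
qed

lemma
  assumes \<psi>: "\<psi> \<in> X2" "\<And>x. 0 \<le> \<psi> x"
  shows H_integrable: "integrable lborel (\<lambda>x. b x * (\<psi> x * (w x + 1 / real (Suc k) * \<psi> x) powr (- q)))"
    and H_increment: "(1 - q) * (1 / real (Suc k)) * H k \<psi> \<le> B (\<lambda>x. w x + 1 / real (Suc k) * \<psi> x) - B w"
    and H_nonneg: "0 \<le> H k \<psi>"
    and H_mono: "j \<le> k \<Longrightarrow> H j \<psi> \<le> H k \<psi>"
proof -
  note [measurable] = F2.borel_potentialD(1)[OF \<psi>(1)]
  show i: "integrable lborel (\<lambda>x. b x * (\<psi> x * (w x + 1 / real (Suc k) * \<psi> x) powr (- q)))" for k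
    using b_pos b_int F2.borel_potentialD(2)[OF wX] F2.borel_potentialD(2)[OF \<psi>(1)] w_nonneg \<psi>(2) q0 q1
    by (intro singular_integral_increment_integrable) (auto intro: less_imp_le)
  show "(1 - q) * (1 / real (Suc k)) * H k \<psi> \<le> B (\<lambda>x. w x + 1 / real (Suc k) * \<psi> x) - B w"
    unfolding H_def using b_pos b_int F2.borel_potentialD(2)[OF wX] F2.borel_potentialD(2)[OF \<psi>(1)] w_nonneg \<psi>(2) q0 q1
    by (intro singular_integral_increment) (auto intro: less_imp_le)
  show "0 \<le> H k \<psi>"
    unfolding H_def using b_pos \<psi>(2) by (intro Bochner_Integration.integral_nonneg mult_nonneg_nonneg) (auto intro: less_imp_le)
  show "j \<le> k \<Longrightarrow> H j \<psi> \<le> H k \<psi>"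
    unfolding H_def using i b_pos w_nonneg \<psi>(2) q0
    by (intro integral_mono mult_left_mono singular_integrand_antimono) (auto simp: frac_le intro: less_imp_le)
qed

lemma C_increment:
  assumes \<phi>: "\<phi> \<in> X1" "\<And>x. 0 \<le> \<phi> x" and \<psi>: "\<psi> \<in> X2" "\<And>x. 0 \<le> \<psi> x" and e: "0 < e"
  shows "e * T \<phi> \<psi> \<le> C (\<lambda>x. z x + e * \<phi> x) (\<lambda>x. w x + e * \<psi> x) - C z w"
proof -
  have Z: "(\<lambda>x. z x + e * \<phi> x) \<in> X1" and W: "(\<lambda>x. w x + e * \<psi> x) \<in> X2"
    using F1.borel_potential_lincomb[OF zX \<phi>(1), of 1 e] F2.borel_potential_lincomb[OF wX \<psi>(1), of 1 e] by simp_all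
  have "(LBINT x. e * coupling_test \<alpha> \<beta> z w \<phi> \<psi> x) \<le>
    (LBINT x. \<bar>z x + e * \<phi> x\<bar> powr \<alpha> * \<bar>w x + e * \<psi> x\<bar> powr \<beta> - \<bar>z x\<bar> powr \<alpha> * \<bar>w x\<bar> powr \<beta>)"
  proof (rule integral_mono)
    fix x
    have "0 \<le> z x + e * \<phi> x" "0 \<le> w x + e * \<psi> x" using z_nonneg[of x] w_nonneg[of x] \<phi>(2)[of x] \<psi>(2)[of x] e by auto
    then show "e * coupling_test \<alpha> \<beta> z w \<phi> \<psi> x \<le> \<bar>z x + e * \<phi> x\<bar> powr \<alpha> * \<bar>w x + e * \<psi> x\<bar> powr \<beta> - \<bar>z x\<bar> powr \<alpha> * \<bar>w x\<bar> powr \<beta>"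
      using coupling_test_increment[of z x w \<phi> \<psi> e \<alpha> \<beta>] z_nonneg[of x] w_nonneg[of x] \<phi>(2) \<psi>(2) \<alpha>1 \<beta>1 e by simp
  qed (use coupling_test_integrable[OF \<phi>(1) \<psi>(1)] C_integrable[OF Z W] C_integrable[OF zX wX] in auto)
  then show ?thesis
    using C_integrable[OF Z W] C_integrable[OF zX wX] by (simp add: T_def coupling_integral_def)
qed

lemma variation_tendsto:
  assumes \<phi>: "\<phi> \<in> X1" "\<And>x. 0 \<le> \<phi> x" and \<psi>: "\<psi> \<in> X2" "\<And>x. 0 \<le> \<psi> x"
  shows "norm_square (\<lambda>x. z x + e * \<phi> x) (\<lambda>x. w x + e * \<psi> x) = norm_square z w + 2 * e * ell \<phi> \<psi> + e\<^sup>2 * norm_square \<phi> \<psi>"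
    "(\<lambda>k. norm_square (\<lambda>x. z x + 1 / real (Suc k) * \<phi> x) (\<lambda>x. w x + 1 / real (Suc k) * \<psi> x)) \<longlonglongrightarrow> norm_square z w"
    "(\<lambda>k. A (\<lambda>x. z x + 1 / real (Suc k) * \<phi> x)) \<longlonglongrightarrow> A z"
    "(\<lambda>k. B (\<lambda>x. w x + 1 / real (Suc k) * \<psi> x)) \<longlonglongrightarrow> B w"
    "(\<lambda>k. C (\<lambda>x. z x + 1 / real (Suc k) * \<phi> x) (\<lambda>x. w x + 1 / real (Suc k) * \<psi> x)) \<longlonglongrightarrow> C z w"
proof -
  note [measurable] = F1.borel_potentialD(1)[OF \<phi>(1)] F2.borel_potentialD(1)[OF \<psi>(1)]
  have e0: "(\<lambda>k. 1 / real (Suc k)) \<longlonglongrightarrow> 0" by (intro LIMSEQ_Suc[OF lim_const_over_n])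
  show n: "norm_square (\<lambda>x. z x + e * \<phi> x) (\<lambda>x. w x + e * \<psi> x) = norm_square z w + 2 * e * ell \<phi> \<psi> + e\<^sup>2 * norm_square \<phi> \<psi>" for e
    using F1.sobolev_form_add_scale[OF zX \<phi>(1), of e] F2.sobolev_form_add_scale[OF wX \<psi>(1), of e]
    by (simp add: norm_square_def ell_def algebra_simps)
  have "(\<lambda>k. norm_square z w + 2 * (1 / real (Suc k)) * ell \<phi> \<psi> + (1 / real (Suc k))\<^sup>2 * norm_square \<phi> \<psi>) \<longlonglongrightarrow> norm_square z w + 2 * 0 * ell \<phi> \<psi> + 0\<^sup>2 * norm_square \<phi> \<psi>"
    by (intro tendsto_intros e0)
  then show "(\<lambda>k. norm_square (\<lambda>x. z x + 1 / real (Suc k) * \<phi> x) (\<lambda>x. w x + 1 / real (Suc k) * \<psi> x)) \<longlonglongrightarrow> norm_square z w"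
    unfolding n by simp
  have Z: "(\<lambda>x. z x + \<phi> x) \<in> X1" and W: "(\<lambda>x. w x + \<psi> x) \<in> X2"
    using F1.borel_potential_add[OF zX \<phi>(1)] F2.borel_potential_add[OF wX \<psi>(1)] by auto
  have le1: "1 / real (Suc k) * t \<le> t" "0 \<le> 1 / real (Suc k) * t" if "0 \<le> t" for t k
  proof -
    have "1 / real (Suc k) * t \<le> 1 * t" using that by (intro mult_right_mono) auto
    then show "1 / real (Suc k) * t \<le> t" by simp
  qed (use that in simp)
  have domz: "AE x in lborel. \<bar>z x + 1 / real (Suc k) * \<phi> x\<bar> \<le> z x + \<phi> x" for k
  proof (rule AE_I2)
    fix x
    show "\<bar>z x + 1 / real (Suc k) * \<phi> x\<bar> \<le> z x + \<phi> x"
      using le1[OF \<phi>(2)[of x], of k] z_nonneg[of x] by linarith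
  qed
  have domw: "AE x in lborel. \<bar>w x + 1 / real (Suc k) * \<psi> x\<bar> \<le> w x + \<psi> x" for k
  proof (rule AE_I2)
    fix x
    show "\<bar>w x + 1 / real (Suc k) * \<psi> x\<bar> \<le> w x + \<psi> x"
      using le1[OF \<psi>(2)[of x], of k] w_nonneg[of x] by linarith
  qed
  have limz: "AE x in lborel. (\<lambda>k. z x + 1 / real (Suc k) * \<phi> x) \<longlonglongrightarrow> z x"
  proof (rule AE_I2)
    fix x
    have "(\<lambda>k. z x + 1 / real (Suc k) * \<phi> x) \<longlonglongrightarrow> z x + 0 * \<phi> x" by (intro tendsto_intros e0)
    then show "(\<lambda>k. z x + 1 / real (Suc k) * \<phi> x) \<longlonglongrightarrow> z x" by simp
  qed
  have limw: "AE x in lborel. (\<lambda>k. w x + 1 / real (Suc k) * \<psi> x) \<longlonglongrightarrow> w x"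
  proof (rule AE_I2)
    fix x
    have "(\<lambda>k. w x + 1 / real (Suc k) * \<psi> x) \<longlonglongrightarrow> w x + 0 * \<psi> x" by (intro tendsto_intros e0)
    then show "(\<lambda>k. w x + 1 / real (Suc k) * \<psi> x) \<longlonglongrightarrow> w x" by simp
  qed
  have nz: "0 \<le> z x + \<phi> x" "0 \<le> w x + \<psi> x" for x
    using z_nonneg[of x] \<phi>(2)[of x] w_nonneg[of x] \<psi>(2)[of x] by auto
  have mz: "(\<lambda>x. z x + 1 / real (Suc k) * \<phi> x) \<in> borel_measurable borel" for k by measurable
  have mw: "(\<lambda>x. w x + 1 / real (Suc k) * \<psi> x) \<in> borel_measurable borel" for k by measurable
  show "(\<lambda>k. A (\<lambda>x. z x + 1 / real (Suc k) * \<phi> x)) \<longlonglongrightarrow> A z"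
    by (rule singular_integral_tendsto[OF a_borel z_borel F1.borel_potentialD(1)[OF Z] mz less_imp_le[OF a_pos] a_int F1.borel_potentialD(2)[OF Z] nz(1) p_pos p1 domz limz])
  show "(\<lambda>k. B (\<lambda>x. w x + 1 / real (Suc k) * \<psi> x)) \<longlonglongrightarrow> B w"
    by (rule singular_integral_tendsto[OF b_borel w_borel F2.borel_potentialD(1)[OF W] mw less_imp_le[OF b_pos] b_int F2.borel_potentialD(2)[OF W] nz(2) q0 q1 domw limw])
  have LZ: "integrable lborel (\<lambda>x. (z x + \<phi> x) powr (\<alpha> + \<beta>))" using Lr1[OF Z] nz by simp
  have LW: "integrable lborel (\<lambda>x. (w x + \<psi> x) powr (\<alpha> + \<beta>))" using Lr2[OF W] nz by simp
  show "(\<lambda>k. C (\<lambda>x. z x + 1 / real (Suc k) * \<phi> x) (\<lambda>x. w x + 1 / real (Suc k) * \<psi> x)) \<longlonglongrightarrow> C z w"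
    using \<alpha>1 \<beta>1 by (intro coupling_integral_tendsto[OF z_borel w_borel mz mw _ _ LZ LW domz domw limz limw]) auto
qed

text \<open>The perturbed pair is pushed back to the Nehari set by a factor close to \<open>1\<close>, which costs nothing because
  the minimizer maximizes the energy along its own fibre near \<open>1\<close>.\<close>

lemma first_variation_approx:
  assumes \<phi>: "\<phi> \<in> X1" "\<And>x. 0 \<le> \<phi> x" and \<psi>: "\<psi> \<in> X2" "\<And>x. 0 \<le> \<psi> x"
  shows "lam * G j \<phi> + lam * H j \<psi> + \<theta> / (\<alpha> + \<beta>) * T \<phi> \<psi> \<le> ell \<phi> \<psi>"
proof -
  define D where "D = lam * G j \<phi> + lam * H j \<psi> + \<theta> / (\<alpha> + \<beta>) * T \<phi> \<psi>"
  define Z where "Z k x = z x + 1 / real (Suc k) * \<phi> x" for k x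
  define W where "W k x = w x + 1 / real (Suc k) * \<psi> x" for k x
  have ZX: "Z k \<in> X1" and WX: "W k \<in> X2" for k
    using F1.borel_potential_lincomb[OF zX \<phi>(1), of 1 "1 / real (Suc k)"] F2.borel_potential_lincomb[OF wX \<psi>(1), of 1 "1 / real (Suc k)"]
    by (simp_all add: Z_def[abs_def] W_def[abs_def])
  note vt = variation_tendsto[OF \<phi> \<psi>, folded Z_def W_def]
  have T0: "0 \<le> T \<phi> \<psi>"
    unfolding T_def using \<phi>(2) \<psi>(2) \<alpha>1 \<beta>1 by (intro Bochner_Integration.integral_nonneg coupling_test_nonneg) auto
  have h1: "slope_along z w 1 = 0" and d1: "fibre_slope_deriv (A z) (B w) (C z w) < 0"
    using zw by (auto simp: minus_pair_def)
  obtain \<delta>1 where \<delta>1: "0 < \<delta>1" "\<delta>1 < 1" "\<And>t. 1 - \<delta>1 < t \<Longrightarrow> t < 1 \<Longrightarrow> 0 < slope_along z w t"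
    using fibre_slope_pos_left_of_one[OF h1 d1] by blast
  obtain \<delta>2 where \<delta>2: "0 < \<delta>2" "\<delta>2 < 1" "\<And>t. 1 - \<delta>2 < t \<Longrightarrow> energy_along z w t \<le> energy_along z w 1"
    using fibre_energy_le_near_one[OF A_nonneg B_nonneg C_nonneg h1 d1] by blast
  \<comment> \<open>For fixed \<open>\<delta>\<close> the step \<open>1 / Suc k\<close> is sent to 0
    first. The error of projecting back to the Nehari set then survives only in two factors, which
    tend to 1 with \<open>\<delta>\<close>.\<close>
  have main: "(1 - \<delta>) powr (\<alpha> + \<beta>) * D \<le> (1 + \<delta>)\<^sup>2 * ell \<phi> \<psi>" if \<delta>: "0 < \<delta>" "\<delta> < min \<delta>1 \<delta>2" for \<delta>
  proof -
    define t0 where "t0 = 1 - \<delta> / 2"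
    define t1 where "t1 = 1 + \<delta> / 2"
    have t01: "0 < t0" "t0 < t1" using \<delta> \<delta>1 by (auto simp: t0_def t1_def)
    have "0 < slope_along z w t0" using \<delta> \<delta>1 by (auto simp: t0_def)
    moreover have "(\<lambda>k. slope_along (Z k) (W k) t) \<longlonglongrightarrow> slope_along z w t" for t
      unfolding fibre_slope_def by (intro tendsto_intros vt)
    ultimately have ev0: "\<forall>\<^sub>F k in sequentially. 0 < slope_along (Z k) (W k) t0"
      by (intro order_tendstoD(1)) auto
    have "slope_along z w t1 < 0"
      using \<delta> by (intro fibre_slope_neg_after[OF A_nonneg B_nonneg C_nonneg h1 d1]) (simp add: t1_def)
    moreover have "(\<lambda>k. slope_along (Z k) (W k) t1) \<longlonglongrightarrow> slope_along z w t1"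
      unfolding fibre_slope_def by (intro tendsto_intros vt)
    ultimately have ev1: "\<forall>\<^sub>F k in sequentially. slope_along (Z k) (W k) t1 < 0"
      by (intro order_tendstoD(2)) auto
    have "\<forall>\<^sub>F k in sequentially. (1 - \<delta>) powr (\<alpha> + \<beta>) * D \<le> (1 + \<delta>)\<^sup>2 * (ell \<phi> \<psi> + 1 / real (Suc k) * norm_square \<phi> \<psi> / 2)"
      using ev0 ev1 eventually_ge_at_top[of j]
    proof eventually_elim
      case (elim k)
      define e where "e = 1 / real (Suc k)"
      have e: "0 < e" by (simp add: e_def)
      obtain t where t: "t0 < t" "t < t1" "slope_along (Z k) (W k) t = 0"
        "scaled_fibre_slope_deriv (A (Z k)) (B (W k)) (C (Z k) (W k)) t < 0"
        using fibre_crossing[OF A_nonneg B_nonneg C_nonneg t01 elim(1,2)] by blast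
      have tp: "0 < t" using t t01 by simp
      have "minus_pair (\<lambda>x. t * Z k x) (\<lambda>x. t * W k x)" using minus_pair_scale[OF ZX WX tp] t by simp
      then have "J z w \<le> energy_along (Z k) (W k) t"
        using minimal J_scale[OF ZX WX tp] by metis
      moreover have "energy_along z w t \<le> J z w"
        using \<delta>2(3)[of t] t \<delta> by (simp add: J_def t0_def)
      \<comment> \<open>\<open>J z w\<close> lies between the two energies at the same
        \<open>t\<close>, so it cancels, and \<open>t\<close> is left only as a factor in front of
        each increment.\<close>
      ultimately have cmp: "lam / (1 - p) * (t powr (1 - p) * (A (Z k) - A z)) + lam / (1 - q) * (t powr (1 - q) * (B (W k) - B w))
          + \<theta> / (\<alpha> + \<beta>) * (t powr (\<alpha> + \<beta>) * (C (Z k) (W k) - C z w)) \<le> t\<^sup>2 * ((norm_square (Z k) (W k) - norm_square z w) / 2)"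
        by (simp add: fibre_energy_def algebra_simps diff_divide_distrib)
      \<comment> \<open>One lower bound for all three powers of \<open>t\<close>: the base
        \<open>1 - \<delta>\<close> is at most 1, so the largest exponent gives the smallest
        power.\<close>
      define \<mu> where "\<mu> = (1 - \<delta>) powr (\<alpha> + \<beta>)"
      have tlow: "1 - \<delta> \<le> t" "0 < 1 - \<delta>" "1 - \<delta> \<le> 1" using t \<delta> \<delta>1 by (auto simp: t0_def)
      have \<mu>le: "\<mu> \<le> t powr c" if "0 \<le> c" "c \<le> \<alpha> + \<beta>" for c
      proof -
        have "\<mu> \<le> (1 - \<delta>) powr c" unfolding \<mu>_def using that tlow by (intro powr_mono') auto
        also have "\<dots> \<le> t powr c" using that tlow by (intro powr_mono2) auto
        finally show ?thesis .
      qed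
      have \<mu>0: "0 \<le> \<mu>" by (simp add: \<mu>_def)
      have gA: "(1 - p) * e * G j \<phi> \<le> A (Z k) - A z"
      proof -
        \<comment> \<open>The regularization index \<open>j\<close> stays fixed while the step tends
          to 0; monotonicity of \<open>G\<close> in its index decouples the two.\<close>
        have "(1 - p) * e * G j \<phi> \<le> (1 - p) * e * G k \<phi>"
          using G_mono[OF \<phi> elim(3)] p1 e by (intro mult_left_mono) auto
        also have "\<dots> \<le> A (Z k) - A z" using G_increment[OF \<phi>, of k] by (simp add: Z_def[abs_def] e_def)
        finally show ?thesis .
      qed
      have gB: "(1 - q) * e * H j \<psi> \<le> B (W k) - B w"
      proof -
        have "(1 - q) * e * H j \<psi> \<le> (1 - q) * e * H k \<psi>"
          using H_mono[OF \<psi> elim(3)] q1 e by (intro mult_left_mono) auto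
        also have "\<dots> \<le> B (W k) - B w" using H_increment[OF \<psi>, of k] by (simp add: W_def[abs_def] e_def)
        finally show ?thesis .
      qed
      have gC: "e * T \<phi> \<psi> \<le> C (Z k) (W k) - C z w"
        using C_increment[OF \<phi> \<psi> e] by (simp add: Z_def[abs_def] W_def[abs_def] e_def)
      have rr: "1 - p \<le> \<alpha> + \<beta>" "1 - q \<le> \<alpha> + \<beta>" "0 \<le> \<alpha> + \<beta>" using p_pos q0 r2 by auto
      have "\<mu> * ((1 - p) * e * G j \<phi>) \<le> t powr (1 - p) * (A (Z k) - A z)"
        using \<mu>le[of "1 - p"] rr p1 gA e G_nonneg[OF \<phi>] by (intro mult_mono) auto
      then have "lam / (1 - p) * (\<mu> * ((1 - p) * e * G j \<phi>)) \<le> lam / (1 - p) * (t powr (1 - p) * (A (Z k) - A z))"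
        using lam_pos p1 by (intro mult_left_mono) auto
      moreover have "lam / (1 - p) * (\<mu> * ((1 - p) * e * G j \<phi>)) = \<mu> * e * (lam * G j \<phi>)"
        using p1 by (simp add: divide_simps)
      ultimately have 1: "\<mu> * e * (lam * G j \<phi>) \<le> lam / (1 - p) * (t powr (1 - p) * (A (Z k) - A z))"
        by (simp only:)
      have "\<mu> * ((1 - q) * e * H j \<psi>) \<le> t powr (1 - q) * (B (W k) - B w)"
        using \<mu>le[of "1 - q"] rr q1 gB e H_nonneg[OF \<psi>] by (intro mult_mono) auto
      then have "lam / (1 - q) * (\<mu> * ((1 - q) * e * H j \<psi>)) \<le> lam / (1 - q) * (t powr (1 - q) * (B (W k) - B w))"
        using lam_pos q1 by (intro mult_left_mono) auto
      moreover have "lam / (1 - q) * (\<mu> * ((1 - q) * e * H j \<psi>)) = \<mu> * e * (lam * H j \<psi>)"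
        using q1 by (simp add: divide_simps)
      ultimately have 2: "\<mu> * e * (lam * H j \<psi>) \<le> lam / (1 - q) * (t powr (1 - q) * (B (W k) - B w))"
        by (simp only:)
      have "\<mu> * (e * T \<phi> \<psi>) \<le> t powr (\<alpha> + \<beta>) * (C (Z k) (W k) - C z w)"
        using \<mu>le[of "\<alpha> + \<beta>"] rr gC e T0 by (intro mult_mono) auto
      then have "\<theta> / (\<alpha> + \<beta>) * (\<mu> * (e * T \<phi> \<psi>)) \<le> \<theta> / (\<alpha> + \<beta>) * (t powr (\<alpha> + \<beta>) * (C (Z k) (W k) - C z w))"
        using \<theta>_pos r2 by (intro mult_left_mono) auto
      then have 3: "\<mu> * e * (\<theta> / (\<alpha> + \<beta>) * T \<phi> \<psi>) \<le> \<theta> / (\<alpha> + \<beta>) * (t powr (\<alpha> + \<beta>) * (C (Z k) (W k) - C z w))"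
        by (simp add: mult_ac)
      have Dle: "\<mu> * e * D \<le> t\<^sup>2 * ((norm_square (Z k) (W k) - norm_square z w) / 2)"
      proof -
        have "\<mu> * e * D = \<mu> * e * (lam * G j \<phi>) + \<mu> * e * (lam * H j \<psi>) + \<mu> * e * (\<theta> / (\<alpha> + \<beta>) * T \<phi> \<psi>)"
          unfolding D_def by (simp only: distrib_left)
        then show ?thesis using 1 2 3 cmp by linarith
      qed
      have nk: "(norm_square (Z k) (W k) - norm_square z w) / 2 = e * (ell \<phi> \<psi> + e * norm_square \<phi> \<psi> / 2)"
      proof -
        have "norm_square (Z k) (W k) = norm_square z w + 2 * e * ell \<phi> \<psi> + e\<^sup>2 * norm_square \<phi> \<psi>"
          unfolding Z_def[abs_def] W_def[abs_def] e_def by (rule variation_tendsto(1)[OF \<phi> \<psi>])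
        then show ?thesis by (simp add: power2_eq_square algebra_simps)
      qed
      have "0 \<le> D" unfolding D_def
        using lam_pos \<theta>_pos r2 T0 G_nonneg[OF \<phi>, of j] H_nonneg[OF \<psi>, of j] by simp
      then have "0 \<le> \<mu> * e * D" using \<mu>0 e by simp
      then have "0 \<le> t\<^sup>2 * (e * (ell \<phi> \<psi> + e * norm_square \<phi> \<psi> / 2))" using Dle unfolding nk by linarith
      \<comment> \<open>The sign of the bracket, inherited from \<open>D\<close>, is what allows
        \<open>t\<^sup>2\<close> to be enlarged to \<open>(1 + \<delta>)\<^sup>2\<close>.\<close>
      then have pos: "0 \<le> ell \<phi> \<psi> + e * norm_square \<phi> \<psi> / 2" using tp e by (simp add: zero_le_mult_iff)
      have "e * (\<mu> * D) \<le> e * (t\<^sup>2 * (ell \<phi> \<psi> + e * norm_square \<phi> \<psi> / 2))" using Dle unfolding nk by (simp add: mult_ac)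
      then have "\<mu> * D \<le> t\<^sup>2 * (ell \<phi> \<psi> + e * norm_square \<phi> \<psi> / 2)" using e by simp
      also have "\<dots> \<le> (1 + \<delta>)\<^sup>2 * (ell \<phi> \<psi> + e * norm_square \<phi> \<psi> / 2)"
        using pos t tp \<delta> by (intro mult_right_mono power_mono) (auto simp: t1_def)
      finally show ?case by (simp add: \<mu>_def e_def)
    qed
    moreover have "(\<lambda>k. (1 + \<delta>)\<^sup>2 * (ell \<phi> \<psi> + 1 / real (Suc k) * norm_square \<phi> \<psi> / 2)) \<longlonglongrightarrow> (1 + \<delta>)\<^sup>2 * (ell \<phi> \<psi> + 0 * norm_square \<phi> \<psi> / 2)"
      by (intro tendsto_intros LIMSEQ_Suc[OF lim_const_over_n]) auto
    ultimately have "(1 - \<delta>) powr (\<alpha> + \<beta>) * D \<le> (1 + \<delta>)\<^sup>2 * (ell \<phi> \<psi> + 0 * norm_square \<phi> \<psi> / 2)"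
      by (intro tendsto_lowerbound[where F = sequentially]) auto
    then show ?thesis by simp
  qed
  have "((\<lambda>\<delta>. (1 - \<delta>) powr (\<alpha> + \<beta>) * D) \<longlongrightarrow> (1 - 0) powr (\<alpha> + \<beta>) * D) (at_right (0::real))"
    by (intro tendsto_intros) auto
  moreover have "((\<lambda>\<delta>. (1 + \<delta>)\<^sup>2 * ell \<phi> \<psi>) \<longlongrightarrow> (1 + 0)\<^sup>2 * ell \<phi> \<psi>) (at_right (0::real))"
    by (intro tendsto_intros)
  moreover have "\<forall>\<^sub>F \<delta> in at_right 0. (1 - \<delta>) powr (\<alpha> + \<beta>) * D \<le> (1 + \<delta>)\<^sup>2 * ell \<phi> \<psi>"
    using main \<delta>1(1) \<delta>2(1) by (intro eventually_at_rightI[of 0 "min \<delta>1 \<delta>2"]) auto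
  ultimately have "(1 - 0) powr (\<alpha> + \<beta>) * D \<le> (1 + 0)\<^sup>2 * ell \<phi> \<psi>"
    by (intro tendsto_le[where F = "at_right (0::real)"]) auto
  then show ?thesis by (simp add: D_def)
qed

end

section \<open>Positivity, the equation, and the sign of the minimal energy\<close>

context nehari_minimizer
begin

definition "Gs \<phi> = (LBINT x. a x * (\<phi> x * z x powr (- p)))"
definition "Hs \<psi> = (LBINT x. b x * (\<psi> x * w x powr (- q)))"

lemma zero_X: "(\<lambda>x. 0) \<in> X1" "(\<lambda>x. 0) \<in> X2"
  using F1.borel_potential_scale[OF zX, of 0] F2.borel_potential_scale[OF wX, of 0] by simp_all

lemma tent_X: "0 < R \<Longrightarrow> tent R \<in> X1" "0 < R \<Longrightarrow> tent R \<in> X2"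
  using tent_borel_potential[OF F1.s_pos s1 _ V1_cont] tent_borel_potential[OF F1.s_pos s1 _ V2_cont] by auto

lemma tent_nonneg: "0 \<le> tent R x"
  by (simp add: tent_def)

lemma T_nonneg: "(\<And>x. 0 \<le> \<phi> x) \<Longrightarrow> (\<And>x. 0 \<le> \<psi> x) \<Longrightarrow> 0 \<le> T \<phi> \<psi>"
  unfolding T_def using \<alpha>1 \<beta>1 by (intro Bochner_Integration.integral_nonneg coupling_test_nonneg) auto

text \<open>Each regularized singular term is one of three nonnegative summands in the first
  variation inequality, so it is bounded independently of \<open>k\<close>. This bound feeds both
  the positivity of the minimizer and the monotone limit.\<close>

lemma GH_bound:
  assumes \<phi>: "\<phi> \<in> X1" "\<And>x. 0 \<le> \<phi> x" and \<psi>: "\<psi> \<in> X2" "\<And>x. 0 \<le> \<psi> x"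
  shows "G k \<phi> \<le> ell \<phi> \<psi> / lam" "H k \<psi> \<le> ell \<phi> \<psi> / lam"
proof -
  have "0 \<le> \<theta> / (\<alpha> + \<beta>) * T \<phi> \<psi>" using \<theta>_pos r2 T_nonneg[OF \<phi>(2) \<psi>(2)] by simp
  moreover have "0 \<le> lam * G k \<phi>" "0 \<le> lam * H k \<psi>" using lam_pos G_nonneg[OF \<phi>] H_nonneg[OF \<psi>] by auto
  ultimately have "lam * G k \<phi> \<le> ell \<phi> \<psi>" "lam * H k \<psi> \<le> ell \<phi> \<psi>"
    using first_variation_approx[OF \<phi> \<psi>, of k] by linarith+
  then show "G k \<phi> \<le> ell \<phi> \<psi> / lam" "H k \<psi> \<le> ell \<phi> \<psi> / lam"
    using lam_pos by (simp_all add: field_simps)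
qed

lemma z_pos: "AE x in lborel. 0 < z x"
proof (rule positive_if_singular_bounded[OF a_borel z_borel a_pos z_nonneg p_pos])
  fix R :: real assume R: "0 < R"
  show "integrable lborel (\<lambda>x. a x * (tent R x * (z x + 1 / real (Suc k) * tent R x) powr (- p)))" for k
    by (rule G_integrable[OF tent_X(1)[OF R] tent_nonneg])
  show "\<exists>L. \<forall>k. (LBINT x. a x * (tent R x * (z x + 1 / real (Suc k) * tent R x) powr (- p))) \<le> L"
    using GH_bound(1)[OF tent_X(1)[OF R] tent_nonneg zero_X(2)] unfolding G_def by auto
qed

lemma w_pos: "AE x in lborel. 0 < w x"
proof (rule positive_if_singular_bounded[OF b_borel w_borel b_pos w_nonneg q0])
  fix R :: real assume R: "0 < R"
  show "integrable lborel (\<lambda>x. b x * (tent R x * (w x + 1 / real (Suc k) * tent R x) powr (- q)))" for k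
    by (rule H_integrable[OF tent_X(2)[OF R] tent_nonneg])
  show "\<exists>L. \<forall>k. (LBINT x. b x * (tent R x * (w x + 1 / real (Suc k) * tent R x) powr (- q))) \<le> L"
    using GH_bound(2)[OF zero_X(1) _ tent_X(2)[OF R] tent_nonneg] unfolding H_def by auto
qed

lemma
  assumes \<phi>: "\<phi> \<in> X1" "\<And>x. 0 \<le> \<phi> x" and \<psi>: "\<psi> \<in> X2" "\<And>x. 0 \<le> \<psi> x"
  shows first_variation: "lam * Gs \<phi> + lam * Hs \<psi> + \<theta> / (\<alpha> + \<beta>) * T \<phi> \<psi> \<le> ell \<phi> \<psi>"
    and Gs_integrable_nonneg: "integrable lborel (\<lambda>x. a x * (\<phi> x * z x powr (- p)))"
    and Hs_integrable_nonneg: "integrable lborel (\<lambda>x. b x * (\<psi> x * w x powr (- q)))"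
proof -
  note st1 = singular_integrals_tendsto[OF a_borel z_borel F1.borel_potentialD(1)[OF \<phi>(1)] a_pos z_nonneg z_pos \<phi>(2) p_pos
      G_integrable[OF \<phi>] GH_bound(1)[OF \<phi> \<psi>, unfolded G_def]]
  note st2 = singular_integrals_tendsto[OF b_borel w_borel F2.borel_potentialD(1)[OF \<psi>(1)] b_pos w_nonneg w_pos \<psi>(2) q0
      H_integrable[OF \<psi>] GH_bound(2)[OF \<phi> \<psi>, unfolded H_def]]
  show "integrable lborel (\<lambda>x. a x * (\<phi> x * z x powr (- p)))" by (rule st1(1))
  show "integrable lborel (\<lambda>x. b x * (\<psi> x * w x powr (- q)))" by (rule st2(1))
  have "(\<lambda>k. lam * G k \<phi> + lam * H k \<psi> + \<theta> / (\<alpha> + \<beta>) * T \<phi> \<psi>) \<longlonglongrightarrow> lam * Gs \<phi> + lam * Hs \<psi> + \<theta> / (\<alpha> + \<beta>) * T \<phi> \<psi>"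
    unfolding G_def H_def Gs_def Hs_def by (intro tendsto_intros st1(2) st2(2))
  then show "lam * Gs \<phi> + lam * Hs \<psi> + \<theta> / (\<alpha> + \<beta>) * T \<phi> \<psi> \<le> ell \<phi> \<psi>"
    by (rule LIMSEQ_le_const2) (use first_variation_approx[OF \<phi> \<psi>] in auto)
qed

lemma Gs_integrable:
  assumes \<phi>: "\<phi> \<in> X1"
  shows "integrable lborel (\<lambda>x. a x * (\<phi> x * z x powr (- p)))"
proof (rule Bochner_Integration.integrable_bound)
  note [measurable] = F1.borel_potentialD(1)[OF \<phi>]
  show "integrable lborel (\<lambda>x. a x * (\<bar>\<phi> x\<bar> * z x powr (- p)))"
    by (rule Gs_integrable_nonneg[OF F1.borel_potential_abs[OF \<phi>] _ zero_X(2)]) auto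
  show "AE x in lborel. norm (a x * (\<phi> x * z x powr (- p))) \<le> norm (a x * (\<bar>\<phi> x\<bar> * z x powr (- p)))"
    by (simp add: abs_mult)
  show "(\<lambda>x. a x * (\<phi> x * z x powr (- p))) \<in> borel_measurable lborel" by measurable
qed

lemma Hs_integrable:
  assumes \<psi>: "\<psi> \<in> X2"
  shows "integrable lborel (\<lambda>x. b x * (\<psi> x * w x powr (- q)))"
proof (rule Bochner_Integration.integrable_bound)
  note [measurable] = F2.borel_potentialD(1)[OF \<psi>]
  show "integrable lborel (\<lambda>x. b x * (\<bar>\<psi> x\<bar> * w x powr (- q)))"
    by (rule Hs_integrable_nonneg[OF zero_X(1) _ F2.borel_potential_abs[OF \<psi>]]) auto
  show "AE x in lborel. norm (b x * (\<psi> x * w x powr (- q))) \<le> norm (b x * (\<bar>\<psi> x\<bar> * w x powr (- q)))"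
    by (simp add: abs_mult)
  show "(\<lambda>x. b x * (\<psi> x * w x powr (- q))) \<in> borel_measurable lborel" by measurable
qed

text \<open>Formally the derivative of \<open>J\<close> at the minimizer. Since the singular terms
  are integrable against all test functions, it is a linear functional, and sign changes of the test
  pair can turn an inequality into an equation.\<close>

definition "dJ \<phi> \<psi> = ell \<phi> \<psi> - \<theta> / (\<alpha> + \<beta>) * T \<phi> \<psi> - lam * (Gs \<phi> + Hs \<psi>)"

lemma dJ_nonneg:
  assumes "\<phi> \<in> X1" "\<And>x. 0 \<le> \<phi> x" "\<psi> \<in> X2" "\<And>x. 0 \<le> \<psi> x"
  shows "0 \<le> dJ \<phi> \<psi>"
  using first_variation[OF assms] by (simp add: dJ_def distrib_left)

lemma dJ_lincomb:
  assumes \<phi>: "\<phi> \<in> X1" "\<phi>' \<in> X1" and \<psi>: "\<psi> \<in> X2" "\<psi>' \<in> X2"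
  shows "dJ (\<lambda>x. c * \<phi> x + d * \<phi>' x) (\<lambda>x. c * \<psi> x + d * \<psi>' x) = c * dJ \<phi> \<psi> + d * dJ \<phi>' \<psi>'"
proof -
  have 1: "ell (\<lambda>x. c * \<phi> x + d * \<phi>' x) (\<lambda>x. c * \<psi> x + d * \<psi>' x) = c * ell \<phi> \<psi> + d * ell \<phi>' \<psi>'"
    by (simp add: ell_def F1.sobolev_form_lincomb_right[OF \<phi> zX] F2.sobolev_form_lincomb_right[OF \<psi> wX] algebra_simps)
  have "(\<lambda>x. a x * ((c * \<phi> x + d * \<phi>' x) * z x powr (- p))) = (\<lambda>x. c * (a x * (\<phi> x * z x powr (- p))) + d * (a x * (\<phi>' x * z x powr (- p))))"
    by (auto simp: algebra_simps)
  then have 2: "Gs (\<lambda>x. c * \<phi> x + d * \<phi>' x) = c * Gs \<phi> + d * Gs \<phi>'"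
    unfolding Gs_def using Gs_integrable[OF \<phi>(1)] Gs_integrable[OF \<phi>(2)] by simp
  have "(\<lambda>x. b x * ((c * \<psi> x + d * \<psi>' x) * w x powr (- q))) = (\<lambda>x. c * (b x * (\<psi> x * w x powr (- q))) + d * (b x * (\<psi>' x * w x powr (- q))))"
    by (auto simp: algebra_simps)
  then have 3: "Hs (\<lambda>x. c * \<psi> x + d * \<psi>' x) = c * Hs \<psi> + d * Hs \<psi>'"
    unfolding Hs_def using Hs_integrable[OF \<psi>(1)] Hs_integrable[OF \<psi>(2)] by simp
  have "coupling_test \<alpha> \<beta> z w (\<lambda>x. c * \<phi> x + d * \<phi>' x) (\<lambda>x. c * \<psi> x + d * \<psi>' x) = (\<lambda>x. c * coupling_test \<alpha> \<beta> z w \<phi> \<psi> x + d * coupling_test \<alpha> \<beta> z w \<phi>' \<psi>' x)"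
    by (auto simp: coupling_test_def algebra_simps)
  then have 4: "T (\<lambda>x. c * \<phi> x + d * \<phi>' x) (\<lambda>x. c * \<psi> x + d * \<psi>' x) = c * T \<phi> \<psi> + d * T \<phi>' \<psi>'"
    unfolding T_def using coupling_test_integrable[OF \<phi>(1) \<psi>(1)] coupling_test_integrable[OF \<phi>(2) \<psi>(2)] by simp
  show ?thesis unfolding dJ_def 1 2 3 4 by (simp add: algebra_simps)
qed

text \<open>The Nehari identity: tested against the minimizer itself, the integrals become
  \<open>A z\<close>, \<open>B w\<close> and \<open>(\<alpha> + \<beta>) * C z w\<close>. It removes
  the term of order 0 from \<open>dJ_ge_zero\<close>.\<close>

lemma dJ_self: "dJ z w = 0"
proof -
  have "Gs z = A z"
    unfolding Gs_def singular_integral_def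
    by (intro Bochner_Integration.integral_cong refl) (simp add: z_nonneg powr_mult_base)
  moreover have "Hs w = B w"
    unfolding Hs_def singular_integral_def
    by (intro Bochner_Integration.integral_cong refl) (simp add: w_nonneg powr_mult_base)
  moreover have "T z w = (\<alpha> + \<beta>) * C z w"
  proof -
    have "coupling_test \<alpha> \<beta> z w z w x = (\<alpha> + \<beta>) * (\<bar>z x\<bar> powr \<alpha> * \<bar>w x\<bar> powr \<beta>)" for x
    proof -
      have "z x powr (\<alpha> - 1) * z x = z x powr \<alpha>" "w x powr (\<beta> - 1) * w x = w x powr \<beta>"
        using powr_mult_base[OF z_nonneg[of x], of "\<alpha> - 1"] powr_mult_base[OF w_nonneg[of x], of "\<beta> - 1"]
        by (simp_all add: mult.commute)
      then have "\<alpha> * (z x powr (\<alpha> - 1) * z x) * w x powr \<beta> + \<beta> * z x powr \<alpha> * (w x powr (\<beta> - 1) * w x) = (\<alpha> + \<beta>) * (z x powr \<alpha> * w x powr \<beta>)"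
        by (simp add: algebra_simps)
      then show ?thesis using z_nonneg[of x] w_nonneg[of x] by (simp add: coupling_test_def mult.assoc)
    qed
    then have "coupling_test \<alpha> \<beta> z w z w = (\<lambda>x. (\<alpha> + \<beta>) * (\<bar>z x\<bar> powr \<alpha> * \<bar>w x\<bar> powr \<beta>))" by (rule ext)
    then show ?thesis unfolding T_def coupling_integral_def by simp
  qed
  moreover have "ell z w = norm_square z w" by (simp add: ell_def norm_square_def)
  ultimately have "dJ z w = norm_square z w - \<theta> / (\<alpha> + \<beta>) * ((\<alpha> + \<beta>) * C z w) - lam * (A z + B w)"
    by (simp only: dJ_def)
  also have "\<theta> / (\<alpha> + \<beta>) * ((\<alpha> + \<beta>) * C z w) = \<theta> * C z w" using r2 by simp
  finally show ?thesis using minus_pairD(3)[OF zw] by (simp add: distrib_left)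
qed

text \<open>With \<open>u = z + e * \<phi>\<close>, and likewise in the second component,
  \<open>dJ\<close> of the positive parts is \<open>e * dJ \<phi> \<psi>\<close> plus
  \<open>dJ\<close> of the negative parts. In the latter the singular and coupling terms enter with
  a minus sign and are dropped; only the quadratic form remains, which is \<open>o(e)\<close> by
  \<open>negative_part_remainder\<close>.\<close>

lemma dJ_ge_zero:
  assumes \<phi>: "\<phi> \<in> X1" and \<psi>: "\<psi> \<in> X2"
  shows "0 \<le> dJ \<phi> \<psi>"
proof -
  define e where "e k = 1 / real (Suc k)" for k
  have e: "0 < e k" for k by (simp add: e_def)
  obtain \<rho>1 :: "nat \<Rightarrow> real" where \<rho>1: "\<rho>1 \<longlonglongrightarrow> 0" "\<And>k. sobolev_form s V1 z (\<lambda>x. max 0 (- (z x + e k * \<phi> x))) \<le> e k * \<rho>1 k"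
    unfolding e_def by (rule F1.negative_part_remainder[OF zX \<phi> z_pos]) blast
  obtain \<rho>2 :: "nat \<Rightarrow> real" where \<rho>2: "\<rho>2 \<longlonglongrightarrow> 0" "\<And>k. sobolev_form s V2 w (\<lambda>x. max 0 (- (w x + e k * \<psi> x))) \<le> e k * \<rho>2 k"
    unfolding e_def by (rule F2.negative_part_remainder[OF wX \<psi> w_pos]) blast
  have "0 \<le> dJ \<phi> \<psi> + (\<rho>1 k + \<rho>2 k)" for k
  proof -
    define u where "u x = z x + e k * \<phi> x" for x
    define v where "v x = w x + e k * \<psi> x" for x
    define M where "M x = max 0 (- u x)" for x
    define N where "N x = max 0 (- v x)" for x
    have u: "u \<in> X1" and v: "v \<in> X2"
      using F1.borel_potential_lincomb[OF zX \<phi>, of 1 "e k"] F2.borel_potential_lincomb[OF wX \<psi>, of 1 "e k"]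
      by (simp_all add: u_def[abs_def] v_def[abs_def])
    have M: "M \<in> X1" and N: "N \<in> X2"
      unfolding M_def[abs_def] N_def[abs_def] by (rule F1.borel_potential_neg[OF u] F2.borel_potential_neg[OF v])+
    have MN0: "0 \<le> M x" "0 \<le> N x" for x by (simp_all add: M_def N_def)
    have posu: "(\<lambda>x. max 0 (u x)) = (\<lambda>x. 1 * u x + 1 * M x)" by (auto simp: M_def max_def)
    have posv: "(\<lambda>x. max 0 (v x)) = (\<lambda>x. 1 * v x + 1 * N x)" by (auto simp: N_def max_def)
    have "0 \<le> dJ (\<lambda>x. max 0 (u x)) (\<lambda>x. max 0 (v x))"
      by (intro dJ_nonneg F1.borel_potential_pos[OF u] F2.borel_potential_pos[OF v]) auto
    also have "\<dots> = dJ u v + dJ M N"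
      unfolding posu posv using dJ_lincomb[OF u M v N, of 1 1] by simp
    also have "dJ u v = e k * dJ \<phi> \<psi>"
      using dJ_lincomb[OF zX \<phi> wX \<psi>, of 1 "e k"] by (simp add: u_def[abs_def] v_def[abs_def] dJ_self)
    also have "dJ M N \<le> e k * (\<rho>1 k + \<rho>2 k)"
    proof -
      have "0 \<le> Gs M" "0 \<le> Hs N"
        unfolding Gs_def Hs_def using a_pos b_pos MN0
        by (auto simp: less_imp_le intro!: Bochner_Integration.integral_nonneg mult_nonneg_nonneg)
      then have "0 \<le> lam * (Gs M + Hs N)" using lam_pos by simp
      moreover have "0 \<le> \<theta> / (\<alpha> + \<beta>) * T M N" using T_nonneg[OF MN0] \<theta>_pos r2 by simp
      moreover have "ell M N \<le> e k * \<rho>1 k + e k * \<rho>2 k"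
        using \<rho>1(2)[of k] \<rho>2(2)[of k] by (simp add: ell_def M_def[abs_def] N_def[abs_def] u_def v_def)
      ultimately show ?thesis by (simp add: dJ_def distrib_left)
    qed
    finally have "0 \<le> e k * (dJ \<phi> \<psi> + (\<rho>1 k + \<rho>2 k))" by (simp add: distrib_left)
    then show ?thesis using e[of k] by (simp add: zero_le_mult_iff)
  qed
  moreover have "(\<lambda>k. dJ \<phi> \<psi> + (\<rho>1 k + \<rho>2 k)) \<longlonglongrightarrow> dJ \<phi> \<psi> + (0 + 0)"
    by (intro tendsto_intros \<rho>1 \<rho>2)
  ultimately have "0 \<le> dJ \<phi> \<psi> + (0 + 0)"
    by (intro LIMSEQ_le_const) auto
  then show ?thesis by simp
qed

text \<open>A linear functional that is nonnegative on a vector space vanishes.\<close>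

theorem euler_lagrange:
  assumes \<phi>: "\<phi> \<in> X1" and \<psi>: "\<psi> \<in> X2"
  shows "ell \<phi> \<psi> - \<theta> / (\<alpha> + \<beta>) * T \<phi> \<psi> - lam * (Gs \<phi> + Hs \<psi>) = 0"
proof -
  have "0 \<le> dJ (\<lambda>x. - 1 * \<phi> x + 0 * \<phi> x) (\<lambda>x. - 1 * \<psi> x + 0 * \<psi> x)"
    by (rule dJ_ge_zero[OF F1.borel_potential_lincomb[OF \<phi> \<phi>] F2.borel_potential_lincomb[OF \<psi> \<psi>]])
  then have "dJ \<phi> \<psi> \<le> 0" unfolding dJ_lincomb[OF \<phi> \<phi> \<psi> \<psi>] by simp
  then show ?thesis using dJ_ge_zero[OF \<phi> \<psi>] by (simp add: dJ_def)
qed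

lemma energy_pos:
  assumes "t > 0" "0 < energy_along z w t"
  shows "0 < J z w"
  using fibre_energy_le_one_if_nonneg[of "A z" "B w" "C z w" "norm_square z w" t] assms zw minus_pairD(6)[OF zw]
  by (simp add: minus_pair_def J_def)

lemma energy_nonneg:
  assumes "\<And>e. e > 0 \<Longrightarrow> \<exists>t>0. 0 < energy_along z w t + e * (t powr (1 - p) * A z / (1 - p) + t powr (1 - q) * B w / (1 - q))"
  shows "0 \<le> J z w"
  unfolding J_def
  using zw minus_pairD(5,6)[OF zw] by (intro fibre_energy_one_nonneg A_pos[OF zX wX] B_nonneg assms) (auto simp: minus_pair_def)

lemma energy_neg:
  assumes "u \<in> X1" "v \<in> X2" "0 < C u v" "\<And>t. t > 0 \<Longrightarrow> energy_along u v t < 0"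
  shows "J z w < 0"
proof -
  obtain t where t: "0 < t" "minus_pair (\<lambda>x. t * u x) (\<lambda>x. t * v x)"
    using project_to_minus_pair[OF assms(1-3)] by blast
  have "J z w \<le> J (\<lambda>x. t * u x) (\<lambda>x. t * v x)" by (rule minimal[OF t(2)])
  also have "\<dots> < 0" unfolding J_scale[OF assms(1,2) t(1)] by (rule assms(4)[OF t(1)])
  finally show ?thesis .
qed

text \<open>Projecting the given pair produces a competitor with \<open>J\<close> at most
  \<open>e * (K1 + norm_square)\<close>. Its norm is not controlled by the assumption, but
  coercivity bounds it uniformly in small \<open>e\<close>, so \<open>e\<close> may tend to
  0.\<close>

lemma energy_nonpos:
  assumes "\<And>e. e > 0 \<Longrightarrow> \<exists>u v. u \<in> X1 \<and> v \<in> X2 \<and> 0 < C u v \<and>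
    (\<forall>t>0. energy_along u v t \<le> e * (t powr (1 - p) * A u / (1 - p) + t powr (1 - q) * B v / (1 - q)))"
  shows "J z w \<le> 0"
proof -
  obtain c K where cK: "0 < c" "0 \<le> K" "\<And>u v. minus_pair u v \<Longrightarrow> c * norm_square u v \<le> J u v + K"
    by (rule minus_pair_coercive) blast
  obtain K1 where K1: "0 \<le> K1" "\<And>u v. u \<in> X1 \<Longrightarrow> v \<in> X2 \<Longrightarrow> A u / (1 - p) + B v / (1 - q) \<le> K1 + 1 * norm_square u v"
    using singular_integral_small[of 1] by (metis zero_less_one)
  \<comment> \<open>For \<open>e < c / 2\<close> half of the coercive term absorbs
    \<open>e * norm_square\<close>; the second summand is the bound on the norm that the other half
    leaves.\<close>
  define M where "M = K1 + (c / 2 * K1 + K) / (c / 2)"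
  have "J z w \<le> e * M" if e: "0 < e" "e < c / 2" for e
  proof -
    obtain u v where uv: "u \<in> X1" "v \<in> X2" "0 < C u v"
      and le: "\<And>t. t > 0 \<Longrightarrow> energy_along u v t \<le> e * (t powr (1 - p) * A u / (1 - p) + t powr (1 - q) * B v / (1 - q))"
      using assms[OF e(1)] by blast
    obtain t where t: "0 < t" "minus_pair (\<lambda>x. t * u x) (\<lambda>x. t * v x)"
      using project_to_minus_pair[OF uv] by blast
    let ?u = "\<lambda>x. t * u x" and ?v = "\<lambda>x. t * v x"
    have "J ?u ?v \<le> e * (A ?u / (1 - p) + B ?v / (1 - q))"
      using le[OF t(1)] by (simp add: J_scale[OF uv(1,2) t(1)] singular_integral_scale[OF t(1)])
    also have "\<dots> \<le> e * (K1 + 1 * norm_square ?u ?v)"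
      using K1(2)[OF minus_pairD(1,2)[OF t(2)]] e by (intro mult_left_mono) auto
    finally have J: "J ?u ?v \<le> e * (K1 + norm_square ?u ?v)" by simp
    also have "\<dots> \<le> c / 2 * (K1 + norm_square ?u ?v)"
      using e K1(1) minus_pairD(6)[OF t(2)] by (intro mult_right_mono) auto
    finally have "c * norm_square ?u ?v \<le> c / 2 * K1 + c / 2 * norm_square ?u ?v + K"
      using cK(3)[OF t(2)] by (simp add: distrib_left)
    then have "norm_square ?u ?v \<le> (c / 2 * K1 + K) / (c / 2)" using cK(1) by (simp add: field_simps)
    then have "e * (K1 + norm_square ?u ?v) \<le> e * M" using e by (intro mult_left_mono) (auto simp: M_def)
    with J minimal[OF t(2)] show ?thesis by linarith
  qed
  then have ev: "\<forall>\<^sub>F e in at_right 0. J z w \<le> e * M"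
    using cK(1) by (intro eventually_at_rightI[of 0 "c / 2"]) auto
  have "((\<lambda>e. e * M) \<longlongrightarrow> 0 * M) (at_right (0::real))" by (intro tendsto_intros)
  then have "J z w \<le> 0 * M" by (rule tendsto_lowerbound) (use ev in auto)
  then show ?thesis by simp
qed

end

section \<open>Transfer to Lebesgue measurable functions\<close>

text \<open>Infinite values are confined to a null set, so both parts of the extended integral are
  those of an integrable real function.\<close>

lemma ext_integral_eq_borel:
  fixes f :: "'a::euclidean_space \<Rightarrow> ereal" and g :: "'a \<Rightarrow> real"
  assumes g: "integrable lborel g" and ae: "AE x in lborel. f x = ereal (g x)"
  shows "ext_integrable lebesgue f" "ext_integral lebesgue f = integral\<^sup>L lborel g"
proof -
  have [measurable]: "g \<in> borel_measurable lborel" using g by simp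
  have "(\<lambda>x. ereal (g x)) \<in> borel_measurable lborel" by measurable
  then have "(\<lambda>x. ereal (g x)) \<in> borel_measurable lebesgue" by (rule measurable_completion)
  then have meas: "f \<in> borel_measurable lebesgue" by (rule measurable_completion_AE[OF _ ae]) simp
  have cong: "(\<integral>\<^sup>+x. h (f x) \<partial>lebesgue) = (\<integral>\<^sup>+x. h (ereal (g x)) \<partial>lborel)" for h :: "ereal \<Rightarrow> ennreal"
  proof -
    have "(\<integral>\<^sup>+x. h (f x) \<partial>lebesgue) = (\<integral>\<^sup>+x. h (f x) \<partial>lborel)" by (rule nn_integral_completion)
    also have "\<dots> = (\<integral>\<^sup>+x. h (ereal (g x)) \<partial>lborel)"
      by (rule nn_integral_cong_AE) (use ae in eventually_elim, simp)
    finally show ?thesis .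
  qed
  show "ext_integrable lebesgue f"
    unfolding ext_integrable_def
  proof
    have "(\<integral>\<^sup>+x. e2ennreal \<bar>f x\<bar> \<partial>lebesgue) = (\<integral>\<^sup>+x. ennreal (norm (g x)) \<partial>lborel)"
      using cong[of "\<lambda>y. e2ennreal \<bar>y\<bar>"] by simp
    then show "(\<integral>\<^sup>+x. e2ennreal \<bar>f x\<bar> \<partial>lebesgue) < \<infinity>"
      using g by (simp add: integrable_iff_bounded)
  qed (fact meas)
  show "ext_integral lebesgue f = integral\<^sup>L lborel g"
    unfolding ext_integral_def real_lebesgue_integral_def[OF g]
    using cong[of e2ennreal] cong[of "\<lambda>y. e2ennreal (- y)"] by simp
qed

lemma sing_int_eq_borel:
  fixes a u a' u' :: "('n::finite) fn"
  assumes [measurable]: "a' \<in> borel_measurable borel" "u' \<in> borel_measurable borel"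
    and "AE x in lborel. a x = a' x" "AE x in lborel. u x = u' x"
  shows "sing_int a p u = singular_integral a' p u'"
proof -
  have "AE x in lborel. a x * \<bar>u x\<bar> powr (1 - p) = a' x * \<bar>u' x\<bar> powr (1 - p)"
    using assms(3,4) by eventually_elim simp
  then show ?thesis
    unfolding sing_int_def singular_integral_def by (intro lebesgue_integral_eq_borel(2)) measurable
qed

lemma coupling_int_eq_borel:
  fixes u v u' v' :: "('n::finite) fn"
  assumes [measurable]: "u' \<in> borel_measurable borel" "v' \<in> borel_measurable borel"
    and "AE x in lborel. u x = u' x" "AE x in lborel. v x = v' x"
  shows "coupling_int \<alpha> \<beta> (u, v) = coupling_integral \<alpha> \<beta> u' v'"
proof -
  have "AE x in lborel. \<bar>u x\<bar> powr \<alpha> * \<bar>v x\<bar> powr \<beta> = \<bar>u' x\<bar> powr \<alpha> * \<bar>v' x\<bar> powr \<beta>"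
    using assms(3,4) by eventually_elim simp
  then show ?thesis
    unfolding coupling_int_def coupling_integral_def prod.case by (intro lebesgue_integral_eq_borel(2)) measurable
qed

section \<open>Pairs of functions and their Borel representatives\<close>

locale two_potentials = F1: positive_potential s V0 V1 + F2: positive_potential s V0 V2 for s V0 :: real and V1 V2 :: "('n::finite) fn"
begin

lemma X_inner_eq_borel:
  assumes u: "u' \<in> borel_potential s V1" "AE x in lborel. u x = u' x" and v: "v' \<in> borel_potential s V2" "AE x in lborel. v x = v' x"
    and \<phi>: "\<phi>' \<in> borel_potential s V1" "AE x in lborel. \<phi> x = \<phi>' x" and \<psi>: "\<psi>' \<in> borel_potential s V2" "AE x in lborel. \<psi> x = \<psi>' x"
  shows "integrable lebesgue (X_gagliardo_integrand s (u, v) (\<phi>, \<psi>))"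
    "integrable lebesgue (X_potential_integrand V1 V2 (u, v) (\<phi>, \<psi>))"
    "X_inner s V1 V2 (u, v) (\<phi>, \<psi>) = sobolev_form s V1 u' \<phi>' + sobolev_form s V2 v' \<psi>'"
proof -
  note [measurable] = F1.borel_potentialD(1)[OF u(1)] F1.borel_potentialD(1)[OF \<phi>(1)] F2.borel_potentialD(1)[OF v(1)] F2.borel_potentialD(1)[OF \<psi>(1)]
  have eq: "X_gagliardo_integrand s (u, v) (\<phi>, \<psi>) z = gagliardo s u \<phi> z + gagliardo s v \<psi> z" for z
    by (cases z) (simp add: X_gagliardo_integrand_def gagliardo_def add_divide_distrib)
  have g: "AE z in lborel. X_gagliardo_integrand s (u, v) (\<phi>, \<psi>) z = gagliardo s u' \<phi>' z + gagliardo s v' \<psi>' z"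
    using AE_gagliardo_eq[OF u(2) \<phi>(2), of s] AE_gagliardo_eq[OF v(2) \<psi>(2), of s] by eventually_elim (simp add: eq)
  have gm: "(\<lambda>z. gagliardo s u' \<phi>' z + gagliardo s v' \<psi>' z) \<in> borel_measurable borel" by measurable
  have gi: "integrable lborel (\<lambda>z. gagliardo s u' \<phi>' z + gagliardo s v' \<psi>' z)"
    using F1.gagliardo_integrable[OF u(1) \<phi>(1)] F2.gagliardo_integrable[OF v(1) \<psi>(1)] by simp
  note G = lebesgue_integral_eq_borel[OF gm g]
  have h: "AE x in lborel. X_potential_integrand V1 V2 (u, v) (\<phi>, \<psi>) x = V1 x * u' x * \<phi>' x + V2 x * v' x * \<psi>' x"
    using u(2) v(2) \<phi>(2) \<psi>(2) by eventually_elim (simp add: X_potential_integrand_def)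
  have hm: "(\<lambda>x. V1 x * u' x * \<phi>' x + V2 x * v' x * \<psi>' x) \<in> borel_measurable borel" by measurable
  have hi: "integrable lborel (\<lambda>x. V1 x * u' x * \<phi>' x + V2 x * v' x * \<psi>' x)"
    using F1.potential_integrable[OF u(1) \<phi>(1)] F2.potential_integrable[OF v(1) \<psi>(1)] by simp
  note H = lebesgue_integral_eq_borel[OF hm h]
  show "integrable lebesgue (X_gagliardo_integrand s (u, v) (\<phi>, \<psi>))" using G(1) gi by simp
  show "integrable lebesgue (X_potential_integrand V1 V2 (u, v) (\<phi>, \<psi>))" using H(1) hi by simp
  show "X_inner s V1 V2 (u, v) (\<phi>, \<psi>) = sobolev_form s V1 u' \<phi>' + sobolev_form s V2 v' \<psi>'"
    unfolding X_inner_def G(2) H(2) sobolev_form_def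
    using F1.gagliardo_integrable[OF u(1) \<phi>(1)] F2.gagliardo_integrable[OF v(1) \<psi>(1)]
      F1.potential_integrable[OF u(1) \<phi>(1)] F2.potential_integrable[OF v(1) \<psi>(1)] by simp
qed

lemma X_norm_eq_borel:
  assumes u: "u' \<in> borel_potential s V1" "AE x in lborel. u x = u' x" and v: "v' \<in> borel_potential s V2" "AE x in lborel. v x = v' x"
  shows "(X_norm s V1 V2 (u, v))\<^sup>2 = sobolev_form s V1 u' u' + sobolev_form s V2 v' v'"
proof -
  have "X_inner s V1 V2 (u, v) (u, v) = sobolev_form s V1 u' u' + sobolev_form s V2 v' v'"
    by (rule X_inner_eq_borel(3)[OF u v u v])
  then show ?thesis
    using F1.sobolev_form_self_ge(4)[OF u(1)] F2.sobolev_form_self_ge(4)[OF v(1)] by (simp add: X_norm_def)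
qed

lemma X_space_representative:
  assumes "(u, v) \<in> X_space s V1 V2"
  obtains u' v' where "u' \<in> borel_potential s V1" "AE x in lborel. u x = u' x" "v' \<in> borel_potential s V2" "AE x in lborel. v x = v' x"
proof -
  have "u \<in> potential_space s V1" "v \<in> potential_space s V2"
    using assms by (auto simp: X_space_def)
  then show ?thesis
    using F1.potential_space_representative F2.potential_space_representative that by metis
qed

lemma scaled_functionals:
  assumes u: "u' \<in> borel_potential s V1" "AE x in lborel. u x = u' x" and v: "v' \<in> borel_potential s V2" "AE x in lborel. v x = v' x"
    and a: "a' \<in> borel_measurable borel" "AE x in lborel. a x = a' x"
    and b: "b' \<in> borel_measurable borel" "AE x in lborel. b x = b' x" and t: "0 < t"
  shows "(X_norm s V1 V2 (\<lambda>x. t * u x, \<lambda>x. t * v x))\<^sup>2 = t\<^sup>2 * (sobolev_form s V1 u' u' + sobolev_form s V2 v' v')"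
    "sing_int a p (\<lambda>x. t * u x) = t powr (1 - p) * singular_integral a' p u'"
    "sing_int b q (\<lambda>x. t * v x) = t powr (1 - q) * singular_integral b' q v'"
    "coupling_int \<alpha> \<beta> (\<lambda>x. t * u x, \<lambda>x. t * v x) = t powr (\<alpha> + \<beta>) * coupling_integral \<alpha> \<beta> u' v'"
proof -
  have tu: "AE x in lborel. t * u x = t * u' x" using u(2) by eventually_elim simp
  have tv: "AE x in lborel. t * v x = t * v' x" using v(2) by eventually_elim simp
  note tu' = F1.borel_potential_scale[OF u(1), of t] and tv' = F2.borel_potential_scale[OF v(1), of t]
  show "(X_norm s V1 V2 (\<lambda>x. t * u x, \<lambda>x. t * v x))\<^sup>2 = t\<^sup>2 * (sobolev_form s V1 u' u' + sobolev_form s V2 v' v')"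
    using X_norm_eq_borel[OF tu' tu tv' tv]
    by (simp add: F1.sobolev_form_scale_scale[OF u(1)] F2.sobolev_form_scale_scale[OF v(1)] distrib_left)
  show "sing_int a p (\<lambda>x. t * u x) = t powr (1 - p) * singular_integral a' p u'"
    using sing_int_eq_borel[OF a(1) F1.borel_potentialD(1)[OF tu'] a(2) tu] by (simp add: singular_integral_scale[OF t])
  show "sing_int b q (\<lambda>x. t * v x) = t powr (1 - q) * singular_integral b' q v'"
    using sing_int_eq_borel[OF b(1) F2.borel_potentialD(1)[OF tv'] b(2) tv] by (simp add: singular_integral_scale[OF t])
  show "coupling_int \<alpha> \<beta> (\<lambda>x. t * u x, \<lambda>x. t * v x) = t powr (\<alpha> + \<beta>) * coupling_integral \<alpha> \<beta> u' v'"
    using coupling_int_eq_borel[OF F1.borel_potentialD(1)[OF tu'] F2.borel_potentialD(1)[OF tv'] tu tv] by (simp add: coupling_integral_scale[OF t])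
qed

end

context fibering
begin

text \<open>The right side is \<open>energy'\<close> of the scaled pair, that is, the numerator of
  \<open>R_n\<close> minus \<open>lam\<close> times its denominator. This links the supremum in
  \<open>lambda_upper\<close> to the assumption \<open>extremal\<close>.\<close>

lemma square_fibre_slope:
  assumes "0 < t"
  shows "t\<^sup>2 * fibre_slope n A B C t = t\<^sup>2 * n - lam * (t powr (1 - p) * A) - lam * (t powr (1 - q) * B) - \<theta> * (t powr r * C)"
proof -
  have "t\<^sup>2 * t powr x = t powr (x + 2)" for x
    using assms by (simp add: powr_add powr_numeral mult.commute)
  from this[of "- 1 - p"] this[of "- 1 - q"] this[of "r - 2"]
  have "t\<^sup>2 * t powr (- 1 - p) = t powr (1 - p)" "t\<^sup>2 * t powr (- 1 - q) = t powr (1 - q)" "t\<^sup>2 * t powr (r - 2) = t powr r"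
    by simp_all
  moreover have "t\<^sup>2 * fibre_slope n A B C t = t\<^sup>2 * n - lam * ((t\<^sup>2 * t powr (- 1 - p)) * A) - lam * ((t\<^sup>2 * t powr (- 1 - q)) * B)
      - \<theta> * ((t\<^sup>2 * t powr (r - 2)) * C)"
    by (simp add: fibre_slope_def algebra_simps)
  ultimately show ?thesis by (simp only:)
qed

end

theorem theorem1p2:
  fixes s \<alpha> \<beta> p q \<theta> V0 lam :: real
    and a b V1 V2 :: "real ^ 'n \<Rightarrow> real"
  assumes s: "0 < s" "s < 1" and N: "real CARD('n) > 2 * s"
    and \<alpha>: "\<alpha> > 1" and \<beta>: "\<beta> > 1"
    and \<alpha>\<beta>: "2 < \<alpha> + \<beta>" "\<alpha> + \<beta> < 2 * real CARD('n) / (real CARD('n) - 2 * s)"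
    and pq: "0 < p" "p \<le> q" "q < 1"
    and \<theta>: "\<theta> > 0"
    and a: "in_Lp (2 / (1 + p)) a" "\<And>x. a x > 0"
    and b: "in_Lp (2 / (1 + q)) b" "\<And>x. b x > 0"
    and V_cont: "continuous_on UNIV V1" "continuous_on UNIV V2"
    and V0: "V0 > 0" "\<And>x. V1 x \<ge> V0" "\<And>x. V2 x \<ge> V0"
    and V_sublevel: "\<And>M. M > 0 \<Longrightarrow> emeasure lebesgue {x. V1 x \<le> M} < \<infinity>"
                    "\<And>M. M > 0 \<Longrightarrow> emeasure lebesgue {x. V2 x \<le> M} < \<infinity>"
    and lam: "0 < lam" "ereal lam < lambda_upper s V1 V2 a b p q \<alpha> \<beta> \<theta>"
  shows "\<exists>z w. weak_solution s V1 V2 a b p q \<alpha> \<beta> \<theta> lam (z, w) \<and>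
      (z, w) \<in> A_set s V1 V2 \<alpha> \<beta> \<and>
      energy'' s V1 V2 a b p q \<alpha> \<beta> \<theta> lam (z, w) < 0 \<and>
      (z, w) \<in> nehari_minus s V1 V2 a b p q \<alpha> \<beta> \<theta> lam \<inter> A_set s V1 V2 \<alpha> \<beta> \<and>
      nehari_minus s V1 V2 a b p q \<alpha> \<beta> \<theta> lam \<inter> A_set s V1 V2 \<alpha> \<beta> =
        nehari_minus s V1 V2 a b p q \<alpha> \<beta> \<theta> lam \<and>
      (ereal lam < lambda_lower s V1 V2 a b p q \<alpha> \<beta> \<theta> \<longrightarrow>
        energy s V1 V2 a b p q \<alpha> \<beta> \<theta> lam (z, w) > 0) \<and>
      (ereal lam = lambda_lower s V1 V2 a b p q \<alpha> \<beta> \<theta> \<longrightarrow>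
        energy s V1 V2 a b p q \<alpha> \<beta> \<theta> lam (z, w) = 0) \<and>
      (lambda_lower s V1 V2 a b p q \<alpha> \<beta> \<theta> < ereal lam \<longrightarrow>
        energy s V1 V2 a b p q \<alpha> \<beta> \<theta> lam (z, w) < 0)"
proof -
  have p1: "p < 1" and q0: "0 < q" using pq by auto
  have V_borel [measurable]: "V1 \<in> borel_measurable borel" "V2 \<in> borel_measurable borel"
    using V_cont by (auto intro: borel_measurable_continuous_onI)
  have sub1: "emeasure lborel {x. V1 x \<le> M} < \<infinity>" if "M > 0" for M
    using V_sublevel(1)[OF that] by simp
  have sub2: "emeasure lborel {x. V2 x \<le> M} < \<infinity>" if "M > 0" for M
    using V_sublevel(2)[OF that] by simp
  interpret F1: coercive_potential s V0 V1
    using V_borel V0 s sub1 by unfold_locales auto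
  interpret F2: coercive_potential s V0 V2
    using V_borel V0 s sub2 by unfold_locales auto
  interpret two_potentials s V0 V1 V2 by unfold_locales
  have borel_weight: "\<exists>f'. f' \<in> borel_measurable borel \<and> (AE x in lborel. f x = f' x) \<and> (\<forall>x. 0 < f' x) \<and> integrable lborel (\<lambda>x. f' x powr e)"
    if f: "in_Lp e f" "\<And>x. f x > 0" for f :: "'n fn" and e
  proof -
    obtain g where g: "g \<in> borel_measurable borel" "AE x in lborel. f x = g x"
      using lebesgue_ex_borel f(1) unfolding in_Lp_def by blast
    \<comment> \<open>The weight is positive everywhere, but a Borel representative only almost
      everywhere; the value 1 on the exceptional null set restores strict positivity.\<close>
    define f' where "f' x = (if 0 < g x then g x else 1)" for x
    have f'm [measurable]: "f' \<in> borel_measurable borel" unfolding f'_def using g(1) by measurable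
    have ae: "AE x in lborel. f x = f' x"
      using g(2)
    proof eventually_elim
      case (elim x)
      then show ?case using f(2)[of x] by (simp add: f'_def)
    qed
    then have "AE x in lborel. \<bar>f x\<bar> powr e = f' x powr e"
      by eventually_elim (simp add: f'_def less_imp_le)
    then have "integrable lborel (\<lambda>x. f' x powr e)"
      using f(1) lebesgue_integral_eq_borel(1)[of "\<lambda>x. f' x powr e"] unfolding in_Lp_def by simp
    moreover have "0 < f' x" for x by (simp add: f'_def)
    ultimately show ?thesis using ae f'm by blast
  qed
  obtain a' where a': "a' \<in> borel_measurable borel" "AE x in lborel. a x = a' x" "\<And>x. 0 < a' x" "integrable lborel (\<lambda>x. a' x powr (2 / (1 + p)))"
    using borel_weight[OF a] by blast
  obtain b' where b': "b' \<in> borel_measurable borel" "AE x in lborel. b x = b' x" "\<And>x. 0 < b' x" "integrable lborel (\<lambda>x. b' x powr (2 / (1 + q)))"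
    using borel_weight[OF b] by blast
  interpret F: fibering lam \<theta> p q "\<alpha> + \<beta>"
    using lam \<theta> pq \<alpha>\<beta> by unfold_locales auto
  have sf: "(X_norm s V1 V2 (\<lambda>x. t * u x, \<lambda>x. t * v x))\<^sup>2 = t\<^sup>2 * (sobolev_form s V1 u' u' + sobolev_form s V2 v' v')"
    "sing_int a p (\<lambda>x. t * u x) = t powr (1 - p) * singular_integral a' p u'"
    "sing_int b q (\<lambda>x. t * v x) = t powr (1 - q) * singular_integral b' q v'"
    "coupling_int \<alpha> \<beta> (\<lambda>x. t * u x, \<lambda>x. t * v x) = t powr (\<alpha> + \<beta>) * coupling_integral \<alpha> \<beta> u' v'"
    if "u' \<in> borel_potential s V1" "AE x in lborel. u x = u' x" "v' \<in> borel_potential s V2" "AE x in lborel. v x = v' x" "0 < t" for u v u' v' t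
    by (rule scaled_functionals[OF that(1-4) a'(1,2) b'(1,2) that(5)])+
  have A_setI: "(u, v) \<in> A_set s V1 V2 \<alpha> \<beta>" if "u \<in> borel_potential s V1" "v \<in> borel_potential s V2" "0 < coupling_integral \<alpha> \<beta> u v" for u v
    using that F1.borel_potential_potential_space F2.borel_potential_potential_space F1.borel_potentialD(1) F2.borel_potentialD(1)
    by (simp add: A_set_def X_space_def coupling_int_eq_borel[of u v u v])
  have refl_AE: "AE x in lborel. f x = f x" for f :: "'n fn" by simp
  have extremal: "\<exists>t>0. 0 < F.fibre_slope (sobolev_form s V1 u u + sobolev_form s V2 v v) (singular_integral a' p u) (singular_integral b' q v) (coupling_integral \<alpha> \<beta> u v) t"
    if uv: "u \<in> borel_potential s V1" "v \<in> borel_potential s V2" "0 < coupling_integral \<alpha> \<beta> u v" for u v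
  proof -
    let ?n = "sobolev_form s V1 u u + sobolev_form s V2 v v" and ?A = "singular_integral a' p u" and ?B = "singular_integral b' q v" and ?C = "coupling_integral \<alpha> \<beta> u v"
    have "ereal lam < (SUP t\<in>{0<..}. ereal (R_n s V1 V2 a b p q \<alpha> \<beta> \<theta> (\<lambda>x. t * u x, \<lambda>x. t * v x)))"
      using lam(2) INF_lower[OF A_setI[OF uv], of "\<lambda>(u, v). SUP t\<in>{0<..}. ereal (R_n s V1 V2 a b p q \<alpha> \<beta> \<theta> (\<lambda>x. t * u x, \<lambda>x. t * v x))"]
      unfolding lambda_upper_def by simp
    then obtain t where t: "0 < t" "lam < R_n s V1 V2 a b p q \<alpha> \<beta> \<theta> (\<lambda>x. t * u x, \<lambda>x. t * v x)"
      by (auto simp: less_SUP_iff)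
    let ?D = "t powr (1 - p) * ?A + t powr (1 - q) * ?B"
    have R: "R_n s V1 V2 a b p q \<alpha> \<beta> \<theta> (\<lambda>x. t * u x, \<lambda>x. t * v x) = (t\<^sup>2 * ?n - \<theta> * (t powr (\<alpha> + \<beta>) * ?C)) / ?D"
      unfolding R_n_def prod.case sf[OF uv(1) refl_AE uv(2) refl_AE t(1)] ..
    have "0 \<le> ?A" "0 \<le> ?B" using a'(3) b'(3) by (auto simp: less_imp_le intro!: singular_integral_nonneg)
    then have "0 \<le> ?D" by simp
    \<comment> \<open>With a zero denominator the quotient would be 0 by the convention for
      division, and could not exceed \<open>lam > 0\<close>.\<close>
    moreover have "?D \<noteq> 0" using t(2) lam(1) unfolding R by force
    ultimately have "0 < ?D" by linarith
    then have "lam * ?D < t\<^sup>2 * ?n - \<theta> * (t powr (\<alpha> + \<beta>) * ?C)"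
      using t(2) unfolding R by (simp add: pos_less_divide_eq)
    then have "0 < t\<^sup>2 * F.fibre_slope ?n ?A ?B ?C t"
      unfolding F.square_fibre_slope[OF t(1)] by (simp add: distrib_left)
    then show ?thesis using t(1) by (auto simp: zero_less_mult_iff)
  qed
  interpret S: singular_system lam \<theta> p q \<alpha> \<beta> s V0 V1 V2 a' b'
    using \<alpha> \<beta> s N \<alpha>\<beta> a' b' V_cont extremal by unfold_locales auto
  obtain z w where zw: "S.minus_pair z w" "\<And>x. 0 \<le> z x" "\<And>x. 0 \<le> w x" "\<And>u v. S.minus_pair u v \<Longrightarrow> S.J z w \<le> S.J u v"
    by (rule S.minimizer_exists) blast
  interpret M: nehari_minimizer lam \<theta> p q \<alpha> \<beta> s V0 V1 V2 a' b' z w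
    using zw by unfold_locales
  note zwD = S.minus_pairD[OF zw(1)]
  note zX = zwD(1) and wX = zwD(2)
  have eqs: "(X_norm s V1 V2 (z, w))\<^sup>2 = S.norm_square z w" "sing_int a p z = S.A z" "sing_int b q w = S.B w" "coupling_int \<alpha> \<beta> (z, w) = S.C z w"
    using sf[OF zX refl_AE wX refl_AE zero_less_one] by (simp_all add: S.norm_square_def)
  have X: "(z, w) \<in> X_space s V1 V2"
    using F1.borel_potential_potential_space[OF zX] F2.borel_potential_potential_space[OF wX] by (simp add: X_space_def)
  have inA: "(z, w) \<in> A_set s V1 V2 \<alpha> \<beta>"
    by (rule A_setI[OF zX wX zwD(5)])
  have e2: "energy'' s V1 V2 a b p q \<alpha> \<beta> \<theta> lam (z, w) < 0"
    using zwD(3,4) by (simp add: energy''_def eqs algebra_simps)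
  have e1: "energy' s V1 V2 a b p q \<alpha> \<beta> \<theta> lam (z, w) = 0"
    using zwD(3) by (simp add: energy'_def eqs)
  have "\<not> (AE x in lebesgue. z x = 0 \<and> w x = 0)"
  proof
    assume "AE x in lebesgue. z x = 0 \<and> w x = 0"
    then have "AE x in lborel. z x = 0 \<and> w x = 0" by (simp add: AE_completion_iff)
    then have "AE x in lborel. \<bar>z x\<bar> powr \<alpha> * \<bar>w x\<bar> powr \<beta> = 0" by eventually_elim simp
    then have "S.C z w = 0" unfolding coupling_integral_def by (rule integral_eq_zero_AE)
    then show False using zwD(5) by simp
  qed
  then have inN: "(z, w) \<in> nehari_minus s V1 V2 a b p q \<alpha> \<beta> \<theta> lam"
    using X e1 e2 by (simp add: nehari_minus_def nehari_def)
  \<comment> \<open>The elimination behind \<open>minus_pairD\<close>, carried out directly for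
    Lebesgue measurable pairs: subtracting \<open>energy'\<close> twice from \<open>energy''\<close>
    removes the norm.\<close>
  have sub: "nehari_minus s V1 V2 a b p q \<alpha> \<beta> \<theta> lam \<subseteq> A_set s V1 V2 \<alpha> \<beta>"
  proof (clarify)
    fix u v assume uv: "(u, v) \<in> nehari_minus s V1 V2 a b p q \<alpha> \<beta> \<theta> lam"
    have norm_square: "0 \<le> sing_int a p u" "0 \<le> sing_int b q v"
      unfolding sing_int_def using a(2) b(2) by (auto simp: less_imp_le intro!: Bochner_Integration.integral_nonneg)
    have "energy' s V1 V2 a b p q \<alpha> \<beta> \<theta> lam (u, v) = 0" "energy'' s V1 V2 a b p q \<alpha> \<beta> \<theta> lam (u, v) < 0"
      using uv by (auto simp: nehari_minus_def nehari_def)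
    then have "lam * (1 + p) * sing_int a p u + lam * (1 + q) * sing_int b q v < \<theta> * (\<alpha> + \<beta> - 2) * coupling_int \<alpha> \<beta> (u, v)"
      by (simp add: energy'_def energy''_def algebra_simps)
    moreover have "0 \<le> lam * (1 + p) * sing_int a p u + lam * (1 + q) * sing_int b q v"
      using norm_square lam(1) pq q0 by simp
    ultimately have "0 < \<theta> * (\<alpha> + \<beta> - 2) * coupling_int \<alpha> \<beta> (u, v)" by linarith
    moreover have "0 < \<theta> * (\<alpha> + \<beta> - 2)" using \<theta> \<alpha>\<beta>(1) by simp
    ultimately have "0 < coupling_int \<alpha> \<beta> (u, v)" by (rule zero_less_mult_pos)
    then show "(u, v) \<in> A_set s V1 V2 \<alpha> \<beta>" using uv by (auto simp: A_set_def nehari_minus_def nehari_def)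
  qed
  have E: "energy s V1 V2 a b p q \<alpha> \<beta> \<theta> lam (z, w) = S.J z w"
    by (simp add: energy_def S.J_def F.fibre_energy_def eqs)
  have weak: "weak_solution s V1 V2 a b p q \<alpha> \<beta> \<theta> lam (z, w)"
    unfolding weak_solution_def prod.case
  proof (intro conjI ballI X, clarify)
    fix \<phi> \<psi> assume "(\<phi>, \<psi>) \<in> X_space s V1 V2"
    then obtain \<phi>' \<psi>' where \<phi>: "\<phi>' \<in> borel_potential s V1" "AE x in lborel. \<phi> x = \<phi>' x" and \<psi>: "\<psi>' \<in> borel_potential s V2" "AE x in lborel. \<psi> x = \<psi>' x"
      by (rule X_space_representative)
    note [measurable] = F1.borel_potentialD(1)[OF \<phi>(1)] F2.borel_potentialD(1)[OF \<psi>(1)]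
    note XI = X_inner_eq_borel[OF zX refl_AE wX refl_AE \<phi> \<psi>]
    have "AE x in lborel. coupling_test_integrand \<alpha> \<beta> (z, w) (\<phi>, \<psi>) x = coupling_test \<alpha> \<beta> z w \<phi>' \<psi>' x"
      using \<phi>(2) \<psi>(2)
    proof eventually_elim
      case (elim x)
      have "\<bar>z x\<bar> powr (\<alpha> - 2) * z x = z x powr (\<alpha> - 1)" "\<bar>w x\<bar> powr (\<beta> - 2) * w x = w x powr (\<beta> - 1)"
        using powr_mult_base[OF zw(2)[of x], of "\<alpha> - 2"] powr_mult_base[OF zw(3)[of x], of "\<beta> - 2"] zw(2,3)[of x]
        by (simp_all add: mult.commute)
      then have "\<alpha> * (\<bar>z x\<bar> powr (\<alpha> - 2) * z x) * \<phi> x * \<bar>w x\<bar> powr \<beta> + \<beta> * \<bar>z x\<bar> powr \<alpha> * (\<bar>w x\<bar> powr (\<beta> - 2) * w x) * \<psi> x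
        = coupling_test \<alpha> \<beta> z w \<phi>' \<psi>' x"
        using elim zw(2,3)[of x] by (simp add: coupling_test_def)
      then show ?case by (simp add: coupling_test_integrand_def mult.assoc)
    qed
    note CI = lebesgue_integral_eq_borel[OF coupling_test_measurable[OF M.z_borel M.w_borel F1.borel_potentialD(1)[OF \<phi>(1)] F2.borel_potentialD(1)[OF \<psi>(1)]] this]
    \<comment> \<open>Positivity of \<open>z\<close> almost everywhere confines the value
      \<open>\<infinity>\<close> of \<open>sing_powr\<close> to a null set.\<close>
    have "AE x in lborel. sing_test_integrand a p z \<phi> x = ereal (a' x * (\<phi>' x * z x powr (- p)))"
      using a'(2) \<phi>(2) M.z_pos by eventually_elim (simp add: sing_test_integrand_def sing_powr_def mult_ac)
    note SA = ext_integral_eq_borel[OF M.Gs_integrable[OF \<phi>(1)] this]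
    have "AE x in lborel. sing_test_integrand b q w \<psi> x = ereal (b' x * (\<psi>' x * w x powr (- q)))"
      using b'(2) \<psi>(2) M.w_pos by eventually_elim (simp add: sing_test_integrand_def sing_powr_def mult_ac)
    note SB = ext_integral_eq_borel[OF M.Hs_integrable[OF \<psi>(1)] this]
    show "integrable lebesgue (X_gagliardo_integrand s (z, w) (\<phi>, \<psi>)) \<and>
        integrable lebesgue (X_potential_integrand V1 V2 (z, w) (\<phi>, \<psi>)) \<and>
        integrable lebesgue (coupling_test_integrand \<alpha> \<beta> (z, w) (\<phi>, \<psi>)) \<and>
        ext_integrable lebesgue (sing_test_integrand a p z \<phi>) \<and>
        ext_integrable lebesgue (sing_test_integrand b q w \<psi>) \<and>
        X_inner s V1 V2 (z, w) (\<phi>, \<psi>)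
          - \<theta> / (\<alpha> + \<beta>) * integral\<^sup>L lebesgue (coupling_test_integrand \<alpha> \<beta> (z, w) (\<phi>, \<psi>))
          - lam * (ext_integral lebesgue (sing_test_integrand a p z \<phi>) +
                   ext_integral lebesgue (sing_test_integrand b q w \<psi>)) = 0"
      using XI CI SA SB M.coupling_test_integrable[OF \<phi>(1) \<psi>(1)] M.euler_lagrange[OF \<phi>(1) \<psi>(1)]
      by (simp add: M.ell_def M.T_def M.Gs_def M.Hs_def)
  qed
  define D where "D u v t = t powr (1 - p) * S.A u / (1 - p) + t powr (1 - q) * S.B v / (1 - q)" for u v t
  define Re where "Re u v t = R_e s V1 V2 a b p q \<alpha> \<beta> \<theta> (\<lambda>x. t * u x, \<lambda>x. t * v x)" for u v and t :: real
  have D_pos: "0 < D u v t" if "u \<in> borel_potential s V1" "v \<in> borel_potential s V2" "0 < S.C u v" "0 < t" for u v t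
  proof -
    have "0 < t powr (1 - p) * S.A u / (1 - p)" using S.A_pos[OF that(1-3)] that(4) p1 by simp
    moreover have "0 \<le> t powr (1 - q) * S.B v / (1 - q)" using pq by simp
    ultimately show ?thesis by (simp add: D_def)
  qed
  \<comment> \<open>On each such fibre the sign of the energy is that of \<open>Re - lam\<close>,
    because \<open>D\<close> is positive. Primed functions are Borel representatives, needed because
    the infimum runs over all of \<open>A_set\<close>.\<close>
  have Re: "S.energy_along u' v' t = (Re u v t - lam) * D u' v' t"
    if uv: "u' \<in> borel_potential s V1" "AE x in lborel. u x = u' x" "v' \<in> borel_potential s V2" "AE x in lborel. v x = v' x" "0 < S.C u' v'" and t: "0 < t" for u v u' v' t
  proof -
    have "Re u v t = (1 / 2 * (t\<^sup>2 * S.norm_square u' v') - \<theta> / (\<alpha> + \<beta>) * (t powr (\<alpha> + \<beta>) * S.C u' v')) / D u' v' t"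
      unfolding Re_def R_e_def prod.case sf[OF uv(1-4) t] by (simp add: D_def S.norm_square_def)
    then have "Re u v t * D u' v' t = 1 / 2 * (t\<^sup>2 * S.norm_square u' v') - \<theta> / (\<alpha> + \<beta>) * (t powr (\<alpha> + \<beta>) * S.C u' v')"
      using D_pos[OF uv(1,3,5) t] by simp
    moreover have "lam * D u' v' t = lam / (1 - p) * (t powr (1 - p) * S.A u') + lam / (1 - q) * (t powr (1 - q) * S.B v')"
      by (simp add: D_def distrib_left)
    ultimately show ?thesis by (simp add: F.fibre_energy_def left_diff_distrib)
  qed
  note Re_zw = Re[OF zX refl_AE wX refl_AE zwD(5)]
  have rep: "\<exists>u' v'. u' \<in> borel_potential s V1 \<and> v' \<in> borel_potential s V2 \<and> 0 < S.C u' v' \<and>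
      (\<forall>t>0. S.energy_along u' v' t = (Re u v t - lam) * D u' v' t)"
    if uv: "(u, v) \<in> A_set s V1 V2 \<alpha> \<beta>" for u v
  proof -
    obtain u' v' where uv': "u' \<in> borel_potential s V1" "AE x in lborel. u x = u' x" "v' \<in> borel_potential s V2" "AE x in lborel. v x = v' x"
      using X_space_representative[of u v] uv unfolding A_set_def by blast
    have "0 < S.C u' v'"
      using uv coupling_int_eq_borel[OF F1.borel_potentialD(1)[OF uv'(1)] F2.borel_potentialD(1)[OF uv'(3)] uv'(2,4)] by (simp add: A_set_def)
    then show ?thesis using Re[OF uv'] uv' by blast
  qed
  have lower: "lambda_lower s V1 V2 a b p q \<alpha> \<beta> \<theta> = (INF (u, v)\<in>A_set s V1 V2 \<alpha> \<beta>. SUP t\<in>{0<..}. ereal (Re u v t))"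
    by (simp add: lambda_lower_def Re_def)
  have lower_le: "lambda_lower s V1 V2 a b p q \<alpha> \<beta> \<theta> \<le> (SUP t\<in>{0<..}. ereal (Re z w t))"
    unfolding lower using INF_lower[OF inA, of "\<lambda>(u, v). SUP t\<in>{0<..}. ereal (Re u v t)"] by simp
  \<comment> \<open>A strict lower bound on the infimum speaks about every pair and is applied to
    the minimizer; a strict upper bound, in \<open>below\<close>, speaks about some pair, which then
    serves as a competitor.\<close>
  have above: "\<exists>t>0. x < Re z w t" if "ereal x < lambda_lower s V1 V2 a b p q \<alpha> \<beta> \<theta>" for x
  proof -
    have "ereal x < (SUP t\<in>{0<..}. ereal (Re z w t))" using that lower_le by (rule less_le_trans)
    then show ?thesis by (auto simp: less_SUP_iff)
  qed
  have below: "\<exists>u v. (u, v) \<in> A_set s V1 V2 \<alpha> \<beta> \<and> (\<forall>t>0. Re u v t < x)"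
    if x: "lambda_lower s V1 V2 a b p q \<alpha> \<beta> \<theta> < ereal x" for x
  proof -
    obtain U where "U \<in> A_set s V1 V2 \<alpha> \<beta>" "(case U of (u, v) \<Rightarrow> SUP t\<in>{0<..}. ereal (Re u v t)) < ereal x"
      using x unfolding lower INF_less_iff by blast
    then obtain u v where uv: "(u, v) \<in> A_set s V1 V2 \<alpha> \<beta>" "(SUP t\<in>{0<..}. ereal (Re u v t)) < ereal x"
      by (cases U) auto
    have "Re u v t < x" if "0 < t" for t
      using le_less_trans[OF SUP_upper[of t "{0<..}" "\<lambda>t. ereal (Re u v t)"] uv(2)] that by simp
    then show ?thesis using uv(1) by blast
  qed
  have pos: "0 < S.J z w" if L: "ereal lam < lambda_lower s V1 V2 a b p q \<alpha> \<beta> \<theta>"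
  proof -
    obtain t where t: "0 < t" "lam < Re z w t" using above[OF L] by blast
    have "0 < S.energy_along z w t"
      using Re_zw[OF t(1)] t(2) D_pos[OF zX wX zwD(5) t(1)] by simp
    then show ?thesis by (rule M.energy_pos[OF t(1)])
  qed
  \<comment> \<open>At the borderline neither bound is strict, so both inequalities go through an
    arbitrary \<open>e > 0\<close>: the quotient of the minimizer exceeds \<open>lam - e\<close>
    somewhere, and some pair has its quotient below \<open>lam + e\<close> everywhere.\<close>
  have zero: "S.J z w = 0" if L: "ereal lam = lambda_lower s V1 V2 a b p q \<alpha> \<beta> \<theta>"
  proof (rule antisym)
    show "0 \<le> S.J z w"
    proof (rule M.energy_nonneg)
      fix e :: real assume e: "0 < e"
      have "ereal (lam - e) < lambda_lower s V1 V2 a b p q \<alpha> \<beta> \<theta>" unfolding L[symmetric] using e by simp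
      then obtain t where t: "0 < t" "lam - e < Re z w t" using above by blast
      have "0 < (Re z w t - lam + e) * D z w t" using t D_pos[OF zX wX zwD(5) t(1)] by simp
      also have "\<dots> = S.energy_along z w t + e * D z w t"
        using Re_zw[OF t(1)] by (simp add: algebra_simps)
      finally show "\<exists>t>0. 0 < S.energy_along z w t + e * (t powr (1 - p) * S.A z / (1 - p) + t powr (1 - q) * S.B w / (1 - q))"
        using t(1) by (auto simp: D_def)
    qed
    show "S.J z w \<le> 0"
    proof (rule M.energy_nonpos)
      fix e :: real assume e: "0 < e"
      have "lambda_lower s V1 V2 a b p q \<alpha> \<beta> \<theta> < ereal (lam + e)" unfolding L[symmetric] using e by simp
      then obtain u v where uv: "(u, v) \<in> A_set s V1 V2 \<alpha> \<beta>" "\<And>t. 0 < t \<Longrightarrow> Re u v t < lam + e" using below by blast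
      obtain u' v' where uv': "u' \<in> borel_potential s V1" "v' \<in> borel_potential s V2" "0 < S.C u' v'"
        "\<And>t. 0 < t \<Longrightarrow> S.energy_along u' v' t = (Re u v t - lam) * D u' v' t"
        using rep[OF uv(1)] by blast
      have "S.energy_along u' v' t \<le> e * D u' v' t" if "0 < t" for t
        unfolding uv'(4)[OF that] using uv(2)[OF that] D_pos[OF uv'(1-3) that] by (intro mult_right_mono) auto
      then show "\<exists>u v. u \<in> borel_potential s V1 \<and> v \<in> borel_potential s V2 \<and> 0 < S.C u v \<and>
          (\<forall>t>0. S.energy_along u v t \<le> e * (t powr (1 - p) * S.A u / (1 - p) + t powr (1 - q) * S.B v / (1 - q)))"
        using uv' unfolding D_def by blast
    qed
  qed
  have neg: "S.J z w < 0" if L: "lambda_lower s V1 V2 a b p q \<alpha> \<beta> \<theta> < ereal lam"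
  proof -
    obtain u v where uv: "(u, v) \<in> A_set s V1 V2 \<alpha> \<beta>" "\<And>t. 0 < t \<Longrightarrow> Re u v t < lam" using below[OF L] by blast
    obtain u' v' where uv': "u' \<in> borel_potential s V1" "v' \<in> borel_potential s V2" "0 < S.C u' v'"
      "\<And>t. 0 < t \<Longrightarrow> S.energy_along u' v' t = (Re u v t - lam) * D u' v' t"
      using rep[OF uv(1)] by blast
    show ?thesis
    proof (rule M.energy_neg[OF uv'(1-3)])
      fix t :: real assume t: "0 < t"
      show "S.energy_along u' v' t < 0"
        unfolding uv'(4)[OF t] using uv(2)[OF t] D_pos[OF uv'(1-3) t] by (simp add: mult_less_0_iff)
    qed
  qed
  show ?thesis
  proof (rule exI[of _ z], rule exI[of _ w], intro conjI impI weak inA e2)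
    show "(z, w) \<in> nehari_minus s V1 V2 a b p q \<alpha> \<beta> \<theta> lam \<inter> A_set s V1 V2 \<alpha> \<beta>" using inN inA by simp
    show "nehari_minus s V1 V2 a b p q \<alpha> \<beta> \<theta> lam \<inter> A_set s V1 V2 \<alpha> \<beta> = nehari_minus s V1 V2 a b p q \<alpha> \<beta> \<theta> lam"
      using sub by blast
  qed (use E pos zero neg in auto)
qed

end
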